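(* Let $\Omega=(a,b)\times(c,d)\subset\mathbb{R}^2$, $\lambda\in\mathbb{R}\setminus\{0\}$, and let $u$ be a solution on $[0,T]$, with $0<T<T_{\max}$, of $$\mathrm{i}\,\partial_t u+\Delta u=\lambda u\ln(|u|^2)\ \text{ in }\Omega,\qquad u=0\ \text{ on }\partial\Omega,\qquad u(\cdot,0)=u_0,$$ satisfying $$u\in C^3([0,T];L^{\infty}(\Omega))\cap C^2([0,T];W^{2,\infty}(\Omega))\cap C^0([0,T];W^{4,\infty}(\Omega)\cap H^1_0(\Omega)).$$ Assume that the meshes satisfy $h\lesssim h_{\min}$, i.e. $h\le C\,h_{\min}$ with a constant $C$ independent of $\tau$ and $h$. Then there exist $h_0>0$ and $\tau_0>0$ sufficiently small such that, whenever $0<h\le h_0$ and $0<\tau\le\tau_0$, the solution $u^n$ of the BDF2 scheme $$\mathrm{i}\,\frac{3u^{n+1}_{j,k}-4u^n_{j,k}+u^{n-1}_{j,k}}{2\tau}+\delta^2_{\nabla}u^{n+1}_{j,k}=2\lambda f(2u^n_{j,k}-u^{n-1}_{j,k}),\quad n=1,\dots,N-1,$$ $$\mathrm{i}\,\frac{u^{1}_{j,k}-u^0_{j,k}}{\tau}+\delta^2_{\nabla}u^{1}_{j,k}=2\lambda f(u^0_{j,k}),$$ (both for $1\le j\le J-1$, $1\le k\le K-1$), with $u^{n}\in X_h^0$ for all $n$ and $u^0_{j,k}=u_0(x_j,y_k)$, satisfies, with $e^n_{j,k}=u(x_j,y_k,t_n)-u^n_{j,k}$, $$\|e^n\|\le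 C_u(\tau^2|\ln(\tau)|+h^2),\qquad |e^n|_1\le C_u\,\tau^{-\frac12}(\tau^2|\ln(\tau)|+h^2),\qquad n=0,1,\dots,N,$$ where $C_u$ is a positive constant independent of $\tau$ and $h$, depending on the norms of $u$ in the regularity class above and on the parameters $|\lambda|$, $|\Omega|$ and $T$.
   Context: Here $f(z)=z\ln|z|$ for $z\in\mathbb{C}$, with $f(0)=0$ (so $\lambda u\ln(|u|^2)=2\lambda f(u)$). $T_{\max}$ is the maximal existence time of the solution $u$. Discretization: $\tau=T/N$ with $N$ a positive integer, $t_n=n\tau$; $h_x=(b-a)/J$, $h_y=(d-c)/K$ with $J,K$ positive integers; $h=\max\{h_x,h_y\}$, $h_{\min}=\min\{h_x,h_y\}$; $x_j=a+jh_x$, $y_k=c+kh_y$ for $0\le j\le J$, $0\le k\le K$. $X_h^0$ is the space of complex grid functions $(v_{j,k})_{0\le j\le J,\,0\le k\le K}$ that vanish at the boundary indices (those with $j\in\{0,J\}$ or $k\in\{0,K\}$). Finite differences: $\delta_x^+v_{j,k}=(v_{j+1,k}-v_{j,k})/h_x$, $\delta_y^+v_{j,k}=(v_{j,k+1}-v_{j,k})/h_y$, $\delta^2_{\nabla}v_{j,k}=\dfrac{v_{j+1,k}-2v_{j,k}+v_{j-1,k}}{h_x^2}+\dfrac{v_{j,k+1}-2v_{j,k}+v_{j,k-1}}{h_y^2}$. Norms on $X_h^0$: $\|v\|=\big(h_xh_y\sum_{j=1}^{J-1}\sum_{k=1}^{K-1}|v_{j,k}|^2\big)^{1/2}$ and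 $|v|_1=\big(h_xh_y\sum_{j=0}^{J-1}\sum_{k=0}^{K-1}(|\delta_x^+v_{j,k}|^2+|\delta_y^+v_{j,k}|^2)\big)^{1/2}$. *)

theory Defs
  imports "HOL-Analysis.Analysis" "HOL-Probability.Essential_Supremum"
begin

section \<open>Sobolev spaces on a bounded open subset of the plane\<close>

text \<open>Elements of all function spaces are represented by complex functions on the whole plane;
  only their values on the domain matter, and only up to null sets.\<close>

type_synonym field2 = "real \<times> real \<Rightarrow> complex"

definition partial_x :: "field2 \<Rightarrow> field2" where
  "partial_x g = (\<lambda>z. vector_derivative (\<lambda>s. g (s, snd z)) (at (fst z)))"

definition partial_y :: "field2 \<Rightarrow> field2" where
  "partial_y g = (\<lambda>z. vector_derivative (\<lambda>s. g (fst z, s)) (at (snd z)))"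

definition partials :: "nat \<Rightarrow> nat \<Rightarrow> field2 \<Rightarrow> field2" where
  "partials i j g = (partial_x ^^ i) ((partial_y ^^ j) g)"

text \<open>\<open>C\<^sub>c\<^sup>\<infinity>(\<Omega>)\<close>: requiring every iterated partial derivative to be (Frechet) differentiable
  everywhere is the same as being infinitely differentiable.\<close>

definition test_functions :: "(real \<times> real) set \<Rightarrow> field2 set" where
  "test_functions \<Omega> = {\<phi>. (\<forall>i j. partials i j \<phi> differentiable_on UNIV) \<and>
     compact (closure {z. \<phi> z \<noteq> 0}) \<and> closure {z. \<phi> z \<noteq> 0} \<subseteq> \<Omega>}"

definition L1_loc :: "(real \<times> real) set \<Rightarrow> field2 set" where
  "L1_loc \<Omega> = {v. \<forall>K. compact K \<and> K \<subseteq> \<Omega> \<longrightarrow> v absolutely_integrable_on K}"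

definition has_weak_deriv ::
    "(real \<times> real) set \<Rightarrow> nat \<Rightarrow> nat \<Rightarrow> field2 \<Rightarrow> field2 \<Rightarrow> bool" where
  "has_weak_deriv \<Omega> i j v w \<longleftrightarrow> v \<in> L1_loc \<Omega> \<and> w \<in> L1_loc \<Omega> \<and>
     (\<forall>\<phi>\<in>test_functions \<Omega>.
        (LINT z|lebesgue_on \<Omega>. v z * partials i j \<phi> z) =
        (-1) ^ (i + j) * (LINT z|lebesgue_on \<Omega>. w z * \<phi> z))"

text \<open>Weak derivatives are unique up to null sets, so the choice below is immaterial.\<close>

definition weak_deriv :: "(real \<times> real) set \<Rightarrow> nat \<Rightarrow> nat \<Rightarrow> field2 \<Rightarrow> field2" where
  "weak_deriv \<Omega> i j v = (SOME w. has_weak_deriv \<Omega> i j v w)"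

definition L2 :: "(real \<times> real) set \<Rightarrow> field2 set" where
  "L2 \<Omega> = {v. v \<in> borel_measurable (lebesgue_on \<Omega>) \<and>
              integrable (lebesgue_on \<Omega>) (\<lambda>z. (cmod (v z))\<^sup>2)}"

definition L2_norm :: "(real \<times> real) set \<Rightarrow> field2 \<Rightarrow> real" where
  "L2_norm \<Omega> v = sqrt (LINT z|lebesgue_on \<Omega>. (cmod (v z))\<^sup>2)"

definition Linf :: "(real \<times> real) set \<Rightarrow> field2 set" where
  "Linf \<Omega> = {v. v \<in> borel_measurable (lebesgue_on \<Omega>) \<and>
                esssup (lebesgue_on \<Omega>) (\<lambda>z. ereal (cmod (v z))) < \<infinity>}"

definition Linf_norm :: "(real \<times> real) set \<Rightarrow> field2 \<Rightarrow> real" where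
  "Linf_norm \<Omega> v = real_of_ereal (esssup (lebesgue_on \<Omega>) (\<lambda>z. ereal (cmod (v z))))"

definition Hk :: "(real \<times> real) set \<Rightarrow> nat \<Rightarrow> field2 set" where
  "Hk \<Omega> k = {v \<in> L2 \<Omega>. \<forall>i j. i + j \<le> k \<longrightarrow> (\<exists>w\<in>L2 \<Omega>. has_weak_deriv \<Omega> i j v w)}"

definition Hk_norm :: "(real \<times> real) set \<Rightarrow> nat \<Rightarrow> field2 \<Rightarrow> real" where
  "Hk_norm \<Omega> k v =
     sqrt (\<Sum>(i, j)\<in>{(i, j). i + j \<le> k}. (L2_norm \<Omega> (weak_deriv \<Omega> i j v))\<^sup>2)"

definition Wk_inf :: "(real \<times> real) set \<Rightarrow> nat \<Rightarrow> field2 set" where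
  "Wk_inf \<Omega> k = {v \<in> Linf \<Omega>. \<forall>i j. i + j \<le> k \<longrightarrow> (\<exists>w\<in>Linf \<Omega>. has_weak_deriv \<Omega> i j v w)}"

definition Wk_inf_norm :: "(real \<times> real) set \<Rightarrow> nat \<Rightarrow> field2 \<Rightarrow> real" where
  "Wk_inf_norm \<Omega> k v =
     Max ((\<lambda>(i, j). Linf_norm \<Omega> (weak_deriv \<Omega> i j v)) ` {(i, j). i + j \<le> k})"

text \<open>Closure of the test functions in \<open>H\<^sup>1(\<Omega>)\<close>.\<close>

definition H1_0 :: "(real \<times> real) set \<Rightarrow> field2 set" where
  "H1_0 \<Omega> = {v \<in> Hk \<Omega> 1. \<forall>\<epsilon>>0. \<exists>\<phi>\<in>test_functions \<Omega>. Hk_norm \<Omega> 1 (\<lambda>z. v z - \<phi> z) < \<epsilon>}"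

definition W4_H10 :: "(real \<times> real) set \<Rightarrow> field2 set" where
  "W4_H10 \<Omega> = Wk_inf \<Omega> 4 \<inter> H1_0 \<Omega>"

definition W4_H10_norm :: "(real \<times> real) set \<Rightarrow> field2 \<Rightarrow> real" where
  "W4_H10_norm \<Omega> v = Wk_inf_norm \<Omega> 4 v + Hk_norm \<Omega> 1 v"


section \<open>The spaces \<open>C\<^sup>m([0,T];X)\<close>\<close>

text \<open>A normed function space \<open>X\<close> is given by its set of elements \<open>V\<close> and its norm \<open>N\<close>. Time
  derivatives are derivatives with respect to \<open>N\<close>, one-sided at \<open>0\<close> and \<open>T\<close>.\<close>

definition has_time_deriv ::
    "real \<Rightarrow> field2 set \<Rightarrow> (field2 \<Rightarrow> real) \<Rightarrow> (real \<Rightarrow> field2) \<Rightarrow> real \<Rightarrow> field2 \<Rightarrow> bool" where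
  "has_time_deriv T V N u t w \<longleftrightarrow> w \<in> V \<and>
     ((\<lambda>s. N (\<lambda>z. (u s z - u t z) / complex_of_real (s - t) - w z)) \<longlongrightarrow> 0) (at t within {0..T})"

definition time_deriv ::
    "real \<Rightarrow> field2 set \<Rightarrow> (field2 \<Rightarrow> real) \<Rightarrow> (real \<Rightarrow> field2) \<Rightarrow> real \<Rightarrow> field2" where
  "time_deriv T V N u t = (SOME w. has_time_deriv T V N u t w)"

definition Cm_time ::
    "nat \<Rightarrow> real \<Rightarrow> field2 set \<Rightarrow> (field2 \<Rightarrow> real) \<Rightarrow> (real \<Rightarrow> field2) set" where
  "Cm_time m T V N = {u.
     (\<forall>l<m. \<forall>t\<in>{0..T}. \<exists>w. has_time_deriv T V N ((time_deriv T V N ^^ l) u) t w) \<and>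
     (\<forall>l\<le>m. \<forall>t\<in>{0..T}. (time_deriv T V N ^^ l) u t \<in> V \<and>
        ((\<lambda>s. N (\<lambda>z. (time_deriv T V N ^^ l) u s z - (time_deriv T V N ^^ l) u t z)) \<longlongrightarrow> 0)
          (at t within {0..T}))}"

definition Cm_time_norm ::
    "nat \<Rightarrow> real \<Rightarrow> field2 set \<Rightarrow> (field2 \<Rightarrow> real) \<Rightarrow> (real \<Rightarrow> field2) \<Rightarrow> real" where
  "Cm_time_norm m T V N u =
     Max ((\<lambda>l. SUP t\<in>{0..T}. N ((time_deriv T V N ^^ l) u t)) ` {..m})"


section \<open>The logarithmic Schroedinger equation\<close>

definition rectangle :: "real \<Rightarrow> real \<Rightarrow> real \<Rightarrow> real \<Rightarrow> (real \<times> real) set" where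
  "rectangle a b c d = {a<..<b} \<times> {c<..<d}"

text \<open>Strong solutions, of class
  \<open>C\<^sup>1([0,S];L\<^sup>2(\<Omega>)) \<inter> C([0,S];H\<^sup>2(\<Omega>) \<inter> H\<^sup>1\<^sub>0(\<Omega>))\<close>. Since \<open>H\<^sup>2(\<Omega>)\<close> embeds into the continuous
  functions on the closed rectangle, \<open>u t\<close> is taken to be the continuous representative, so that
  boundary values, initial values and values at grid points are values at points. Where
  \<open>u t z = 0\<close>, the right-hand side vanishes because of the factor \<open>u t z\<close>.\<close>

definition logSE_solution ::
    "(real \<times> real) set \<Rightarrow> real \<Rightarrow> field2 \<Rightarrow> real \<Rightarrow> (real \<Rightarrow> field2) \<Rightarrow> bool" where
  "logSE_solution \<Omega> lam u0 S u \<longleftrightarrow>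
     u \<in> Cm_time 1 S (L2 \<Omega>) (L2_norm \<Omega>) \<and>
     u \<in> Cm_time 0 S (Hk \<Omega> 2 \<inter> H1_0 \<Omega>) (Hk_norm \<Omega> 2) \<and>
     (\<forall>t\<in>{0..S}. continuous_on (closure \<Omega>) (u t)) \<and>
     (\<forall>t\<in>{0..S}. AE z in lebesgue_on \<Omega>.
        \<i> * time_deriv S (L2 \<Omega>) (L2_norm \<Omega>) u t z
          + (weak_deriv \<Omega> 2 0 (u t) z + weak_deriv \<Omega> 0 2 (u t) z)
        = complex_of_real lam * u t z * complex_of_real (ln ((cmod (u t z))\<^sup>2))) \<and>
     (\<forall>t\<in>{0..S}. \<forall>z\<in>frontier \<Omega>. u t z = 0) \<and>
     (\<forall>z\<in>closure \<Omega>. u 0 z = u0 z)"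

text \<open>The solution with given initial value is unique, so its maximal existence time depends on
  the initial value only.\<close>

definition max_existence_time :: "(real \<times> real) set \<Rightarrow> real \<Rightarrow> field2 \<Rightarrow> ereal" where
  "max_existence_time \<Omega> lam u0 = Sup {ereal S | S. 0 < S \<and> (\<exists>v. logSE_solution \<Omega> lam u0 S v)}"


section \<open>The BDF2 finite difference scheme\<close>

type_synonym grid_fun = "nat \<Rightarrow> nat \<Rightarrow> complex"

text \<open>The value at \<open>0\<close> is \<open>0\<close>, whatever \<open>ln 0\<close> is.\<close>

definition zlog :: "complex \<Rightarrow> complex" where
  "zlog z = z * complex_of_real (ln (cmod z))"

text \<open>Grid functions have indices \<open>j \<le> J\<close>, \<open>k \<le> K\<close>; values at other indices are irrelevant.\<close>

definition grid_space0 :: "nat \<Rightarrow> nat \<Rightarrow> grid_fun set" where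
  "grid_space0 J K = {v. \<forall>j\<le>J. \<forall>k\<le>K. j = 0 \<or> j = J \<or> k = 0 \<or> k = K \<longrightarrow> v j k = 0}"

definition diff_x :: "real \<Rightarrow> grid_fun \<Rightarrow> grid_fun" where
  "diff_x hx v j k = (v (j + 1) k - v j k) / complex_of_real hx"

definition diff_y :: "real \<Rightarrow> grid_fun \<Rightarrow> grid_fun" where
  "diff_y hy v j k = (v j (k + 1) - v j k) / complex_of_real hy"

text \<open>Only used for \<open>j, k \<ge> 1\<close>, where the subtraction of naturals is exact.\<close>

definition grid_laplacian :: "real \<Rightarrow> real \<Rightarrow> grid_fun \<Rightarrow> grid_fun" where
  "grid_laplacian hx hy v j k =
     (v (j + 1) k - 2 * v j k + v (j - 1) k) / complex_of_real (hx\<^sup>2)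
     + (v j (k + 1) - 2 * v j k + v j (k - 1)) / complex_of_real (hy\<^sup>2)"

definition grid_norm :: "real \<Rightarrow> real \<Rightarrow> nat \<Rightarrow> nat \<Rightarrow> grid_fun \<Rightarrow> real" where
  "grid_norm hx hy J K v = sqrt (hx * hy * (\<Sum>j=1..<J. \<Sum>k=1..<K. (cmod (v j k))\<^sup>2))"

definition grid_seminorm1 :: "real \<Rightarrow> real \<Rightarrow> nat \<Rightarrow> nat \<Rightarrow> grid_fun \<Rightarrow> real" where
  "grid_seminorm1 hx hy J K v =
     sqrt (hx * hy * (\<Sum>j<J. \<Sum>k<K. ((cmod (diff_x hx v j k))\<^sup>2 + (cmod (diff_y hy v j k))\<^sup>2)))"

definition BDF2_solution ::
    "real \<Rightarrow> real \<Rightarrow> real \<Rightarrow> real \<Rightarrow> nat \<Rightarrow> nat \<Rightarrow> nat \<Rightarrow> grid_fun \<Rightarrow> (nat \<Rightarrow> grid_fun) \<Rightarrow> bool" where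
  "BDF2_solution lam \<tau> hx hy N J K g0 U \<longleftrightarrow>
     (\<forall>n\<le>N. U n \<in> grid_space0 J K) \<and>
     (\<forall>j\<le>J. \<forall>k\<le>K. U 0 j k = g0 j k) \<and>
     (\<forall>j\<in>{1..<J}. \<forall>k\<in>{1..<K}.
        \<i> * ((U 1 j k - U 0 j k) / complex_of_real \<tau>) + grid_laplacian hx hy (U 1) j k
        = 2 * complex_of_real lam * zlog (U 0 j k)) \<and>
     (\<forall>n\<in>{1..<N}. \<forall>j\<in>{1..<J}. \<forall>k\<in>{1..<K}.
        \<i> * ((3 * U (n + 1) j k - 4 * U n j k + U (n - 1) j k) / complex_of_real (2 * \<tau>))
          + grid_laplacian hx hy (U (n + 1)) j k
        = 2 * complex_of_real lam * zlog (2 * U n j k - U (n - 1) j k))"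

end

theory Submission
  imports Defs "HOL-Real_Asymp.Real_Asymp"
begin

text \<open>
  Let \<open>e\<close> be the error at the grid points. It satisfies the scheme with right-hand side
  \<open>2 \<lambda> (f(p) - f(q)) + \<xi>\<close>, where \<open>p\<close> and \<open>q = p - w\<close>
  are the exact and the computed extrapolation and \<open>\<xi>\<close> is the residual of the exact solution. The
  estimate is consistency plus stability.

  \<^emph>\<open>Stability\<close> (\<open>BDF2_stability\<close>). The function \<open>f(z) = z ln |z|\<close>
  is not Lipschitz, but \<open>|Im ((f(p) - f(q)) cnj (p - q))| \<le> |p - q|\<^sup>2\<close>
  (\<open>Im_zlog_diff_le\<close>). The scheme is explicit in \<open>f\<close>, so the energy identity tests
  \<open>f(p) - f(q)\<close> not with \<open>w = p - q\<close> but with the new error \<open>w + s\<close>,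
  where \<open>s\<close> is the second difference of the error in time. G-stability of BDF2 supplies the
  dissipation \<open>|s|\<^sup>2\<close>, which absorbs the excess at the price of a term
  \<open>\<tau>\<^sup>2 |f(p) - f(q)|\<^sup>2\<close>. Since \<open>f\<close> is log-Lipschitz
  (\<open>zlog_diff_le\<close>), this is at most \<open>\<tau> |w|\<^sup>2\<close> plus a negligible term as soon
  as \<open>\<tau> (ln \<tau>)\<^sup>2\<close> is small. So Gronwall's inequality applies with a constant free of
  \<open>ln \<tau>\<close>.

  The log-Lipschitz bound requires \<open>|q|\<close> to be at most a power of \<open>1/\<tau>\<close>. This
  follows inductively: the scheme itself bounds the discrete Laplacian of the error, up to the residual, by
  \<open>1/\<tau>\<close> times its \<open>L\<^sup>2\<close> norm, and in the plane the discrete Laplacian controls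
  the maximum (\<open>grid_sup_le_laplacian\<close>). The same bound on the Laplacian, interpolated with the
  \<open>L\<^sup>2\<close> estimate, gives the \<open>H\<^sup>1\<close> estimate with its loss of
  \<open>\<tau> powr (- 1 / 2)\<close>.

  \<^emph>\<open>Consistency\<close> (\<open>BDF2_residual\<close>, \<open>Euler_residual\<close>). The derivatives
  of \<open>u\<close> are known only almost everywhere, while the residual is needed at grid points. Therefore the
  equation is tested with a mollifier. Averages of \<open>u\<close> are three times differentiable in time, with
  derivatives bounded by the \<open>C\<^sup>3(L\<^sup>\<infinity>)\<close> norm; they are smooth in space, with
  fourth derivatives bounded by the \<open>W\<^sup>4\<^sup>,\<^sup>\<infinity>\<close> norm; and they satisfy the
  averaged equation exactly. Taylor expansion of these scalar functions gives truncation errors of order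
  \<open>\<tau>\<^sup>2 + h\<^sup>2\<close> (\<open>\<tau> + h\<^sup>2\<close> in the first step, whose error
  is multiplied by \<open>\<tau>\<close>) that do not depend on the mollifier, and its radius can tend to
  \<open>0\<close> because \<open>u\<close> is continuous. The factor \<open>|ln \<tau>|\<close> enters when
  \<open>f(u)\<close> is replaced by \<open>f\<close> of the extrapolated value, which is at distance of order
  \<open>\<tau>\<^sup>2\<close>.

  Two facts make the norms usable. Weak derivatives are unique up to null sets, by the fundamental lemma of the
  calculus of variations (\<open>has_weak_deriv_unique\<close>), so that the chosen representatives are bounded by
  the Sobolev norms. Norms of continuous functions of time are bounded on \<open>[0,T]\<close>
  (\<open>Cm_time_bdd_above\<close>), so that the suprema in \<open>Cm_time_norm\<close> are upper bounds.
\<close>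

section \<open>Discrete calculus on the grid\<close>

lemma summation_by_parts:
  fixes p q :: "nat \<Rightarrow> complex"
  assumes "0 < J" "q 0 = 0" "q J = 0"
  shows "(\<Sum>j=1..<J. (p (j + 1) - 2 * p j + p (j - 1)) * cnj (q j))
       = - (\<Sum>j<J. (p (j + 1) - p j) * cnj (q (j + 1) - q j))"
proof -
  obtain n where J: "J = Suc n" using assms(1) by (cases J) auto
  have "(\<Sum>j=1..<Suc n. (p (j + 1) - 2 * p j + p (j - 1)) * cnj (q j))
       = - (\<Sum>j<Suc n. (p (j + 1) - p j) * cnj (q (j + 1) - q j))
         + (p (Suc n) - p n) * cnj (q (Suc n)) - (p 1 - p 0) * cnj (q 0)"
    by (induction n) (simp_all add: algebra_simps)
  then show ?thesis using assms J by simp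
qed

definition second_diff_x :: "real \<Rightarrow> grid_fun \<Rightarrow> grid_fun" where
  "second_diff_x hx v j k = (v (j + 1) k - 2 * v j k + v (j - 1) k) / complex_of_real (hx\<^sup>2)"

definition second_diff_y :: "real \<Rightarrow> grid_fun \<Rightarrow> grid_fun" where
  "second_diff_y hy v j k = (v j (k + 1) - 2 * v j k + v j (k - 1)) / complex_of_real (hy\<^sup>2)"

lemma grid_laplacian_eq:
  "grid_laplacian hx hy v j k = second_diff_x hx v j k + second_diff_y hy v j k"
  by (simp add: grid_laplacian_def second_diff_x_def second_diff_y_def)

lemma grid_space0_zero:
  assumes "v \<in> grid_space0 J K"
  shows "k \<le> K \<Longrightarrow> v 0 k = 0" "k \<le> K \<Longrightarrow> v J k = 0" "j \<le> J \<Longrightarrow> v j 0 = 0" "j \<le> J \<Longrightarrow> v j K = 0"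
  using assms by (auto simp: grid_space0_def)

lemma sum_second_diff_x:
  assumes "0 < J" "q 0 k = 0" "q J k = 0"
  shows "(\<Sum>j=1..<J. second_diff_x hx v j k * cnj (q j k))
       = - (\<Sum>j<J. diff_x hx v j k * cnj (diff_x hx q j k))"
proof -
  have "(\<Sum>j=1..<J. second_diff_x hx v j k * cnj (q j k))
      = (\<Sum>j=1..<J. (v (j+1) k - 2 * v j k + v (j-1) k) * cnj (q j k)) / complex_of_real (hx\<^sup>2)"
    by (simp add: second_diff_x_def sum_divide_distrib)
  also have "\<dots> = - (\<Sum>j<J. (v (j + 1) k - v j k) * cnj (q (j + 1) k - q j k)) / complex_of_real (hx\<^sup>2)"
    using summation_by_parts[OF assms(1), of "\<lambda>j. q j k" "\<lambda>j. v j k"] assms by simp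
  also have "\<dots> = - (\<Sum>j<J. diff_x hx v j k * cnj (diff_x hx q j k))"
    by (simp add: diff_x_def sum_divide_distrib power2_eq_square)
  finally show ?thesis .
qed

lemma sum_second_diff_y:
  assumes "0 < K" "q j 0 = 0" "q j K = 0"
  shows "(\<Sum>k=1..<K. second_diff_y hy v j k * cnj (q j k))
       = - (\<Sum>k<K. diff_y hy v j k * cnj (diff_y hy q j k))"
  using sum_second_diff_x[of K "\<lambda>k j. q j k" j hy "\<lambda>k j. v j k"] assms
  by (simp add: second_diff_x_def second_diff_y_def diff_x_def diff_y_def)

lemma sum_lessThan_eq_interior:
  fixes f :: "nat \<Rightarrow> 'a::comm_monoid_add"
  assumes "f 0 = 0"
  shows "(\<Sum>k<K. f k) = (\<Sum>k=1..<K. f k)"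
proof -
  have "{..<K} - {1..<K} \<subseteq> {0}" by auto
  then show ?thesis
    by (intro sum.mono_neutral_right) (use assms in auto)
qed

text \<open>The discrete Green identity; the right-hand side is real, so the Laplacian drops out of the
  imaginary part of the energy identity.\<close>

lemma grid_green_identity:
  assumes v: "v \<in> grid_space0 J K" and "0 < J" "0 < K" "0 < hx" "0 < hy"
  shows "complex_of_real (hx * hy) * (\<Sum>j=1..<J. \<Sum>k=1..<K. grid_laplacian hx hy v j k * cnj (v j k))
       = - complex_of_real ((grid_seminorm1 hx hy J K v)\<^sup>2)"
proof -
  note z = grid_space0_zero[OF v]
  have x: "(\<Sum>j=1..<J. \<Sum>k=1..<K. second_diff_x hx v j k * cnj (v j k))
      = - complex_of_real (\<Sum>j<J. \<Sum>k<K. (cmod (diff_x hx v j k))\<^sup>2)"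
  proof -
    have "(\<Sum>j=1..<J. \<Sum>k=1..<K. second_diff_x hx v j k * cnj (v j k))
        = (\<Sum>k=1..<K. \<Sum>j=1..<J. second_diff_x hx v j k * cnj (v j k))"
      by (rule sum.swap)
    also have "\<dots> = (\<Sum>k=1..<K. - (\<Sum>j<J. diff_x hx v j k * cnj (diff_x hx v j k)))"
      by (intro sum.cong refl sum_second_diff_x) (use assms z in auto)
    also have "\<dots> = - (\<Sum>k<K. \<Sum>j<J. diff_x hx v j k * cnj (diff_x hx v j k))"
      by (subst sum_lessThan_eq_interior[of _ K])
         (use z in \<open>auto simp: diff_x_def sum_negf intro!: sum.neutral\<close>)
    also have "\<dots> = - (\<Sum>j<J. \<Sum>k<K. diff_x hx v j k * cnj (diff_x hx v j k))"
      by (subst sum.swap) simp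
    finally show ?thesis by (simp only: complex_norm_square of_real_sum)
  qed
  have y: "(\<Sum>j=1..<J. \<Sum>k=1..<K. second_diff_y hy v j k * cnj (v j k))
      = - complex_of_real (\<Sum>j<J. \<Sum>k<K. (cmod (diff_y hy v j k))\<^sup>2)"
  proof -
    have "(\<Sum>j=1..<J. \<Sum>k=1..<K. second_diff_y hy v j k * cnj (v j k))
        = (\<Sum>j=1..<J. - (\<Sum>k<K. diff_y hy v j k * cnj (diff_y hy v j k)))"
      by (intro sum.cong refl sum_second_diff_y) (use assms z in auto)
    also have "\<dots> = - (\<Sum>j<J. \<Sum>k<K. diff_y hy v j k * cnj (diff_y hy v j k))"
      by (subst sum_lessThan_eq_interior[of _ J])
         (use z in \<open>auto simp: diff_y_def sum_negf intro!: sum.neutral\<close>)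
    finally show ?thesis by (simp only: complex_norm_square of_real_sum)
  qed
  have sq: "(grid_seminorm1 hx hy J K v)\<^sup>2
     = hx * hy * (\<Sum>j<J. \<Sum>k<K. ((cmod (diff_x hx v j k))\<^sup>2 + (cmod (diff_y hy v j k))\<^sup>2))"
    unfolding grid_seminorm1_def
    by (intro real_sqrt_pow2 mult_nonneg_nonneg sum_nonneg) (use assms in auto)
  show ?thesis
    unfolding sq using x y
    by (simp add: grid_laplacian_eq distrib_right sum.distrib algebra_simps)
qed

text \<open>Since \<open>v\<close> vanishes on the boundary, \<open>v j k\<close> is the double integral of the mixed difference
  quotient, whose \<open>L\<^sup>2\<close> norm equals the square root of the inner product of the two pure
  second differences and is therefore controlled by the Laplacian. The constant depends on the
  area only.\<close>

lemma grid_sup_le_laplacian: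
  assumes v: "v \<in> grid_space0 J K" and "0 < J" "0 < K" "0 < hx" "0 < hy" "j \<le> J" "k \<le> K"
  shows "(cmod (v j k))\<^sup>2
      \<le> (hx * real J) * (hy * real K) * (grid_norm hx hy J K (grid_laplacian hx hy v))\<^sup>2"
proof -
  note z = grid_space0_zero[OF v]
  define m where "m j k = diff_y hy (diff_x hx v) j k" for j k
  define S where "S = (\<Sum>j<J. \<Sum>k<K. (cmod (m j k))\<^sup>2)"
  have cross: "(\<Sum>j=1..<J. \<Sum>k=1..<K. second_diff_x hx v j k * cnj (second_diff_y hy v j k))
     = complex_of_real S"
  proof -
    have "(\<Sum>j=1..<J. \<Sum>k=1..<K. second_diff_x hx v j k * cnj (second_diff_y hy v j k))
        = (\<Sum>k=1..<K. \<Sum>j=1..<J. second_diff_x hx v j k * cnj (second_diff_y hy v j k))"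
      by (rule sum.swap)
    also have "\<dots> = (\<Sum>k=1..<K. - (\<Sum>j<J. diff_x hx v j k * cnj (diff_x hx (second_diff_y hy v) j k)))"
      by (intro sum.cong refl sum_second_diff_x)
         (use assms z in \<open>auto simp: second_diff_y_def\<close>)
    also have "\<dots> = - (\<Sum>j<J. \<Sum>k=1..<K. diff_x hx v j k * cnj (diff_x hx (second_diff_y hy v) j k))"
      by (subst sum.swap) (simp add: sum_negf)
    also have "\<dots> = - (\<Sum>j<J. \<Sum>k=1..<K. cnj (second_diff_y hy (diff_x hx v) j k * cnj (diff_x hx v j k)))"
    proof -
      have "diff_x hx (second_diff_y hy v) j k = second_diff_y hy (diff_x hx v) j k" for j k
        by (simp add: diff_x_def second_diff_y_def field_simps)
          (simp add: diff_divide_distrib add_divide_distrib mult.commute)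
      then show ?thesis by (simp add: mult.commute)
    qed
    also have "\<dots> = - (\<Sum>j<J. cnj (\<Sum>k=1..<K. second_diff_y hy (diff_x hx v) j k * cnj (diff_x hx v j k)))"
      by simp
    also have "\<dots> = - (\<Sum>j<J. cnj (- (\<Sum>k<K. m j k * cnj (m j k))))"
    proof -
      have "(\<Sum>k=1..<K. second_diff_y hy (diff_x hx v) j k * cnj (diff_x hx v j k))
          = - (\<Sum>k<K. m j k * cnj (m j k))" if "j < J" for j
        unfolding m_def
        by (rule sum_second_diff_y) (use assms z that in \<open>auto simp: diff_x_def\<close>)
      then show ?thesis
        by (intro arg_cong[where f = uminus] sum.cong refl arg_cong[where f = cnj]) auto
    qed
    also have "\<dots> = complex_of_real S"
      by (simp add: sum_negf S_def complex_norm_square[symmetric] mult.commute flip: of_real_power)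
    finally show ?thesis .
  qed
  have "S \<le> (\<Sum>j=1..<J. \<Sum>k=1..<K. (cmod (grid_laplacian hx hy v j k))\<^sup>2)"
  proof -
    have pw: "Re (p * cnj q) \<le> (cmod (p + q))\<^sup>2" for p q :: complex
    proof -
      have r: "x * y \<le> (x + y)\<^sup>2" for x y :: real
      proof -
        have "(x + y)\<^sup>2 - x * y = (x + y / 2)\<^sup>2 + 3 / 4 * y\<^sup>2"
          by (simp add: power2_eq_square field_simps)
        then show ?thesis using zero_le_power2[of "x + y / 2"] zero_le_power2[of y] by linarith
      qed
      show ?thesis using r[of "Re p" "Re q"] r[of "Im p" "Im q"] by (simp add: cmod_power2)
    qed
    have "S = Re (\<Sum>j=1..<J. \<Sum>k=1..<K. second_diff_x hx v j k * cnj (second_diff_y hy v j k))"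
      by (simp only: cross Re_complex_of_real)
    also have "\<dots> = (\<Sum>j=1..<J. \<Sum>k=1..<K. Re (second_diff_x hx v j k * cnj (second_diff_y hy v j k)))"
      by simp
    also have "\<dots> \<le> (\<Sum>j=1..<J. \<Sum>k=1..<K. (cmod (grid_laplacian hx hy v j k))\<^sup>2)"
      unfolding grid_laplacian_eq by (intro sum_mono pw)
    finally show ?thesis .
  qed
  then have S: "hx * hy * S \<le> (grid_norm hx hy J K (grid_laplacian hx hy v))\<^sup>2"
    unfolding grid_norm_def using assms by (subst real_sqrt_pow2) (auto intro!: sum_nonneg mult_nonneg_nonneg)
  have v_eq: "v j k = complex_of_real (hx * hy) * (\<Sum>j'<j. \<Sum>k'<k. m j' k')"
  proof -
    have "complex_of_real (hx * hy) * (\<Sum>k'<k. m j' k') = v (Suc j') k - v j' k" if "j' < j" for j'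
    proof -
      have "complex_of_real (hx * hy) * (\<Sum>k'<k. m j' k')
          = (\<Sum>k'<k. (v (Suc j') (Suc k') - v j' (Suc k')) - (v (Suc j') k' - v j' k'))"
        unfolding sum_distrib_left m_def diff_x_def diff_y_def
        using assms by (intro sum.cong) (auto simp: field_simps)
      also have "\<dots> = v (Suc j') k - v j' k"
        using z that assms by (subst sum_lessThan_telescope) auto
      finally show ?thesis .
    qed
    then have "complex_of_real (hx * hy) * (\<Sum>j'<j. \<Sum>k'<k. m j' k') = (\<Sum>j'<j. v (Suc j') k - v j' k)"
      by (simp add: sum_distrib_left)
    also have "\<dots> = v j k" using z assms by (subst sum_lessThan_telescope) auto
    finally show ?thesis by simp
  qed
  have "cmod (v j k) \<le> hx * hy * (\<Sum>j'<j. \<Sum>k'<k. cmod (m j' k'))"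
    unfolding v_eq norm_mult using assms
    by (intro mult_mono order.trans[OF norm_sum] sum_mono) (auto simp: norm_mult)
  also have "\<dots> \<le> hx * hy * (\<Sum>j<J. \<Sum>k<K. cmod (m j k))"
    using assms by (intro mult_left_mono order.trans[OF sum_mono sum_mono2] sum_mono2 sum_nonneg) auto
  also have "(\<Sum>j<J. \<Sum>k<K. cmod (m j k)) = (\<Sum>(j,k)\<in>{..<J}\<times>{..<K}. 1 * cmod (m j k))"
    by (simp add: sum.cartesian_product)
  finally have "(cmod (v j k))\<^sup>2 \<le> (hx * hy * (\<Sum>(j,k)\<in>{..<J}\<times>{..<K}. 1 * cmod (m j k)))\<^sup>2"
    by (intro power_mono) auto
  also have "\<dots> = (hx * hy)\<^sup>2 * (\<Sum>x\<in>{..<J}\<times>{..<K}. 1 * cmod (m (fst x) (snd x)))\<^sup>2"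
    by (simp add: power_mult_distrib case_prod_unfold)
  also have "\<dots> \<le> (hx * hy)\<^sup>2 * ((\<Sum>x\<in>{..<J}\<times>{..<K}. 1\<^sup>2) * (\<Sum>x\<in>{..<J}\<times>{..<K}. (cmod (m (fst x) (snd x)))\<^sup>2))"
    by (intro mult_left_mono Cauchy_Schwarz_ineq_sum) auto
  also have "\<dots> = (hx * real J) * (hy * real K) * (hx * hy * S)"
    by (simp add: S_def sum.cartesian_product case_prod_unfold power2_eq_square)
  also have "\<dots> \<le> (hx * real J) * (hy * real K) * (grid_norm hx hy J K (grid_laplacian hx hy v))\<^sup>2"
    using assms by (intro mult_left_mono S) auto
  finally show ?thesis .
qed

section \<open>The logarithmic nonlinearity\<close>

lemma ln_diff_le:
  fixes x y :: real
  assumes "0 < y" "y \<le> x"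
  shows "0 \<le> ln x - ln y" "y * (ln x - ln y) \<le> x - y"
proof -
  show "0 \<le> ln x - ln y" using assms by simp
  have "ln x - ln y = ln (x / y)" using assms by (simp add: ln_div)
  also have "\<dots> \<le> x / y - 1" using assms by (intro ln_le_minus_one) auto
  finally have "y * (ln x - ln y) \<le> y * (x / y - 1)" using assms by (intro mult_left_mono) auto
  then show "y * (ln x - ln y) \<le> x - y" using assms by (simp add: right_diff_distrib)
qed

lemma zlog_0 [simp]: "zlog 0 = 0" by (simp add: zlog_def)

text \<open>In the imaginary part the unbounded logarithm enters only through \<open>ln |p| - ln |q|\<close>, multiplied
  by a quantity of size \<open>min |p| |q| * |p - q|\<close>.\<close>

lemma Im_zlog_diff_le:
  "\<bar>Im ((zlog p - zlog q) * cnj (p - q))\<bar> \<le> (cmod (p - q))\<^sup>2"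
proof -
  have main: "\<bar>Im ((zlog p - zlog q) * cnj (p - q))\<bar> \<le> (cmod (p - q))\<^sup>2"
    if le: "cmod q \<le> cmod p" for p q
  proof (cases "q = 0")
    case True
    then show ?thesis by (simp add: zlog_def)
  next
    case False
    then have pos: "0 < cmod q" by simp
    define l where "l = ln (cmod p) - ln (cmod q)"
    note l = ln_diff_le[OF pos le, folded l_def]
    have "Im ((zlog p - zlog q) * cnj (p - q)) = - (l * Im ((p - q) * cnj q))"
      by (simp add: zlog_def l_def algebra_simps)
    then have "\<bar>Im ((zlog p - zlog q) * cnj (p - q))\<bar> = l * \<bar>Im ((p - q) * cnj q)\<bar>"
      using l by (simp add: abs_mult)
    also have "\<dots> \<le> l * (cmod (p - q) * cmod q)"
      using abs_Im_le_cmod[of "(p - q) * cnj q"] l by (intro mult_left_mono) (auto simp: norm_mult)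
    also have "\<dots> = (cmod q * l) * cmod (p - q)" by simp
    also have "\<dots> \<le> cmod (p - q) * cmod (p - q)"
      using l norm_triangle_ineq2[of p q] by (intro mult_right_mono) auto
    finally show ?thesis by (simp add: power2_eq_square)
  qed
  show ?thesis
  proof (cases "cmod q \<le> cmod p")
    case False
    have "(zlog p - zlog q) * cnj (p - q) = (zlog q - zlog p) * cnj (q - p)"
      by (simp add: algebra_simps)
    then show ?thesis using main[of p q] False by (simp add: norm_minus_commute)
  qed (use main in auto)
qed

text \<open>Log-Lipschitz continuity with a free threshold \<open>\<epsilon>\<close>: below it the logarithm is traded for the
  additive term.\<close>

lemma zlog_diff_le:
  assumes \<epsilon>: "0 < \<epsilon>" "\<epsilon> \<le> 1" and B: "1 \<le> B" "cmod p \<le> B" "cmod q \<le> B"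
  shows "cmod (zlog p - zlog q) \<le> (1 + ln B + ln (1 / \<epsilon>)) * cmod (p - q) + 2 * \<epsilon>"
proof -
  have main: "cmod (zlog p - zlog q) \<le> (1 + ln B + ln (1 / \<epsilon>)) * cmod (p - q) + 2 * \<epsilon>"
    if le: "cmod q \<le> cmod p" and p: "cmod p \<le> B" for p q
  proof (cases "p = 0")
    case True
    then show ?thesis using le \<epsilon> by simp
  next
    case False
    define m where "m = cmod p"
    have m: "0 < m" using False by (simp add: m_def)
    have d: "cmod (p - q) \<le> 2 * m"
      using norm_triangle_ineq4[of p q] le by (simp add: m_def)
    have lnB: "0 \<le> ln B" "0 \<le> ln (1 / \<epsilon>)" using B \<epsilon> by (auto simp: ln_div)
    have t1: "cmod (p - q) * \<bar>ln m\<bar> \<le> (ln B + ln (1 / \<epsilon>)) * cmod (p - q) + 2 * \<epsilon>"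
    proof (cases "\<epsilon> \<le> m")
      case True
      have "\<bar>ln m\<bar> \<le> ln B + ln (1 / \<epsilon>)"
      proof (cases "1 \<le> m")
        case True
        then have "ln m \<le> ln B" "0 \<le> ln m" using p m by (auto simp: m_def)
        then show ?thesis using lnB by simp
      next
        case False
        then have "ln \<epsilon> \<le> ln m" "ln m < 0" using True m \<epsilon> by auto
        then show ?thesis using lnB \<epsilon> by (simp add: ln_div)
      qed
      then have "cmod (p - q) * \<bar>ln m\<bar> \<le> cmod (p - q) * (ln B + ln (1 / \<epsilon>))"
        by (intro mult_left_mono) auto
      then show ?thesis using \<epsilon> by (simp add: mult.commute)
    next
      case False
      then have "m < 1" using \<epsilon> by simp
      then have "\<bar>ln m\<bar> = ln (1 / \<epsilon>) + (ln \<epsilon> - ln m)" using m \<epsilon> by (simp add: ln_div)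
      moreover have "m * (ln \<epsilon> - ln m) \<le> \<epsilon>" and pos: "0 \<le> ln \<epsilon> - ln m"
        using ln_diff_le[of m \<epsilon>] m False by auto
      moreover have "cmod (p - q) * (ln \<epsilon> - ln m) \<le> 2 * m * (ln \<epsilon> - ln m)"
        using d pos by (intro mult_right_mono) auto
      ultimately have "cmod (p - q) * \<bar>ln m\<bar> \<le> cmod (p - q) * ln (1 / \<epsilon>) + 2 * \<epsilon>"
        by (simp add: distrib_left)
      moreover have "0 \<le> ln B * cmod (p - q)" using lnB by simp
      ultimately show ?thesis by (simp add: algebra_simps)
    qed
    have t2: "cmod q * \<bar>ln m - ln (cmod q)\<bar> \<le> cmod (p - q)"
    proof (cases "q = 0")
      case False
      then show ?thesis
        using ln_diff_le[of "cmod q" m] le norm_triangle_ineq2[of p q] by (simp add: m_def)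
    qed simp
    have "zlog p - zlog q = (p - q) * complex_of_real (ln m) + q * complex_of_real (ln m - ln (cmod q))"
      by (simp add: zlog_def m_def algebra_simps)
    then have "cmod (zlog p - zlog q) \<le> cmod (p - q) * \<bar>ln m\<bar> + cmod q * \<bar>ln m - ln (cmod q)\<bar>"
      using norm_triangle_ineq[of "(p - q) * complex_of_real (ln m)"
          "q * complex_of_real (ln m - ln (cmod q))"]
      by (simp only: norm_mult norm_of_real)
    then show ?thesis using t1 t2 by (simp add: algebra_simps)
  qed
  show ?thesis
  proof (cases "cmod q \<le> cmod p")
    case False
    then show ?thesis using main[of p q] B by (simp add: norm_minus_commute)
  qed (use main B in auto)
qed

lemma isCont_zlog: "isCont zlog z"
proof -
  define R where "R = cmod z + 2"
  have R: "1 \<le> R" by (simp add: R_def)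
  show ?thesis
    unfolding isCont_def
  proof (rule LIM_I)
    fix r :: real assume r: "0 < r"
    define \<epsilon> where "\<epsilon> = min 1 (r / 4)"
    have \<epsilon>: "0 < \<epsilon>" "\<epsilon> \<le> 1" "2 * \<epsilon> \<le> r / 2" using r by (auto simp: \<epsilon>_def)
    define c where "c = 1 + ln R + ln (1 / \<epsilon>)"
    have "0 \<le> ln R" "0 \<le> ln (1 / \<epsilon>)" using R \<epsilon> by (auto simp: ln_div)
    then have c: "0 < c" by (simp add: c_def)
    have "cmod (zlog w - zlog z) < r" if "cmod (w - z) < min 1 (r / (2 * c))" for w
    proof -
      have "cmod w \<le> R" using norm_triangle_sub[of w z] that by (simp add: R_def)
      then have "cmod (zlog w - zlog z) \<le> c * cmod (w - z) + 2 * \<epsilon>"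
        using zlog_diff_le[OF \<epsilon>(1,2) R, of w z] by (simp add: c_def R_def)
      moreover have "c * cmod (w - z) < c * (r / (2 * c))" using that c by (intro mult_strict_left_mono) auto
      ultimately show ?thesis using \<epsilon> c by (simp add: field_simps)
    qed
    then show "\<exists>s>0. \<forall>x. x \<noteq> z \<and> norm (x - z) < s \<longrightarrow> norm (zlog x - zlog z) < r"
      using r c by (intro exI[of _ "min 1 (r / (2 * c))"]) auto
  qed
qed

section \<open>Stability of the scheme\<close>

text \<open>G-stability of BDF2: the increment of the squared norm \<open>|a|\<^sup>2 + |2 a - b|\<^sup>2\<close> of two consecutive values,
  plus a numerical dissipation, which is the square of the second difference.\<close>

lemma BDF2_G_identity:
  fixes a b c :: complex
  shows "2 * Re ((3 * a - 4 * b + c) * cnj a)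
     = (cmod a)\<^sup>2 + (cmod (2 * a - b))\<^sup>2 - (cmod b)\<^sup>2 - (cmod (2 * b - c))\<^sup>2 + (cmod (a - 2 * b + c))\<^sup>2"
proof -
  have real: "2 * ((3 * a - 4 * b + c) * a) = a\<^sup>2 + (2 * a - b)\<^sup>2 - b\<^sup>2 - (2 * b - c)\<^sup>2 + (a - 2 * b + c)\<^sup>2"
    for a b c :: real
    by (simp add: power2_eq_square algebra_simps)
  have ri: "Re (numeral n * z) = numeral n * Re z" "Im (numeral n * z) = numeral n * Im z" for n z
    by simp_all
  have "2 * Re ((3 * a - 4 * b + c) * cnj a)
      = 2 * ((3 * Re a - 4 * Re b + Re c) * Re a) + 2 * ((3 * Im a - 4 * Im b + Im c) * Im a)"
    by (simp add: algebra_simps)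
  then show ?thesis
    unfolding cmod_power2 minus_complex.sel plus_complex.sel ri
    using real[of "Re a" "Re b" "Re c"] real[of "Im a" "Im b" "Im c"] by linarith
qed

lemma square_add_le: "(x + y)\<^sup>2 \<le> 2 * x\<^sup>2 + 2 * (y::real)\<^sup>2"
  using sum_squares_bound[of x y] by (simp add: power2_sum)

text \<open>The nonlinear term is tested with the new error, \<open>w + s\<close>, while one-sided control is available
  only against the extrapolated error \<open>w\<close>. The remainder \<open>s\<close> is absorbed by the numerical dissipation
  \<open>|s|\<^sup>2\<close> of the scheme, at the price of \<open>\<tau>\<^sup>2 |F|\<^sup>2\<close>; the large Lipschitz constant \<open>\<alpha>\<close> of \<open>F\<close> is therefore
  harmless once \<open>\<tau> \<alpha>\<^sup>2\<close> is bounded.\<close>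

lemma BDF2_pointwise_energy:
  fixes e0 e1 e2 L F x :: complex and \<tau> lam :: real
  defines "w \<equiv> 2 * e1 - e0"
  assumes scheme: "\<i> * ((3 * e2 - 4 * e1 + e0) / complex_of_real (2 * \<tau>)) + L
                   = 2 * complex_of_real lam * F + x"
    and F: "\<bar>Im (F * cnj w)\<bar> \<le> (cmod w)\<^sup>2" "cmod F \<le> \<alpha> * cmod w + \<beta>"
    and x: "cmod x \<le> r" and \<tau>: "0 < \<tau>" "\<tau> \<le> 1" and \<alpha>: "0 \<le> \<alpha>" "64 * lam\<^sup>2 * \<tau> * \<alpha>\<^sup>2 \<le> 1" and \<beta>: "0 \<le> \<beta>"
  shows "(cmod e2)\<^sup>2 + (cmod (2 * e2 - e1))\<^sup>2 + 4 * \<tau> * Im (L * cnj e2)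
     \<le> (1 + (8 * \<bar>lam\<bar> + 2) * \<tau>) * ((cmod e1)\<^sup>2 + (cmod (2 * e1 - e0))\<^sup>2)
       + \<tau> * (12 * r\<^sup>2 + 64 * lam\<^sup>2 * \<tau> * \<beta>\<^sup>2)"
proof -
  define s where "s = e2 - 2 * e1 + e0"
  have e2: "e2 = w + s" by (simp add: w_def s_def)
  have r: "0 \<le> r" using x norm_ge_zero[of x] by linarith
  define D where "D = \<i> * ((3 * e2 - 4 * e1 + e0) / complex_of_real (2 * \<tau>))"
  have dt: "4 * \<tau> * Im (D * cnj e2) = 2 * Re ((3 * e2 - 4 * e1 + e0) * cnj e2)"
  proof -
    have "D * cnj e2 = \<i> * (((3 * e2 - 4 * e1 + e0) * cnj e2) / complex_of_real (2 * \<tau>))"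
      by (simp add: D_def)
    then show ?thesis using \<tau> by (simp only: Im_divide_of_real Re_divide_of_real Im_i_times) simp
  qed
  have imr: "Im (complex_of_real y * z) = y * Im z" for y z by simp
  have "(D + L) * cnj e2 = (2 * complex_of_real lam * F + x) * cnj e2"
    using scheme by (simp only: D_def)
  then have "D * cnj e2 + L * cnj e2 = complex_of_real (2 * lam) * (F * cnj e2) + x * cnj e2"
    by (simp only: distrib_right mult.assoc of_real_mult of_real_numeral)
  then have "Im (D * cnj e2 + L * cnj e2) = Im (complex_of_real (2 * lam) * (F * cnj e2) + x * cnj e2)"
    by (rule arg_cong)
  then have sc: "Im (D * cnj e2) + Im (L * cnj e2) = 2 * lam * Im (F * cnj e2) + Im (x * cnj e2)"
    by (simp only: plus_complex.sel imr)
  have comb: "P + 4 * \<tau> * b = 8 * \<tau> * lam * c + 4 * \<tau> * d"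
    if "4 * \<tau> * a = P" "a + b = 2 * lam * c + d" for P a b c d :: real
  proof -
    have "P + 4 * \<tau> * b = 4 * \<tau> * (a + b)" using that(1) by (simp add: distrib_left)
    then show ?thesis using that(2) by (simp add: distrib_left)
  qed
  note en = comb[OF dt sc]
  have I1: "8 * \<tau> * lam * Im (F * cnj e2) \<le> 8 * \<tau> * \<bar>lam\<bar> * ((cmod w)\<^sup>2 + cmod F * cmod s)"
  proof -
    have "\<bar>Im (F * cnj e2)\<bar> \<le> \<bar>Im (F * cnj w)\<bar> + \<bar>Im (F * cnj s)\<bar>"
      by (simp add: e2 distrib_left del: times_complex.sel)
    also have "\<dots> \<le> (cmod w)\<^sup>2 + cmod F * cmod s"
      using F abs_Im_le_cmod[of "F * cnj s"] by (simp add: norm_mult)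
    finally have "\<bar>8 * \<tau> * lam * Im (F * cnj e2)\<bar> \<le> 8 * \<tau> * \<bar>lam\<bar> * ((cmod w)\<^sup>2 + cmod F * cmod s)"
      using \<tau> by (simp add: abs_mult mult_left_mono)
    then show ?thesis by linarith
  qed
  have I2: "4 * \<tau> * Im (x * cnj e2) \<le> 4 * \<tau> * r * (cmod w + cmod s)"
  proof -
    have "\<bar>Im (x * cnj e2)\<bar> \<le> cmod x * cmod e2"
      using abs_Im_le_cmod[of "x * cnj e2"] by (simp add: norm_mult)
    also have "\<dots> \<le> r * (cmod w + cmod s)"
      using x norm_triangle_ineq[of w s] r by (intro mult_mono) (auto simp: e2)
    finally have "4 * \<tau> * Im (x * cnj e2) \<le> 4 * \<tau> * (r * (cmod w + cmod s))"
      using \<tau> by (intro mult_left_mono) auto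
    then show ?thesis by (simp add: mult.assoc)
  qed
  have F2: "(cmod F)\<^sup>2 \<le> 2 * \<alpha>\<^sup>2 * (cmod w)\<^sup>2 + 2 * \<beta>\<^sup>2"
  proof -
    have "(cmod F)\<^sup>2 \<le> (\<alpha> * cmod w + \<beta>)\<^sup>2" using F by (intro power_mono) auto
    also have "\<dots> \<le> 2 * (\<alpha> * cmod w)\<^sup>2 + 2 * \<beta>\<^sup>2" by (rule square_add_le)
    finally show ?thesis by (simp add: power_mult_distrib)
  qed
  have A1: "4 * \<tau> * r * cmod w \<le> 4 * \<tau> * r\<^sup>2 + \<tau> * (cmod w)\<^sup>2"
  proof -
    have "2 * (2 * r) * cmod w \<le> (2 * r)\<^sup>2 + (cmod w)\<^sup>2" by (rule sum_squares_bound)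
    then have "\<tau> * (2 * (2 * r) * cmod w) \<le> \<tau> * ((2 * r)\<^sup>2 + (cmod w)\<^sup>2)"
      using \<tau> by (intro mult_left_mono) auto
    then show ?thesis by (simp add: power2_eq_square algebra_simps)
  qed
  have A2: "8 * \<tau> * \<bar>lam\<bar> * (cmod F * cmod s) + 4 * \<tau> * r * cmod s
     \<le> (cmod s)\<^sup>2 + (32 * \<tau>\<^sup>2 * lam\<^sup>2 * (cmod F)\<^sup>2 + 8 * \<tau>\<^sup>2 * r\<^sup>2)"
  proof -
    define y where "y = 4 * \<tau> * \<bar>lam\<bar> * cmod F + 2 * \<tau> * r"
    have "2 * y * cmod s \<le> y\<^sup>2 + (cmod s)\<^sup>2" by (rule sum_squares_bound)
    moreover have "y\<^sup>2 \<le> 2 * (4 * \<tau> * \<bar>lam\<bar> * cmod F)\<^sup>2 + 2 * (2 * \<tau> * r)\<^sup>2"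
      unfolding y_def by (rule square_add_le)
    ultimately show ?thesis by (simp add: y_def power_mult_distrib algebra_simps)
  qed
  have A3: "32 * \<tau>\<^sup>2 * lam\<^sup>2 * (cmod F)\<^sup>2 \<le> \<tau> * (cmod w)\<^sup>2 + \<tau> * (64 * lam\<^sup>2 * \<tau> * \<beta>\<^sup>2)"
  proof -
    have "32 * \<tau>\<^sup>2 * lam\<^sup>2 * (cmod F)\<^sup>2 \<le> 32 * \<tau>\<^sup>2 * lam\<^sup>2 * (2 * \<alpha>\<^sup>2 * (cmod w)\<^sup>2 + 2 * \<beta>\<^sup>2)"
      using F2 by (intro mult_left_mono) auto
    also have "\<dots> = (64 * lam\<^sup>2 * \<tau> * \<alpha>\<^sup>2) * (\<tau> * (cmod w)\<^sup>2) + \<tau> * (64 * lam\<^sup>2 * \<tau> * \<beta>\<^sup>2)"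
      by (simp add: power2_eq_square algebra_simps)
    also have "\<dots> \<le> 1 * (\<tau> * (cmod w)\<^sup>2) + \<tau> * (64 * lam\<^sup>2 * \<tau> * \<beta>\<^sup>2)"
      using \<alpha> \<tau> by (intro add_mono mult_right_mono) auto
    finally show ?thesis by simp
  qed
  have A4: "8 * \<tau>\<^sup>2 * r\<^sup>2 \<le> 8 * \<tau> * r\<^sup>2"
    using \<tau> by (intro mult_right_mono) (auto simp: power2_eq_square)
  have A5: "(8 * \<bar>lam\<bar> + 2) * \<tau> * (cmod w)\<^sup>2 \<le> (8 * \<bar>lam\<bar> + 2) * \<tau> * ((cmod e1)\<^sup>2 + (cmod w)\<^sup>2)"
    using \<tau> by (intro mult_left_mono) auto
  show ?thesis
    using en I1 I2 A1 A2 A3 A4 A5 BDF2_G_identity[of e2 e1 e0]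
    unfolding s_def[symmetric] w_def[symmetric]
    by (simp add: algebra_simps del: times_complex.sel)
qed

text \<open>The scheme expresses the Laplacian of the error through the errors themselves; a Lipschitz constant
  \<open>\<alpha>\<close> of size \<open>1/\<tau>\<close> does no harm here because the difference quotient already costs \<open>1/\<tau>\<close>.\<close>

lemma BDF2_pointwise_laplacian:
  fixes e0 e1 e2 L F x :: complex and \<tau> lam :: real
  defines "w \<equiv> 2 * e1 - e0"
  assumes scheme: "\<i> * ((3 * e2 - 4 * e1 + e0) / complex_of_real (2 * \<tau>)) + L
                   = 2 * complex_of_real lam * F + x"
    and F: "cmod F \<le> \<alpha> * cmod w + \<beta>"
    and x: "cmod x \<le> r" and \<tau>: "0 < \<tau>" and \<alpha>: "2 * \<bar>lam\<bar> * \<alpha> * \<tau> \<le> 1" and \<beta>: "0 \<le> \<beta>"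
  shows "(cmod L)\<^sup>2 \<le> 32 / \<tau>\<^sup>2 * (((cmod e2)\<^sup>2 + (cmod (2 * e2 - e1))\<^sup>2) + ((cmod e1)\<^sup>2 + (cmod w)\<^sup>2))
      + 2 * (2 * \<bar>lam\<bar> * \<beta> + r)\<^sup>2"
proof -
  define q where "q = 2 * \<bar>lam\<bar> * \<beta> + r"
  have r: "0 \<le> r" using x norm_ge_zero[of x] by linarith
  have q: "0 \<le> q" using r \<beta> by (simp add: q_def)
  define D where "D = \<i> * ((3 * e2 - 4 * e1 + e0) / complex_of_real (2 * \<tau>))"
  have D: "cmod D \<le> (2 * cmod e2 + cmod e1 + cmod w) / \<tau>"
  proof -
    have "3 * e2 - 4 * e1 + e0 = 3 * e2 - 2 * e1 - w" by (simp add: w_def)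
    then have "cmod (3 * e2 - 4 * e1 + e0) \<le> 3 * cmod e2 + 2 * cmod e1 + cmod w"
      using norm_triangle_ineq4[of "3 * e2 - 2 * e1" w] norm_triangle_ineq4[of "3 * e2" "2 * e1"]
      by (simp only: norm_mult norm_numeral)
    also have "\<dots> \<le> 2 * (2 * cmod e2 + cmod e1 + cmod w)" by simp
    finally have "cmod (3 * e2 - 4 * e1 + e0) / (2 * \<tau>) \<le> 2 * (2 * cmod e2 + cmod e1 + cmod w) / (2 * \<tau>)"
      using \<tau> by (intro divide_right_mono) auto
    moreover have "cmod D = cmod (3 * e2 - 4 * e1 + e0) / (2 * \<tau>)"
      using \<tau> by (simp add: D_def norm_mult norm_divide)
    ultimately show ?thesis by (simp only: mult_divide_mult_cancel_left[OF zero_neq_numeral[symmetric]])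
  qed
  have F': "2 * \<bar>lam\<bar> * cmod F \<le> cmod w / \<tau> + 2 * \<bar>lam\<bar> * \<beta>"
  proof -
    have "2 * \<bar>lam\<bar> * cmod F \<le> 2 * \<bar>lam\<bar> * (\<alpha> * cmod w + \<beta>)" using F by (intro mult_left_mono) auto
    moreover have "(2 * \<bar>lam\<bar> * \<alpha>) * cmod w \<le> (1 / \<tau>) * cmod w"
      using \<alpha> \<tau> by (intro mult_right_mono) (auto simp: field_simps)
    ultimately show ?thesis by (simp add: algebra_simps)
  qed
  have "L = 2 * complex_of_real lam * F + x - D" using scheme by (simp add: D_def algebra_simps)
  then have "cmod L \<le> cmod (2 * complex_of_real lam * F) + cmod x + cmod D"
    using norm_triangle_ineq4[of "2 * complex_of_real lam * F + x" D]
      norm_triangle_ineq[of "2 * complex_of_real lam * F" x] by simp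
  then have "cmod L \<le> (2 * cmod e2 + cmod e1 + 2 * cmod w) / \<tau> + q"
    using D F' x by (simp add: norm_mult q_def add_divide_distrib)
  then have "(cmod L)\<^sup>2 \<le> ((2 * cmod e2 + cmod e1 + 2 * cmod w) / \<tau> + q)\<^sup>2"
    by (intro power_mono) auto
  also have "\<dots> \<le> 2 * ((2 * cmod e2 + cmod e1 + 2 * cmod w) / \<tau>)\<^sup>2 + 2 * q\<^sup>2"
    by (rule square_add_le)
  also have "(2 * cmod e2 + cmod e1 + 2 * cmod w)\<^sup>2 \<le> 16 * (cmod e2)\<^sup>2 + 4 * (cmod e1)\<^sup>2 + 8 * (cmod w)\<^sup>2"
    using square_add_le[of "2 * cmod e2 + cmod e1" "2 * cmod w"] square_add_le[of "2 * cmod e2" "cmod e1"]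
    by (simp add: power_mult_distrib)
  then have "2 * ((2 * cmod e2 + cmod e1 + 2 * cmod w) / \<tau>)\<^sup>2
      \<le> 2 * ((16 * (cmod e2)\<^sup>2 + 4 * (cmod e1)\<^sup>2 + 8 * (cmod w)\<^sup>2) / \<tau>\<^sup>2)"
    by (simp add: power_divide divide_right_mono)
  finally have "(cmod L)\<^sup>2 \<le> 2 * ((16 * (cmod e2)\<^sup>2 + 4 * (cmod e1)\<^sup>2 + 8 * (cmod w)\<^sup>2) / \<tau>\<^sup>2) + 2 * q\<^sup>2"
    by simp
  also have "\<dots> \<le> 2 * (16 * (((cmod e2)\<^sup>2 + (cmod (2 * e2 - e1))\<^sup>2) + ((cmod e1)\<^sup>2 + (cmod w)\<^sup>2)) / \<tau>\<^sup>2) + 2 * q\<^sup>2"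
    by (intro add_mono mult_left_mono divide_right_mono) auto
  finally show ?thesis by (simp add: q_def)
qed

definition grid_integral :: "real \<Rightarrow> real \<Rightarrow> nat \<Rightarrow> nat \<Rightarrow> (nat \<Rightarrow> nat \<Rightarrow> real) \<Rightarrow> real" where
  "grid_integral hx hy J K f = hx * hy * (\<Sum>j=1..<J. \<Sum>k=1..<K. f j k)"

lemma grid_integral_mono:
  assumes "0 \<le> hx" "0 \<le> hy" "\<And>j k. j \<in> {1..<J} \<Longrightarrow> k \<in> {1..<K} \<Longrightarrow> f j k \<le> g j k"
  shows "grid_integral hx hy J K f \<le> grid_integral hx hy J K g"
  unfolding grid_integral_def using assms by (intro mult_left_mono sum_mono) auto

lemma grid_integral_add:
  "grid_integral hx hy J K (\<lambda>j k. f j k + g j k) = grid_integral hx hy J K f + grid_integral hx hy J K g"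
  by (simp add: grid_integral_def sum.distrib distrib_left)

lemma grid_integral_cmult:
  "grid_integral hx hy J K (\<lambda>j k. c * f j k) = c * grid_integral hx hy J K f"
  by (simp add: grid_integral_def sum_distrib_left mult.left_commute)

lemma grid_integral_const_le:
  assumes "0 < hx" "0 < hy" "0 \<le> c"
  shows "grid_integral hx hy J K (\<lambda>j k. c) \<le> (hx * real J) * (hy * real K) * c"
proof -
  have "grid_integral hx hy J K (\<lambda>j k. c) = (hx * real (J - 1)) * (hy * real (K - 1)) * c"
    by (simp add: grid_integral_def)
  also have "\<dots> \<le> (hx * real J) * (hy * real K) * c"
    using assms by (intro mult_mono mult_left_mono) auto
  finally show ?thesis .
qed

lemma grid_norm_power2:
  assumes "0 < hx" "0 < hy"
  shows "(grid_norm hx hy J K v)\<^sup>2 = grid_integral hx hy J K (\<lambda>j k. (cmod (v j k))\<^sup>2)"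
  unfolding grid_norm_def grid_integral_def
  by (intro real_sqrt_pow2 mult_nonneg_nonneg sum_nonneg) (use assms in auto)

lemma grid_green_Im_Re:
  assumes v: "v \<in> grid_space0 J K" and "0 < J" "0 < K" "0 < hx" "0 < hy"
  shows "grid_integral hx hy J K (\<lambda>j k. Im (grid_laplacian hx hy v j k * cnj (v j k))) = 0"
    and "grid_integral hx hy J K (\<lambda>j k. Re (grid_laplacian hx hy v j k * cnj (v j k)))
         = - (grid_seminorm1 hx hy J K v)\<^sup>2"
proof -
  define Z where "Z = (\<Sum>j=1..<J. \<Sum>k=1..<K. grid_laplacian hx hy v j k * cnj (v j k))"
  have Z: "complex_of_real (hx * hy) * Z = complex_of_real (- (grid_seminorm1 hx hy J K v)\<^sup>2)"
    using grid_green_identity[OF assms] by (simp add: Z_def)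
  have "hx * hy * Im Z = 0" "hx * hy * Re Z = - (grid_seminorm1 hx hy J K v)\<^sup>2"
    using arg_cong[OF Z, of Im] arg_cong[OF Z, of Re]
    by (simp_all only: Im_complex_of_real Re_complex_of_real times_complex.sel mult_zero_left mult_zero_right add_0_right diff_0_right)
  then show "grid_integral hx hy J K (\<lambda>j k. Im (grid_laplacian hx hy v j k * cnj (v j k))) = 0"
    and "grid_integral hx hy J K (\<lambda>j k. Re (grid_laplacian hx hy v j k * cnj (v j k)))
         = - (grid_seminorm1 hx hy J K v)\<^sup>2"
    by (simp_all only: grid_integral_def Z_def Im_sum Re_sum)
qed

text \<open>Green's identity and Young's inequality with a free weight \<open>t\<close>; for \<open>t = \<tau>\<close> both terms on the right are of
  the same size in the error estimate.\<close>

lemma grid_seminorm1_interpolation: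
  assumes v: "v \<in> grid_space0 J K" and "0 < J" "0 < K" "0 < hx" "0 < hy" and t: "0 < t"
  shows "2 * (grid_seminorm1 hx hy J K v)\<^sup>2
     \<le> t * (grid_norm hx hy J K (grid_laplacian hx hy v))\<^sup>2 + (grid_norm hx hy J K v)\<^sup>2 / t"
proof -
  let ?I = "grid_integral hx hy J K"
  have pw: "(-2) * Re (p * cnj q) \<le> t * (cmod p)\<^sup>2 + (1 / t) * (cmod q)\<^sup>2" for p q
  proof -
    have "(-2) * Re (p * cnj q) \<le> 2 * (cmod p * cmod q)"
      using abs_Re_le_cmod[of "p * cnj q"] by (simp add: norm_mult del: times_complex.sel)
    also have "\<dots> = 2 * (sqrt t * cmod p) * (cmod q / sqrt t)" using t by simp
    also have "\<dots> \<le> (sqrt t * cmod p)\<^sup>2 + (cmod q / sqrt t)\<^sup>2" by (rule sum_squares_bound)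
    finally show ?thesis using t by (simp add: power_mult_distrib power_divide)
  qed
  have "2 * (grid_seminorm1 hx hy J K v)\<^sup>2
      = ?I (\<lambda>j k. (-2) * Re (grid_laplacian hx hy v j k * cnj (v j k)))"
    unfolding grid_integral_cmult grid_green_Im_Re(2)[OF assms(1-5)] by simp
  also have "\<dots> \<le> ?I (\<lambda>j k. t * (cmod (grid_laplacian hx hy v j k))\<^sup>2 + (1 / t) * (cmod (v j k))\<^sup>2)"
    using assms by (intro grid_integral_mono pw) auto
  finally show ?thesis using assms
    unfolding grid_integral_add grid_integral_cmult by (simp add: grid_norm_power2)
qed

lemma grid_laplacian_diff:
  "grid_laplacian hx hy (\<lambda>j k. v j k - w j k) j k = grid_laplacian hx hy v j k - grid_laplacian hx hy w j k"
  by (simp add: grid_laplacian_def algebra_simps diff_divide_distrib add_divide_distrib)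

text \<open>In the stability estimate, \<open>energy_const * r\<^sup>2\<close> bounds the discrete energy, by Gronwall's inequality, and
  \<open>laplacian_const * r\<^sup>2 / \<tau>\<^sup>2\<close> bounds the squared norm of the discrete Laplacian of the error, read off from the
  scheme.\<close>

definition energy_const :: "real \<Rightarrow> real \<Rightarrow> real \<Rightarrow> real" where
  "energy_const lam A T = exp ((8 * \<bar>lam\<bar> + 2) * T) * (5 * A + T * (A * (12 + 256 * lam\<^sup>2)))"

definition laplacian_const :: "real \<Rightarrow> real \<Rightarrow> real \<Rightarrow> real" where
  "laplacian_const lam A T = 64 * energy_const lam A T + 4 * A * (4 * \<bar>lam\<bar> + 1)\<^sup>2"

text \<open>\<open>v\<close> is any family that solves the scheme up to residuals; the residual of the first step may be larger by
  the factor \<open>1/\<tau>\<close>, because that step is made only once. The induction carries the discrete energy together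
  with the crude bound \<open>1/\<tau>\<^sup>2\<close> for the maximal error, which keeps the logarithms in the nonlinear term of size
  \<open>ln (1/\<tau>)\<close>. The constants depend on the grid only through its area.\<close>

lemma BDF2_stability:
  fixes v U :: "nat \<Rightarrow> grid_fun" and \<tau> lam r M hx hy :: real and J K N :: nat
  defines "A \<equiv> (hx * real J) * (hy * real K)" and "T \<equiv> real N * \<tau>"
  defines "e \<equiv> \<lambda>n j k. v n j k - U n j k"
  assumes pos: "0 < J" "0 < K" "0 < hx" "0 < hy" "0 < \<tau>" and M: "0 \<le> M"
    and v0: "\<And>n. n \<le> N \<Longrightarrow> v n \<in> grid_space0 J K"
    and v_le: "\<And>n j k. n \<le> N \<Longrightarrow> j \<in> {1..<J} \<Longrightarrow> k \<in> {1..<K} \<Longrightarrow> cmod (v n j k) \<le> M"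
    and res1: "\<And>j k. 1 \<le> N \<Longrightarrow> j \<in> {1..<J} \<Longrightarrow> k \<in> {1..<K} \<Longrightarrow>
       cmod (\<i> * ((v 1 j k - v 0 j k) / complex_of_real \<tau>) + grid_laplacian hx hy (v 1) j k
        - 2 * complex_of_real lam * zlog (v 0 j k)) \<le> r / \<tau>"
    and res: "\<And>n j k. n \<in> {1..<N} \<Longrightarrow> j \<in> {1..<J} \<Longrightarrow> k \<in> {1..<K} \<Longrightarrow>
       cmod (\<i> * ((3 * v (n + 1) j k - 4 * v n j k + v (n - 1) j k) / complex_of_real (2 * \<tau>))
          + grid_laplacian hx hy (v (n + 1)) j k
        - 2 * complex_of_real lam * zlog (2 * v n j k - v (n - 1) j k)) \<le> r"
    and U: "BDF2_solution lam \<tau> hx hy N J K (v 0) U"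
    and r: "\<tau>\<^sup>2 \<le> r"
    and small1: "\<tau> \<le> exp (- 1)" and small2: "2304 * lam\<^sup>2 * \<tau> * (ln \<tau>)\<^sup>2 \<le> 1"
    and small3: "3 * M * \<tau> ^ 3 + 3 * \<tau> \<le> 1"
    and small4: "A * laplacian_const lam A T * r\<^sup>2 * \<tau>\<^sup>2 \<le> 1"
    and n: "n \<le> N"
  shows "(grid_norm hx hy J K (e n))\<^sup>2 \<le> energy_const lam A T * r\<^sup>2"
    and "\<tau> * (grid_seminorm1 hx hy J K (e n))\<^sup>2 \<le> laplacian_const lam A T * r\<^sup>2"
proof -
  let ?I = "grid_integral hx hy J K"
  have hx: "0 < hx" and hy: "0 < hy" and \<tau>: "0 < \<tau>" using pos by auto
  have A: "0 \<le> A" and T: "0 \<le> T" using pos by (auto simp: A_def T_def)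
  have r0: "0 < r" using r \<tau> by (smt (verit) zero_less_power2)
  have "exp (- 1) < (1::real)" by simp
  then have \<tau>1: "\<tau> \<le> 1" using small1 by linarith
  define l where "l = ln (1 / \<tau>)"
  have l_eq: "l = - ln \<tau>" using \<tau> by (simp add: l_def ln_div)
  have l: "1 \<le> l"
    using ln_mono[OF small1] \<tau> by (simp add: l_eq)
  define c where "c = 8 * \<bar>lam\<bar> + 2"
  define R where "R = A * (12 + 256 * lam\<^sup>2) * r\<^sup>2"
  have R: "0 \<le> R" using A by (simp add: R_def)
  define g where "g n j k = (cmod (e n j k))\<^sup>2 + (cmod (2 * e n j k - e (n - 1) j k))\<^sup>2" for n j k
  define G where "G n = ?I (g n)" for n
  define Lap where "Lap n = grid_laplacian hx hy (e n)" for n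
  have e_space: "e n \<in> grid_space0 J K" if "n \<le> N" for n
    using v0[OF that] U that by (auto simp: e_def grid_space0_def BDF2_solution_def)
  have e0: "e 0 j k = 0" if "j \<le> J" "k \<le> K" for j k
    using U that by (simp add: e_def BDF2_solution_def)
  have lap_e: "Lap n j k = grid_laplacian hx hy (v n) j k - grid_laplacian hx hy (U n) j k" for n j k
    unfolding Lap_def e_def by (rule grid_laplacian_diff)
  have green: "?I (\<lambda>j k. Im (Lap n j k * cnj (e n j k))) = 0" if "n \<le> N" for n
    unfolding Lap_def using grid_green_Im_Re(1)[OF e_space[OF that]] pos by simp
  have ec: "A * 5 + T * (A * (12 + 256 * lam\<^sup>2)) \<le> energy_const lam A T" "0 \<le> energy_const lam A T"
  proof -
    have "1 \<le> exp ((8 * \<bar>lam\<bar> + 2) * T)" using T by simp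
    then have "1 * (5 * A + T * (A * (12 + 256 * lam\<^sup>2))) \<le> energy_const lam A T"
      unfolding energy_const_def using A T by (intro mult_right_mono) auto
    then show "A * 5 + T * (A * (12 + 256 * lam\<^sup>2)) \<le> energy_const lam A T" by (simp add: mult.commute)
    then show "0 \<le> energy_const lam A T" using A T by (smt (verit) mult_nonneg_nonneg zero_le_power2)
  qed
  have lc: "64 * energy_const lam A T + 4 * A * (4 * \<bar>lam\<bar> + 1)\<^sup>2 = laplacian_const lam A T"
    by (simp add: laplacian_const_def)
  have lc_A: "4 * A \<le> laplacian_const lam A T"
  proof -
    have "4 * A * 1 \<le> 4 * A * (4 * \<bar>lam\<bar> + 1)\<^sup>2"
      using A by (intro mult_left_mono one_le_power) auto
    then show ?thesis using ec lc by linarith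
  qed
  have lap_sup: "cmod (e n j k) \<le> 1 / \<tau>\<^sup>2"
    if n: "n \<le> N" and L: "?I (\<lambda>j k. (cmod (Lap n j k))\<^sup>2) \<le> laplacian_const lam A T * r\<^sup>2 / \<tau>\<^sup>2"
      and jk: "j \<le> J" "k \<le> K" for n j k
  proof (rule power2_le_imp_le)
    have "(cmod (e n j k))\<^sup>2 \<le> A * (grid_norm hx hy J K (Lap n))\<^sup>2"
      unfolding A_def Lap_def using pos jk by (intro grid_sup_le_laplacian e_space n) auto
    also have "\<dots> \<le> A * (laplacian_const lam A T * r\<^sup>2 / \<tau>\<^sup>2)"
      using L A by (intro mult_left_mono) (auto simp: grid_norm_power2[OF hx hy])
    also have "\<dots> = (A * laplacian_const lam A T * r\<^sup>2 * \<tau>\<^sup>2) / (\<tau>\<^sup>2)\<^sup>2"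
      using \<tau> by (simp add: power2_eq_square)
    also have "\<dots> \<le> 1 / (\<tau>\<^sup>2)\<^sup>2" using small4 \<tau> by (intro divide_right_mono) auto
    finally show "(cmod (e n j k))\<^sup>2 \<le> (1 / \<tau>\<^sup>2)\<^sup>2" by (simp add: power_divide)
  qed (use \<tau> in auto)
  have first_step: "G 1 \<le> 5 * A * r\<^sup>2 \<and> ?I (\<lambda>j k. (cmod (Lap 1 j k))\<^sup>2) \<le> laplacian_const lam A T * r\<^sup>2 / \<tau>\<^sup>2"
    if N: "1 \<le> N"
  proof -
    have eq: "cmod (\<i> * (e 1 j k / complex_of_real \<tau>) + Lap 1 j k) \<le> r / \<tau>"
      if jk: "j \<in> {1..<J}" "k \<in> {1..<K}" for j k
    proof -
      have "U 0 j k = v 0 j k" using U jk by (simp add: BDF2_solution_def)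
      moreover have "\<i> * ((U 1 j k - U 0 j k) / complex_of_real \<tau>) + grid_laplacian hx hy (U 1) j k
        = 2 * complex_of_real lam * zlog (U 0 j k)" using U jk unfolding BDF2_solution_def by blast
      ultimately have "\<i> * (e 1 j k / complex_of_real \<tau>) + Lap 1 j k
        = \<i> * ((v 1 j k - v 0 j k) / complex_of_real \<tau>) + grid_laplacian hx hy (v 1) j k
           - 2 * complex_of_real lam * zlog (v 0 j k)"
        by (simp add: lap_e e_def diff_divide_distrib algebra_simps)
      then show ?thesis using res1[OF N jk] by simp
    qed
    have en: "(cmod (e 1 j k))\<^sup>2 + 2 * \<tau> * Im (Lap 1 j k * cnj (e 1 j k)) \<le> r\<^sup>2"
      if jk: "j \<in> {1..<J}" "k \<in> {1..<K}" for j k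
    proof -
      define a where "a = e 1 j k"
      define x where "x = \<i> * (a / complex_of_real \<tau>) + Lap 1 j k"
      have x: "cmod x \<le> r / \<tau>" unfolding x_def a_def by (rule eq[OF jk])
      have "x * cnj a = \<i> * complex_of_real ((cmod a)\<^sup>2 / \<tau>) + Lap 1 j k * cnj a"
        unfolding x_def by (simp only: distrib_right of_real_divide complex_norm_square) simp
      then have "Im (x * cnj a) = (cmod a)\<^sup>2 / \<tau> + Im (Lap 1 j k * cnj a)"
        by (simp only: plus_complex.sel Im_i_times Re_complex_of_real)
      moreover have "Im (x * cnj a) \<le> r / \<tau> * cmod a"
        using abs_Im_le_cmod[of "x * cnj a"] mult_right_mono[OF x norm_ge_zero[of a]] by (simp add: norm_mult)
      ultimately have "(cmod a)\<^sup>2 / \<tau> + Im (Lap 1 j k * cnj a) \<le> r * cmod a / \<tau>" by simp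
      then have "\<tau> * ((cmod a)\<^sup>2 / \<tau> + Im (Lap 1 j k * cnj a)) \<le> \<tau> * (r * cmod a / \<tau>)"
        using \<tau> by (intro mult_left_mono) auto
      then have "(cmod a)\<^sup>2 + \<tau> * Im (Lap 1 j k * cnj a) \<le> r * cmod a"
        using \<tau> by (simp only: distrib_left) simp
      moreover have "2 * r * cmod a \<le> r\<^sup>2 + (cmod a)\<^sup>2" by (rule sum_squares_bound)
      ultimately show ?thesis unfolding a_def[symmetric] by linarith
    qed
    have "?I (\<lambda>j k. (cmod (e 1 j k))\<^sup>2 + 2 * \<tau> * Im (Lap 1 j k * cnj (e 1 j k))) \<le> ?I (\<lambda>j k. r\<^sup>2)"
      using hx hy by (intro grid_integral_mono en) auto
    also have "\<dots> \<le> A * r\<^sup>2" unfolding A_def using hx hy by (intro grid_integral_const_le) auto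
    finally have e1: "?I (\<lambda>j k. (cmod (e 1 j k))\<^sup>2) \<le> A * r\<^sup>2"
      unfolding grid_integral_add grid_integral_cmult green[OF N] by simp
    have "G 1 \<le> ?I (\<lambda>j k. 5 * (cmod (e 1 j k))\<^sup>2)"
      unfolding G_def using hx hy
      by (intro grid_integral_mono) (auto simp: g_def e0 norm_mult power_mult_distrib)
    then have G1: "G 1 \<le> 5 * A * r\<^sup>2" using e1 unfolding grid_integral_cmult by simp
    have "(cmod (Lap 1 j k))\<^sup>2 \<le> 2 / \<tau>\<^sup>2 * (cmod (e 1 j k))\<^sup>2 + 2 / \<tau>\<^sup>2 * r\<^sup>2"
      if jk: "j \<in> {1..<J}" "k \<in> {1..<K}" for j k
    proof -
      define x where "x = \<i> * (e 1 j k / complex_of_real \<tau>) + Lap 1 j k"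
      have "Lap 1 j k = x - \<i> * (e 1 j k / complex_of_real \<tau>)" by (simp add: x_def)
      then have "cmod (Lap 1 j k) \<le> cmod x + cmod (e 1 j k) / \<tau>"
        using norm_triangle_ineq4[of x "\<i> * (e 1 j k / complex_of_real \<tau>)"] \<tau>
        by (simp add: norm_mult norm_divide)
      also have "\<dots> \<le> r / \<tau> + cmod (e 1 j k) / \<tau>" using eq[OF jk] by (simp add: x_def)
      finally have "(cmod (Lap 1 j k))\<^sup>2 \<le> (r / \<tau> + cmod (e 1 j k) / \<tau>)\<^sup>2"
        by (intro power_mono) auto
      also have "\<dots> \<le> 2 * (r / \<tau>)\<^sup>2 + 2 * (cmod (e 1 j k) / \<tau>)\<^sup>2" by (rule square_add_le)
      finally show ?thesis by (simp add: power_divide)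
    qed
    then have "?I (\<lambda>j k. (cmod (Lap 1 j k))\<^sup>2) \<le> ?I (\<lambda>j k. 2 / \<tau>\<^sup>2 * (cmod (e 1 j k))\<^sup>2 + 2 / \<tau>\<^sup>2 * r\<^sup>2)"
      using hx hy by (intro grid_integral_mono) auto
    also have "\<dots> \<le> 2 / \<tau>\<^sup>2 * (A * r\<^sup>2) + 2 / \<tau>\<^sup>2 * (A * r\<^sup>2)"
      unfolding grid_integral_add grid_integral_cmult A_def
      using e1 hx hy \<tau> by (intro add_mono mult_left_mono grid_integral_const_le) (auto simp: A_def)
    also have "\<dots> = 4 * A * (r\<^sup>2 / \<tau>\<^sup>2)" by simp
    also have "\<dots> \<le> laplacian_const lam A T * (r\<^sup>2 / \<tau>\<^sup>2)"
      using lc_A by (intro mult_right_mono) auto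
    finally show ?thesis using G1 by simp
  qed
  have next_step: "G (Suc n) \<le> (1 + c * \<tau>) * G n + \<tau> * R \<and>
      ?I (\<lambda>j k. (cmod (Lap (Suc n) j k))\<^sup>2) \<le> 32 / \<tau>\<^sup>2 * (G (Suc n) + G n) + 2 * A * ((4 * \<bar>lam\<bar> + 1) * r)\<^sup>2"
    if n: "1 \<le> n" "Suc n \<le> N" and sup: "\<And>j k. j \<le> J \<Longrightarrow> k \<le> K \<Longrightarrow> cmod (e n j k) \<le> 1 / \<tau>\<^sup>2"
      "\<And>j k. j \<le> J \<Longrightarrow> k \<le> K \<Longrightarrow> cmod (e (n - 1) j k) \<le> 1 / \<tau>\<^sup>2" for n
  proof -
    have pw: "g (Suc n) j k + 4 * \<tau> * Im (Lap (Suc n) j k * cnj (e (Suc n) j k))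
          \<le> (1 + c * \<tau>) * g n j k + \<tau> * (12 * r\<^sup>2 + 256 * lam\<^sup>2 * r\<^sup>2) \<and>
        (cmod (Lap (Suc n) j k))\<^sup>2 \<le> 32 / \<tau>\<^sup>2 * (g (Suc n) j k + g n j k) + 2 * ((4 * \<bar>lam\<bar> + 1) * r)\<^sup>2"
      if jk: "j \<in> {1..<J}" "k \<in> {1..<K}" for j k
    proof -
      define w where "w = 2 * e n j k - e (n - 1) j k"
      define p where "p = 2 * v n j k - v (n - 1) j k"
      define q where "q = 2 * U n j k - U (n - 1) j k"
      define F where "F = zlog p - zlog q"
      define x where "x = \<i> * ((3 * v (n + 1) j k - 4 * v n j k + v (n - 1) j k) / complex_of_real (2 * \<tau>))
          + grid_laplacian hx hy (v (n + 1)) j k - 2 * complex_of_real lam * zlog p"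
      have nN: "n \<in> {1..<N}" using n by auto
      have x: "cmod x \<le> r" unfolding x_def p_def using res[OF nN jk] by simp
      have pq: "p - q = w" by (simp add: p_def q_def w_def e_def algebra_simps)
      have Ueq: "\<i> * ((3 * U (n + 1) j k - 4 * U n j k + U (n - 1) j k) / complex_of_real (2 * \<tau>))
          + grid_laplacian hx hy (U (n + 1)) j k = 2 * complex_of_real lam * zlog q"
        using U nN jk unfolding BDF2_solution_def q_def by blast
      have scheme: "\<i> * ((3 * e (Suc n) j k - 4 * e n j k + e (n - 1) j k) / complex_of_real (2 * \<tau>))
          + Lap (Suc n) j k = 2 * complex_of_real lam * F + x"
      proof -
        have "\<i> * ((3 * e (Suc n) j k - 4 * e n j k + e (n - 1) j k) / complex_of_real (2 * \<tau>)) 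
          = \<i> * ((3 * v (n + 1) j k - 4 * v n j k + v (n - 1) j k) / complex_of_real (2 * \<tau>))
           - \<i> * ((3 * U (n + 1) j k - 4 * U n j k + U (n - 1) j k) / complex_of_real (2 * \<tau>))"
          by (simp add: e_def diff_divide_distrib add_divide_distrib algebra_simps)
        moreover have "De + (Lv - LU) = 2 * complex_of_real lam * (zp - zq) + (Dv + Lv - 2 * complex_of_real lam * zp)"
          if "De = Dv - DU" "DU + LU = 2 * complex_of_real lam * zq" for De Dv DU Lv LU zp zq :: complex
          using that(1) by (simp only: right_diff_distrib that(2)[symmetric]) simp
        ultimately show ?thesis
          unfolding lap_e F_def x_def Suc_eq_plus1 using Ueq by blast
      qed
      have B: "1 \<le> 1 / \<tau> ^ 3" using \<tau> \<tau>1 by (simp add: power_le_one)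
      have p: "cmod p \<le> 3 * M"
        using norm_triangle_ineq4[of "2 * v n j k" "v (n - 1) j k"] v_le[of n j k] v_le[of "n - 1" j k] n jk
          le_trans[OF diff_le_self[of n 1], of N]
        by (simp add: p_def norm_mult)
      have w: "cmod w \<le> 3 / \<tau>\<^sup>2"
        using norm_triangle_ineq4[of "2 * e n j k" "e (n - 1) j k"] sup[of j k] jk
        by (simp add: w_def norm_mult)
      have M3: "3 * M + 3 / \<tau>\<^sup>2 \<le> 1 / \<tau> ^ 3"
      proof -
        have "(3 * M * \<tau> ^ 3 + 3 * \<tau>) / \<tau> ^ 3 \<le> 1 / \<tau> ^ 3"
          using small3 \<tau> by (intro divide_right_mono) auto
        then show ?thesis using \<tau> by (simp add: add_divide_distrib power2_eq_square power3_eq_cube)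
      qed
      have p': "cmod p \<le> 1 / \<tau> ^ 3" using p M3 \<tau> by (smt (verit) divide_nonneg_nonneg zero_le_power2)
      have "cmod q \<le> cmod p + cmod w" using norm_triangle_ineq4[of p w] by (simp add: pq[symmetric])
      then have q': "cmod q \<le> 1 / \<tau> ^ 3" using p w M3 by linarith
      \<comment> \<open>The threshold \<open>\<tau>\<^sup>2\<close> gives the additive term the size of the residual bound \<open>r\<close>.\<close>
      have "cmod F \<le> (1 + ln (1 / \<tau> ^ 3) + ln (1 / \<tau>\<^sup>2)) * cmod (p - q) + 2 * \<tau>\<^sup>2"
        unfolding F_def using \<tau> \<tau>1 p' q' B by (intro zlog_diff_le) (auto simp: power_le_one)
      also have "1 + ln (1 / \<tau> ^ 3) + ln (1 / \<tau>\<^sup>2) = 1 + 5 * l"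
        using \<tau> by (simp add: l_eq ln_div ln_realpow)
      also have "(1 + 5 * l) * cmod (p - q) \<le> 6 * l * cmod w"
        unfolding pq using l by (intro mult_right_mono) auto
      finally have F: "cmod F \<le> 6 * l * cmod w + 2 * \<tau>\<^sup>2" by simp
      have ImF: "\<bar>Im (F * cnj w)\<bar> \<le> (cmod w)\<^sup>2"
        using Im_zlog_diff_le[of p q] unfolding F_def pq .
      have al: "64 * lam\<^sup>2 * \<tau> * (6 * l)\<^sup>2 \<le> 1"
        using small2 by (simp add: l_eq power_mult_distrib algebra_simps)
      have al2: "2 * \<bar>lam\<bar> * (6 * l) * \<tau> \<le> 1"
      proof -
        have "(2 * \<bar>lam\<bar> * (6 * l) * \<tau>)\<^sup>2 = (144 * lam\<^sup>2 * \<tau> * (ln \<tau>)\<^sup>2) * \<tau>"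
          by (simp add: l_eq power2_eq_square)
        also have "\<dots> \<le> 1 * 1"
        proof (intro mult_mono)
          have "0 \<le> lam\<^sup>2 * \<tau> * (ln \<tau>)\<^sup>2" using \<tau> by simp
          then show "144 * lam\<^sup>2 * \<tau> * (ln \<tau>)\<^sup>2 \<le> 1" using small2 by linarith
        qed (use \<tau> \<tau>1 in auto)
        finally show ?thesis by (simp add: abs_square_le_1 abs_le_iff)
      qed
      have \<beta>: "64 * lam\<^sup>2 * \<tau> * (2 * \<tau>\<^sup>2)\<^sup>2 \<le> 256 * lam\<^sup>2 * r\<^sup>2"
      proof -
        have "\<tau> * (\<tau>\<^sup>2)\<^sup>2 \<le> 1 * r\<^sup>2" using \<tau> \<tau>1 r by (intro mult_mono power_mono) auto
        then have "256 * lam\<^sup>2 * (\<tau> * (\<tau>\<^sup>2)\<^sup>2) \<le> 256 * lam\<^sup>2 * r\<^sup>2" by (intro mult_left_mono) auto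
        then show ?thesis by (simp add: power_mult_distrib algebra_simps)
      qed
      have E: "g (Suc n) j k + 4 * \<tau> * Im (Lap (Suc n) j k * cnj (e (Suc n) j k))
         \<le> (1 + c * \<tau>) * g n j k + \<tau> * (12 * r\<^sup>2 + 64 * lam\<^sup>2 * \<tau> * (2 * \<tau>\<^sup>2)\<^sup>2)"
        using BDF2_pointwise_energy[OF scheme ImF[unfolded w_def] F[unfolded w_def] x \<tau> \<tau>1 _ al] l
        by (simp add: g_def c_def)
      have "\<tau> * (12 * r\<^sup>2 + 64 * lam\<^sup>2 * \<tau> * (2 * \<tau>\<^sup>2)\<^sup>2) \<le> \<tau> * (12 * r\<^sup>2 + 256 * lam\<^sup>2 * r\<^sup>2)"
        using \<beta> \<tau> by (intro mult_left_mono) auto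
      then have E1: "g (Suc n) j k + 4 * \<tau> * Im (Lap (Suc n) j k * cnj (e (Suc n) j k))
          \<le> (1 + c * \<tau>) * g n j k + \<tau> * (12 * r\<^sup>2 + 256 * lam\<^sup>2 * r\<^sup>2)" using E by linarith
      have "(cmod (Lap (Suc n) j k))\<^sup>2 \<le> 32 / \<tau>\<^sup>2 * (g (Suc n) j k + g n j k)
         + 2 * (2 * \<bar>lam\<bar> * (2 * \<tau>\<^sup>2) + r)\<^sup>2"
        using BDF2_pointwise_laplacian[OF scheme F[unfolded w_def] x \<tau> al2] by (simp add: g_def)
      moreover have "(2 * \<bar>lam\<bar> * (2 * \<tau>\<^sup>2) + r)\<^sup>2 \<le> ((4 * \<bar>lam\<bar> + 1) * r)\<^sup>2"
      proof (intro power_mono)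
        have "4 * \<bar>lam\<bar> * \<tau>\<^sup>2 \<le> 4 * \<bar>lam\<bar> * r" using r by (intro mult_left_mono) auto
        then show "2 * \<bar>lam\<bar> * (2 * \<tau>\<^sup>2) + r \<le> (4 * \<bar>lam\<bar> + 1) * r" by (simp add: algebra_simps)
      qed (use r0 in auto)
      ultimately show ?thesis using E1 by linarith
    qed
    have "?I (\<lambda>j k. g (Suc n) j k + 4 * \<tau> * Im (Lap (Suc n) j k * cnj (e (Suc n) j k)))
       \<le> ?I (\<lambda>j k. (1 + c * \<tau>) * g n j k + \<tau> * (12 * r\<^sup>2 + 256 * lam\<^sup>2 * r\<^sup>2))"
      using pw hx hy by (intro grid_integral_mono) auto
    then have "G (Suc n) \<le> (1 + c * \<tau>) * G n + ?I (\<lambda>j k. \<tau> * (12 * r\<^sup>2 + 256 * lam\<^sup>2 * r\<^sup>2))"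
      unfolding grid_integral_add grid_integral_cmult[of _ _ _ _ "4 * \<tau>"] grid_integral_cmult[of _ _ _ _ "1 + c * \<tau>"] green[OF n(2)] G_def
      by (simp only: mult_zero_right add_0_right)
    also have "?I (\<lambda>j k. \<tau> * (12 * r\<^sup>2 + 256 * lam\<^sup>2 * r\<^sup>2)) \<le> A * (\<tau> * (12 * r\<^sup>2 + 256 * lam\<^sup>2 * r\<^sup>2))"
      unfolding A_def using hx hy \<tau> by (intro grid_integral_const_le) auto
    also have "\<dots> = \<tau> * R" by (simp add: R_def algebra_simps)
    finally have G: "G (Suc n) \<le> (1 + c * \<tau>) * G n + \<tau> * R" by simp
    have "?I (\<lambda>j k. (cmod (Lap (Suc n) j k))\<^sup>2)
        \<le> ?I (\<lambda>j k. 32 / \<tau>\<^sup>2 * (g (Suc n) j k + g n j k) + 2 * ((4 * \<bar>lam\<bar> + 1) * r)\<^sup>2)"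
      using pw hx hy by (intro grid_integral_mono) auto
    also have "\<dots> = 32 / \<tau>\<^sup>2 * (G (Suc n) + G n) + ?I (\<lambda>j k. 2 * ((4 * \<bar>lam\<bar> + 1) * r)\<^sup>2)"
      unfolding grid_integral_add grid_integral_cmult[of _ _ _ _ "32 / \<tau>\<^sup>2"] G_def ..
    also have "?I (\<lambda>j k. 2 * ((4 * \<bar>lam\<bar> + 1) * r)\<^sup>2) \<le> A * (2 * ((4 * \<bar>lam\<bar> + 1) * r)\<^sup>2)"
      unfolding A_def using hx hy by (intro grid_integral_const_le) auto
    finally show ?thesis using G by (simp add: algebra_simps)
  qed
  \<comment> \<open>The Gronwall majorant of the energy.\<close>
  define Q where "Q n = exp (c * (real n * \<tau>)) * (5 * A * r\<^sup>2 + real n * \<tau> * R)" for n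
  have Q0: "0 \<le> Q n" for n using A R \<tau> by (simp add: Q_def)
  have Q_le: "Q n \<le> energy_const lam A T * r\<^sup>2" if "n \<le> N" for n
  proof -
    have nT: "real n * \<tau> \<le> T" using that \<tau> by (simp add: T_def)
    have "Q n \<le> exp (c * T) * (5 * A * r\<^sup>2 + T * R)"
      unfolding Q_def using nT A R \<tau> T
      by (intro mult_mono add_mono mult_right_mono) (auto simp: c_def intro!: mult_left_mono)
    also have "\<dots> = energy_const lam A T * r\<^sup>2"
      by (simp add: energy_const_def c_def R_def algebra_simps)
    finally show ?thesis .
  qed
  have Q_step: "(1 + c * \<tau>) * Q n + \<tau> * R \<le> Q (Suc n)" for n
  proof -
    define X where "X = 5 * A * r\<^sup>2 + real n * \<tau> * R"
    have X: "0 \<le> X" using A R \<tau> by (simp add: X_def)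
    have E: "exp (c * (real (Suc n) * \<tau>)) = exp (c * \<tau>) * exp (c * (real n * \<tau>))"
      by (simp add: algebra_simps flip: exp_add)
    have "(1 + c * \<tau>) * (exp (c * (real n * \<tau>)) * X) \<le> exp (c * \<tau>) * (exp (c * (real n * \<tau>)) * X)"
      using X exp_ge_add_one_self[of "c * \<tau>"] by (intro mult_right_mono) auto
    moreover have "1 * (\<tau> * R) \<le> exp (c * (real (Suc n) * \<tau>)) * (\<tau> * R)"
      using R \<tau> by (intro mult_right_mono) (auto simp: c_def)
    ultimately show ?thesis
      unfolding Q_def X_def[symmetric] using E by (simp add: X_def algebra_simps)
  qed
  have main: "G n \<le> Q n \<and> ?I (\<lambda>j k. (cmod (Lap n j k))\<^sup>2) \<le> laplacian_const lam A T * r\<^sup>2 / \<tau>\<^sup>2 \<and>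
      (\<forall>j\<le>J. \<forall>k\<le>K. cmod (e n j k) \<le> 1 / \<tau>\<^sup>2 \<and> cmod (e (n - 1) j k) \<le> 1 / \<tau>\<^sup>2)"
    if "1 \<le> n" "n \<le> N" for n
    using that
  proof (induction n rule: dec_induct)
    case base
    then have N: "1 \<le> N" by simp
    have "5 * A * r\<^sup>2 \<le> Q 1"
    proof -
      have "1 * (5 * A * r\<^sup>2 + 0) \<le> Q 1"
        unfolding Q_def using A R \<tau> by (intro mult_mono add_mono) (auto simp: c_def)
      then show ?thesis by simp
    qed
    then show ?case using first_step[OF N] lap_sup[OF N] e0 by auto
  next
    case (step n)
    have nN: "n \<le> N" "Suc n \<le> N" "1 \<le> n" using step by auto
    have IH: "G n \<le> Q n" and sup: "\<And>j k. j \<le> J \<Longrightarrow> k \<le> K \<Longrightarrow> cmod (e n j k) \<le> 1 / \<tau>\<^sup>2"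
      "\<And>j k. j \<le> J \<Longrightarrow> k \<le> K \<Longrightarrow> cmod (e (n - 1) j k) \<le> 1 / \<tau>\<^sup>2"
      using step.IH[OF nN(1)] by auto
    have S: "G (Suc n) \<le> (1 + c * \<tau>) * G n + \<tau> * R"
      "?I (\<lambda>j k. (cmod (Lap (Suc n) j k))\<^sup>2) \<le> 32 / \<tau>\<^sup>2 * (G (Suc n) + G n) + 2 * A * ((4 * \<bar>lam\<bar> + 1) * r)\<^sup>2"
      using next_step[OF nN(3,2) sup] by auto
    have "(1 + c * \<tau>) * G n \<le> (1 + c * \<tau>) * Q n"
      using IH \<tau> by (intro mult_left_mono) (auto simp: c_def)
    then have G: "G (Suc n) \<le> Q (Suc n)" using S(1) Q_step[of n] by linarith
    have EC: "G (Suc n) + G n \<le> 2 * (energy_const lam A T * r\<^sup>2)"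
      using G IH Q_le[OF nN(1)] Q_le[OF nN(2)] by linarith
    have L: "?I (\<lambda>j k. (cmod (Lap (Suc n) j k))\<^sup>2) \<le> laplacian_const lam A T * r\<^sup>2 / \<tau>\<^sup>2"
    proof -
      have "32 / \<tau>\<^sup>2 * (G (Suc n) + G n) \<le> 32 / \<tau>\<^sup>2 * (2 * (energy_const lam A T * r\<^sup>2))"
        using EC by (intro mult_left_mono) auto
      moreover have "2 * A * ((4 * \<bar>lam\<bar> + 1) * r)\<^sup>2 \<le> 4 * A * (4 * \<bar>lam\<bar> + 1)\<^sup>2 * r\<^sup>2 / \<tau>\<^sup>2"
      proof -
        define Y where "Y = A * (4 * \<bar>lam\<bar> + 1)\<^sup>2 * r\<^sup>2"
        have Y: "0 \<le> Y" using A by (simp add: Y_def)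
        have "4 * Y * 1 \<le> 4 * Y * (1 / \<tau>\<^sup>2)" using Y \<tau> \<tau>1 by (intro mult_left_mono) (auto simp: power_le_one)
        then have "2 * Y \<le> 4 * Y / \<tau>\<^sup>2" using Y by simp
        moreover have "2 * A * ((4 * \<bar>lam\<bar> + 1) * r)\<^sup>2 = 2 * Y"
          unfolding Y_def power_mult_distrib by simp
        moreover have "4 * A * (4 * \<bar>lam\<bar> + 1)\<^sup>2 * r\<^sup>2 / \<tau>\<^sup>2 = 4 * Y / \<tau>\<^sup>2"
          unfolding Y_def by simp
        ultimately show ?thesis by (simp only:)
      qed
      moreover have "laplacian_const lam A T * r\<^sup>2 / \<tau>\<^sup>2
        = 32 / \<tau>\<^sup>2 * (2 * (energy_const lam A T * r\<^sup>2)) + 4 * A * (4 * \<bar>lam\<bar> + 1)\<^sup>2 * r\<^sup>2 / \<tau>\<^sup>2"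
        by (simp add: laplacian_const_def add_divide_distrib algebra_simps)
      ultimately show ?thesis using S(2) by linarith
    qed
    show ?case using G L lap_sup[OF nN(2) L] sup by auto
  qed
  have fin: "(grid_norm hx hy J K (e n))\<^sup>2 \<le> energy_const lam A T * r\<^sup>2 \<and>
     (grid_norm hx hy J K (Lap n))\<^sup>2 \<le> laplacian_const lam A T * r\<^sup>2 / \<tau>\<^sup>2"
  proof (cases "n = 0")
    case True
    have "?I (\<lambda>j k. (cmod (e 0 j k))\<^sup>2) = 0" "?I (\<lambda>j k. (cmod (Lap 0 j k))\<^sup>2) = 0"
      by (auto simp: grid_integral_def e0 Lap_def grid_laplacian_def intro!: sum.neutral)
    then show ?thesis using True ec lc_A A by (simp add: grid_norm_power2[OF hx hy])
  next
    case False
    then have m: "G n \<le> Q n" "?I (\<lambda>j k. (cmod (Lap n j k))\<^sup>2) \<le> laplacian_const lam A T * r\<^sup>2 / \<tau>\<^sup>2"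
      using main[of n] n by auto
    have "?I (\<lambda>j k. (cmod (e n j k))\<^sup>2) \<le> G n"
      unfolding G_def using hx hy by (intro grid_integral_mono) (auto simp: g_def)
    then show ?thesis using m Q_le[OF n] by (simp add: grid_norm_power2[OF hx hy])
  qed
  then show "(grid_norm hx hy J K (e n))\<^sup>2 \<le> energy_const lam A T * r\<^sup>2" by simp
  have "2 * (grid_seminorm1 hx hy J K (e n))\<^sup>2
     \<le> \<tau> * (grid_norm hx hy J K (Lap n))\<^sup>2 + (grid_norm hx hy J K (e n))\<^sup>2 / \<tau>"
    unfolding Lap_def using pos by (intro grid_seminorm1_interpolation e_space n) auto
  then have "\<tau> * (2 * (grid_seminorm1 hx hy J K (e n))\<^sup>2)
     \<le> \<tau> * (\<tau> * (grid_norm hx hy J K (Lap n))\<^sup>2 + (grid_norm hx hy J K (e n))\<^sup>2 / \<tau>)"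
    using \<tau> by (intro mult_left_mono) auto
  then have "\<tau> * (2 * (grid_seminorm1 hx hy J K (e n))\<^sup>2)
     \<le> \<tau>\<^sup>2 * (grid_norm hx hy J K (Lap n))\<^sup>2 + (grid_norm hx hy J K (e n))\<^sup>2"
    using \<tau> by (simp add: distrib_left power2_eq_square)
  moreover have "\<tau>\<^sup>2 * (grid_norm hx hy J K (Lap n))\<^sup>2 \<le> \<tau>\<^sup>2 * (laplacian_const lam A T * r\<^sup>2 / \<tau>\<^sup>2)"
    using fin by (intro mult_left_mono) auto
  then have "\<tau>\<^sup>2 * (grid_norm hx hy J K (Lap n))\<^sup>2 \<le> laplacian_const lam A T * r\<^sup>2" using \<tau> by simp
  moreover have "energy_const lam A T * r\<^sup>2 \<le> laplacian_const lam A T * r\<^sup>2"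
    using ec(2) A by (intro mult_right_mono) (auto simp: laplacian_const_def intro!: add_increasing2)
  ultimately show "\<tau> * (grid_seminorm1 hx hy J K (e n))\<^sup>2 \<le> laplacian_const lam A T * r\<^sup>2"
    using fin by linarith
qed

section \<open>Smooth bump functions\<close>

text \<open>Recursion on the order makes closure properties provable by induction, without Leibniz
  formulas.\<close>

primrec smooth_upto :: "nat \<Rightarrow> (real \<Rightarrow> real) \<Rightarrow> bool" where
  "smooth_upto 0 f \<longleftrightarrow> True"
| "smooth_upto (Suc n) f \<longleftrightarrow> (\<exists>f'. (\<forall>x. (f has_real_derivative f' x) (at x)) \<and> smooth_upto n f')"

definition smooth :: "(real \<Rightarrow> real) \<Rightarrow> bool" where
  "smooth f \<longleftrightarrow> (\<forall>n. smooth_upto n f)"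

lemma smooth_upto_SucD: "smooth_upto (Suc n) f \<Longrightarrow> smooth_upto n f"
proof (induction n arbitrary: f)
  case (Suc n)
  then obtain f' where f': "\<forall>x. (f has_real_derivative f' x) (at x)" "smooth_upto (Suc n) f'"
    unfolding smooth_upto.simps(2)[of "Suc n"] by blast
  then show ?case using Suc.IH[of f'] unfolding smooth_upto.simps(2)[of n f] by blast
qed simp

lemma smooth_upto_add:
  "smooth_upto n f \<Longrightarrow> smooth_upto n g \<Longrightarrow> smooth_upto n (\<lambda>x. f x + g x)"
proof (induction n arbitrary: f g)
  case (Suc n)
  from Suc.prems(1) obtain f' where f: "\<And>x. (f has_real_derivative f' x) (at x)" "smooth_upto n f'"
    by auto
  from Suc.prems(2) obtain g' where g: "\<And>x. (g has_real_derivative g' x) (at x)" "smooth_upto n g'"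
    by auto
  show ?case unfolding smooth_upto.simps
    using DERIV_add[OF f(1) g(1)] Suc.IH[OF f(2) g(2)] by (intro exI[of _ "\<lambda>x. f' x + g' x"]) auto
qed simp

lemma smooth_upto_mult:
  "smooth_upto n f \<Longrightarrow> smooth_upto n g \<Longrightarrow> smooth_upto n (\<lambda>x. f x * g x)"
proof (induction n arbitrary: f g)
  case (Suc n)
  from Suc.prems(1) obtain f' where f: "\<And>x. (f has_real_derivative f' x) (at x)" "smooth_upto n f'"
    by auto
  from Suc.prems(2) obtain g' where g: "\<And>x. (g has_real_derivative g' x) (at x)" "smooth_upto n g'"
    by auto
  show ?case unfolding smooth_upto.simps
  proof (intro exI[of _ "\<lambda>x. f' x * g x + g' x * f x"] conjI allI)
    show "((\<lambda>x. f x * g x) has_real_derivative f' x * g x + g' x * f x) (at x)" for x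
      by (rule DERIV_mult[OF f(1) g(1)])
    show "smooth_upto n (\<lambda>x. f' x * g x + g' x * f x)"
      by (rule smooth_upto_add[OF Suc.IH[OF f(2) smooth_upto_SucD[OF Suc.prems(2)]]
            Suc.IH[OF g(2) smooth_upto_SucD[OF Suc.prems(1)]]])
  qed
qed simp

lemma smooth_upto_const: "smooth_upto n (\<lambda>x. c)"
proof (induction n arbitrary: c)
  case (Suc n)
  show ?case unfolding smooth_upto.simps
    using Suc.IH[of 0] by (intro exI[of _ "\<lambda>x. 0"]) auto
qed simp

lemma smooth_upto_affine: "smooth_upto n f \<Longrightarrow> smooth_upto n (\<lambda>x. f (c * x + d))"
proof (induction n arbitrary: f)
  case (Suc n)
  from Suc.prems obtain f' where f: "\<And>x. (f has_real_derivative f' x) (at x)" "smooth_upto n f'"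
    by auto
  have "((\<lambda>x. f (c * x + d)) has_real_derivative f' (c * x + d) * c) (at x)" for x
    by (rule DERIV_chain2[OF f(1)]) (auto intro!: derivative_eq_intros)
  then show ?case unfolding smooth_upto.simps
    using smooth_upto_mult[OF Suc.IH[OF f(2)] smooth_upto_const[of n c]]
    by (intro exI[of _ "\<lambda>x. f' (c * x + d) * c"]) auto
qed simp

lemma smooth_mult: "smooth f \<Longrightarrow> smooth g \<Longrightarrow> smooth (\<lambda>x. f x * g x)"
  by (simp add: smooth_def smooth_upto_mult)

lemma smooth_const: "smooth (\<lambda>x. c)"
  by (simp add: smooth_def smooth_upto_const)

lemma smooth_affine: "smooth f \<Longrightarrow> smooth (\<lambda>x. f (c * x + d))"
  by (simp add: smooth_def smooth_upto_affine)

lemma smooth_deriv: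
  assumes "smooth f"
  shows "(f has_real_derivative deriv f x) (at x)" "smooth (deriv f)"
proof -
  have ex: "\<exists>f'. (\<forall>x. (f has_real_derivative f' x) (at x)) \<and> smooth_upto n f'" for n
    using assms unfolding smooth_def smooth_upto.simps(2)[symmetric] by blast
  then obtain f' where "\<forall>x. (f has_real_derivative f' x) (at x)" by blast
  then show "(f has_real_derivative deriv f x) (at x)" using DERIV_imp_deriv by metis
  have "smooth_upto n (deriv f)" for n
  proof -
    obtain f' where f': "\<forall>x. (f has_real_derivative f' x) (at x)" "smooth_upto n f'" using ex by blast
    then have "deriv f = f'" by (intro ext DERIV_imp_deriv) auto
    then show ?thesis using f' by simp
  qed
  then show "smooth (deriv f)" by (simp add: smooth_def)
qed

lemma smooth_higher_deriv: "smooth f \<Longrightarrow> smooth ((deriv ^^ i) f)"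
  by (induction i) (auto intro: smooth_deriv)

lemma smooth_has_higher_deriv:
  "smooth f \<Longrightarrow> ((deriv ^^ i) f has_real_derivative (deriv ^^ Suc i) f x) (at x)"
  using smooth_deriv(1)[OF smooth_higher_deriv[of f i]] by simp

lemma smooth_continuous: "smooth f \<Longrightarrow> continuous_on S f"
  using smooth_deriv(1) by (intro continuous_at_imp_continuous_on ballI DERIV_isCont) blast

text \<open>The class of functions \<open>p (1/x) exp (- 1/x)\<close> with a polynomial \<open>p\<close>, extended by \<open>0\<close>, is closed under
  differentiation.\<close>

definition flat_exp :: "real poly \<Rightarrow> real \<Rightarrow> real" where
  "flat_exp p x = (if 0 < x then poly p (inverse x) * exp (- inverse x) else 0)"

lemma poly_times_exp_minus_tendsto_0: "((\<lambda>y::real. poly p y * exp (- y)) \<longlongrightarrow> 0) at_top"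
proof -
  have "((\<lambda>y::real. \<Sum>i\<le>degree p. coeff p i * (y ^ i / exp y)) \<longlongrightarrow> (\<Sum>i\<le>degree p. coeff p i * 0)) at_top"
    by (intro tendsto_sum tendsto_mult tendsto_const tendsto_power_div_exp_0)
  moreover have "(\<Sum>i\<le>degree p. coeff p i * (y ^ i / exp y)) = poly p y * exp (- y)" for y
    by (simp add: poly_altdef sum_distrib_right exp_minus divide_inverse mult.assoc)
  ultimately show ?thesis by simp
qed

lemma flat_exp_deriv:
  "(flat_exp p has_real_derivative flat_exp ([:0, 0, 1:] * (p - pderiv p)) x) (at x)"
proof -
  consider "x < 0" | "x = 0" | "0 < x" by linarith
  then show ?thesis
  proof cases
    case 1
    have "((\<lambda>_. 0) has_real_derivative 0) (at x)" by simp
    moreover have "eventually (\<lambda>y. 0 = flat_exp p y) (nhds x)"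
      using eventually_nhds_in_open[of "{..<0}" x] 1 by (auto simp: flat_exp_def elim!: eventually_mono)
    ultimately have "(flat_exp p has_real_derivative 0) (at x)"
      using DERIV_cong_ev[of x x "\<lambda>_. 0" "flat_exp p" 0 0] by auto
    then show ?thesis using 1 by (simp add: flat_exp_def)
  next
    case 3
    have "((\<lambda>x. poly p (inverse x) * exp (- inverse x)) has_real_derivative
        poly ([:0, 0, 1:] * (p - pderiv p)) (inverse x) * exp (- inverse x)) (at x)"
      using 3 by (auto intro!: derivative_eq_intros DERIV_chain2[OF poly_DERIV]
          simp: field_simps power2_eq_square)
    moreover have "eventually (\<lambda>y. poly p (inverse y) * exp (- inverse y) = flat_exp p y) (nhds x)"
      using eventually_nhds_in_open[of "{0<..}" x] 3 by (auto simp: flat_exp_def elim!: eventually_mono)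
    ultimately have "(flat_exp p has_real_derivative
        poly ([:0, 0, 1:] * (p - pderiv p)) (inverse x) * exp (- inverse x)) (at x)"
      using DERIV_cong_ev[of x x "\<lambda>x. poly p (inverse x) * exp (- inverse x)" "flat_exp p"] by blast
    then show ?thesis using 3 by (simp add: flat_exp_def)
  next
    case 2
    have "((\<lambda>h. flat_exp p h / h) \<longlongrightarrow> 0) (at 0)"
      unfolding filterlim_at_split
    proof
      have "\<forall>\<^sub>F h in at_left 0. 0 = flat_exp p h / h"
        by (auto simp: eventually_at_filter flat_exp_def)
      then show "((\<lambda>h. flat_exp p h / h) \<longlongrightarrow> 0) (at_left 0)"
        by (rule Lim_transform_eventually[OF tendsto_const])
      have "((\<lambda>h. poly (pCons 0 p) (inverse h) * exp (- inverse h)) \<longlongrightarrow> 0) (at_right (0::real))"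
        by (rule filterlim_compose[OF poly_times_exp_minus_tendsto_0 filterlim_inverse_at_top_right])
      moreover have "\<forall>\<^sub>F h in at_right 0. poly (pCons 0 p) (inverse h) * exp (- inverse h) = flat_exp p h / h"
        by (auto simp: eventually_at_filter flat_exp_def divide_inverse)
      ultimately show "((\<lambda>h. flat_exp p h / h) \<longlongrightarrow> 0) (at_right 0)"
        by (rule Lim_transform_eventually)
    qed
    then show ?thesis using 2 by (simp add: DERIV_def flat_exp_def)
  qed
qed

lemma smooth_flat_exp: "smooth (flat_exp p)"
proof -
  have "smooth_upto n (flat_exp p)" for n
  proof (induction n arbitrary: p)
    case (Suc n)
    then show ?case unfolding smooth_upto.simps using flat_exp_deriv by blast
  qed simp
  then show ?thesis by (simp add: smooth_def)
qed

text \<open>Smooth approximations from below of the indicator function of \<open>{a<..<b}\<close>, which increase to it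
  as \<open>n \<rightarrow> \<infinity>\<close>; no normalisation is needed because \<open>exp (- 1/x) \<rightarrow> 1\<close> as \<open>x \<rightarrow> \<infinity>\<close>. The
  arguments are written as affine functions of \<open>x\<close>, so that smoothness follows by composition.\<close>

definition bump :: "real \<Rightarrow> real \<Rightarrow> nat \<Rightarrow> real \<Rightarrow> real" where
  "bump a b n x = flat_exp 1 (real (Suc n) * x + real (Suc n) * (- a))
     * flat_exp 1 ((- real (Suc n)) * x + real (Suc n) * b)"

lemma flat_exp_1: "flat_exp 1 x = (if 0 < x then exp (- inverse x) else 0)"
  by (simp add: flat_exp_def)

lemma smooth_bump: "smooth (bump a b n)"
  unfolding bump_def[abs_def] by (rule smooth_mult[OF smooth_affine[OF smooth_flat_exp] smooth_affine[OF smooth_flat_exp]])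

lemma bump_eq:
  "bump a b n x = flat_exp 1 (real (Suc n) * (x - a)) * flat_exp 1 (real (Suc n) * (b - x))"
proof -
  have "real (Suc n) * x + real (Suc n) * (- a) = real (Suc n) * (x - a)"
    "(- real (Suc n)) * x + real (Suc n) * b = real (Suc n) * (b - x)" by (simp_all add: algebra_simps)
  then show ?thesis unfolding bump_def by (simp only:)
qed

lemma bump_bounds: "0 \<le> bump a b n x" "bump a b n x \<le> 1"
  unfolding bump_eq by (auto simp: flat_exp_1 zero_less_mult_iff intro!: mult_nonneg_nonneg mult_le_one)

lemma bump_pos_iff: "bump a b n x \<noteq> 0 \<longleftrightarrow> a < x \<and> x < b"
  unfolding bump_eq by (auto simp: flat_exp_1 zero_less_mult_iff)

lemma bump_tendsto_indicator: "(\<lambda>n. bump a b n x) \<longlonglongrightarrow> indicator {a<..<b} x"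
proof (cases "a < x \<and> x < b")
  case True
  have lim: "(\<lambda>n. flat_exp 1 (real (Suc n) * y)) \<longlonglongrightarrow> 1" if "0 < y" for y
  proof -
    have "filterlim (\<lambda>n. real (Suc n) * y) at_top sequentially"
      using that
      by (intro filterlim_at_top_mult_tendsto_pos[OF tendsto_const] filterlim_compose[OF filterlim_real_sequentially filterlim_Suc]) 
    then have "(\<lambda>n. exp (- inverse (real (Suc n) * y))) \<longlonglongrightarrow> exp (- 0)"
      by (intro tendsto_intros tendsto_inverse_0_at_top)
    moreover have "exp (- inverse (real (Suc n) * y)) = flat_exp 1 (real (Suc n) * y)" for n
      using that by (simp add: flat_exp_1)
    ultimately show ?thesis by simp
  qed
  have "(\<lambda>n. bump a b n x) \<longlonglongrightarrow> 1 * 1"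
    unfolding bump_eq using True by (intro tendsto_mult lim) auto
  then show ?thesis using True by simp
next
  case False
  then have "bump a b n x = 0" for n using bump_pos_iff by blast
  then show ?thesis using False by auto
qed

text \<open>The test functions constructed here are products of functions of one variable, whose iterated partial
  derivatives are again such products.\<close>

definition tensor :: "(real \<Rightarrow> real) \<Rightarrow> (real \<Rightarrow> real) \<Rightarrow> field2" where
  "tensor f g z = complex_of_real (f (fst z) * g (snd z))"

lemma partial_y_tensor: "smooth g \<Longrightarrow> partial_y (tensor f g) = tensor f (deriv g)"
proof -
  assume g: "smooth g"
  have "((\<lambda>s. tensor f g (x, s)) has_vector_derivative tensor f (deriv g) (x, y)) (at y)" for x y
    unfolding tensor_def using smooth_deriv(1)[OF g, of y]
    by (intro has_vector_derivative_of_real) (auto intro!: derivative_eq_intros simp: has_real_derivative_iff_has_vector_derivative[symmetric])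
  then show ?thesis unfolding partial_y_def by (intro ext) (auto intro: vector_derivative_at)
qed

lemma partial_x_tensor: "smooth f \<Longrightarrow> partial_x (tensor f g) = tensor (deriv f) g"
proof -
  assume f: "smooth f"
  have "((\<lambda>s. tensor f g (s, y)) has_vector_derivative tensor (deriv f) g (x, y)) (at x)" for x y
    unfolding tensor_def using smooth_deriv(1)[OF f, of x]
    by (intro has_vector_derivative_of_real) (auto intro!: derivative_eq_intros simp: has_real_derivative_iff_has_vector_derivative[symmetric])
  then show ?thesis unfolding partial_x_def by (intro ext) (auto intro: vector_derivative_at)
qed

lemma partials_tensor:
  assumes "smooth f" "smooth g"
  shows "partials i j (tensor f g) = tensor ((deriv ^^ i) f) ((deriv ^^ j) g)"
proof -
  have "(partial_y ^^ j) (tensor f g) = tensor f ((deriv ^^ j) g)"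
    by (induction j) (auto simp: partial_y_tensor smooth_higher_deriv assms)
  moreover have "(partial_x ^^ i) (tensor f g') = tensor ((deriv ^^ i) f) g'" for g'
    by (induction i) (auto simp: partial_x_tensor smooth_higher_deriv assms)
  ultimately show ?thesis by (simp add: partials_def)
qed

lemma tensor_differentiable:
  assumes "smooth f" "smooth g"
  shows "tensor f g differentiable_on UNIV"
unfolding differentiable_on_def
proof
  fix z :: "real \<times> real"
  have f: "(f has_derivative (*) (deriv f (fst z))) (at (fst z))"
    and g: "(g has_derivative (*) (deriv g (snd z))) (at (snd z))"
    using smooth_deriv(1) assms by (auto simp: has_field_derivative_def)
  have "((\<lambda>z. complex_of_real (f (fst z) * g (snd z))) has_derivative
     (\<lambda>h. complex_of_real (f (fst z) * (deriv g (snd z) * snd h) + (deriv f (fst z) * fst h) * g (snd z)))) (at z)"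
    by (intro has_derivative_of_real has_derivative_mult
        has_derivative_compose[OF has_derivative_fst[OF has_derivative_ident] f]
        has_derivative_compose[OF has_derivative_snd[OF has_derivative_ident] g])
  then show "tensor f g differentiable at z within UNIV"
    unfolding tensor_def[abs_def] differentiable_def by auto
qed

lemma tensor_continuous: "smooth f \<Longrightarrow> smooth g \<Longrightarrow> continuous_on S (tensor f g)"
  using differentiable_imp_continuous_on[OF tensor_differentiable] continuous_on_subset by blast

lemma tensor_test_function:
  assumes "smooth f" "smooth g"
    and f: "\<And>x. f x \<noteq> 0 \<Longrightarrow> x \<in> {p..q}" and g: "\<And>y. g y \<noteq> 0 \<Longrightarrow> y \<in> {r..s}"
    and \<Omega>: "{p..q} \<times> {r..s} \<subseteq> \<Omega>"
  shows "tensor f g \<in> test_functions \<Omega>"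
proof -
  have "{z. tensor f g z \<noteq> 0} \<subseteq> {p..q} \<times> {r..s}"
    using f g by (auto simp: tensor_def mem_Times_iff)
  then have cl: "closure {z. tensor f g z \<noteq> 0} \<subseteq> {p..q} \<times> {r..s}"
    by (intro closure_minimal closed_Times) auto
  moreover have "compact ({p..q} \<times> {r..s})" by (intro compact_Times) auto
  ultimately have "compact (closure {z. tensor f g z \<noteq> 0})"
    by (metis closed_closure compact_Int_closed inf.absorb_iff2)
  then show ?thesis
    using order.trans[OF cl \<Omega>]
    by (simp add: test_functions_def partials_tensor assms tensor_differentiable smooth_higher_deriv)
qed

section \<open>Uniqueness of weak derivatives\<close>

text \<open>Boxes form an intersection-stable generator of the Borel sets, so the integral of \<open>g\<close> vanishes over all Borel
  sets, and hence over all Lebesgue measurable sets, which differ from Borel sets by null sets.\<close>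

lemma integral_zero_on_boxes_imp_AE_zero:
  fixes g :: "'a::euclidean_space \<Rightarrow> real"
  assumes g: "integrable (lebesgue_on (box a b)) g"
    and zero: "\<And>p q. box p q \<subseteq> box a b \<Longrightarrow> (LINT z|lebesgue_on (box a b). indicator (box p q) z * g z) = 0"
  shows "AE z in lebesgue_on (box a b). g z = 0"
proof -
  define M where "M = lebesgue_on (box a b)"
  have gM: "integrable M g" using g by (simp add: M_def)
  have sp: "space M = box a b" by (simp add: M_def)
  have meas: "A \<inter> box a b \<in> sets M" if "A \<in> sets borel" for A
    using that by (auto simp: M_def sets_restrict_space)
  define I where "I A = (LINT z:A \<inter> box a b|M. g z)" for A
  have set_int: "set_integrable M (A \<inter> box a b) g" if "A \<in> sets borel" for A
    unfolding set_integrable_def using gM meas[OF that] by (intro integrable_mult_indicator)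
  have I_box: "I (box p q) = 0" for p q
  proof -
    have int: "box p q \<inter> box a b = box (\<Sum>i\<in>Basis. max (p \<bullet> i) (a \<bullet> i) *\<^sub>R i) (\<Sum>i\<in>Basis. min (q \<bullet> i) (b \<bullet> i) *\<^sub>R i)"
      by (auto simp: box_def)
    show ?thesis unfolding I_def int set_lebesgue_integral_def M_def
      using zero[of "\<Sum>i\<in>Basis. max (p \<bullet> i) (a \<bullet> i) *\<^sub>R i" "\<Sum>i\<in>Basis. min (q \<bullet> i) (b \<bullet> i) *\<^sub>R i"]
      unfolding int[symmetric] by simp
  qed
  have I_UNIV: "I UNIV = 0" using I_box[of a b] by (simp add: I_def)
  have I_borel: "I A = 0" if "A \<in> sets borel" for A
  proof -
    have A: "A \<in> sigma_sets UNIV (range (\<lambda>(p, q). box p q :: 'a set))"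
      using that by (simp add: borel_eq_box)
    have stable: "Int_stable (range (\<lambda>(p, q). box p q :: 'a set))"
    proof (rule Int_stableI)
      fix S T assume "S \<in> range (\<lambda>(p, q). box p q :: 'a set)" "T \<in> range (\<lambda>(p, q). box p q :: 'a set)"
      then obtain p q r s where "S = box p q" "T = box r s" by auto
      then have "S \<inter> T = box (\<Sum>i\<in>Basis. max (p \<bullet> i) (r \<bullet> i) *\<^sub>R i) (\<Sum>i\<in>Basis. min (q \<bullet> i) (s \<bullet> i) *\<^sub>R i)"
        by (auto simp: box_def)
      then show "S \<inter> T \<in> range (\<lambda>(p, q). box p q :: 'a set)" by auto
    qed
    have borel: "B \<in> sets borel" if "B \<in> sigma_sets UNIV (range (\<lambda>(p, q). box p q :: 'a set))" for B
      using that by (simp add: borel_eq_box)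
    show ?thesis
    proof (rule sigma_sets_induct_disjoint[OF stable _ A, where P = "\<lambda>A. I A = 0"])
      fix B assume "B \<in> range (\<lambda>(p, q). box p q :: 'a set)"
      then show "I B = 0" using I_box by auto
    next
      show "I {} = 0" by (simp add: I_def set_lebesgue_integral_def)
    next
      fix B assume B: "B \<in> sigma_sets UNIV (range (\<lambda>(p, q). box p q :: 'a set))" "I B = 0"
      have "I UNIV = (LINT z:(B \<inter> box a b) \<union> ((UNIV - B) \<inter> box a b)|M. g z)"
        unfolding I_def by (rule arg_cong[where f = "\<lambda>S. set_lebesgue_integral M S g"]) auto
      also have "\<dots> = I B + I (UNIV - B)"
        unfolding I_def using borel[OF B(1)] by (intro set_integral_Un set_int) auto
      finally show "I (UNIV - B) = 0" using B(2) I_UNIV by simp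
    next
      fix B :: "nat \<Rightarrow> 'a set"
      assume B: "disjoint_family B" "range B \<subseteq> sigma_sets UNIV (range (\<lambda>(p, q). box p q :: 'a set))" "\<And>i. I (B i) = 0"
      have b: "B i \<in> sets borel" for i using borel B(2) by auto
      have U: "(\<Union>i. B i) \<inter> box a b = (\<Union>i. B i \<inter> box a b)" by auto
      have "I (\<Union>i. B i) = (\<Sum>i. LINT z:B i \<inter> box a b|M. g z)"
        unfolding I_def U
      proof (rule lebesgue_integral_countable_add)
        show "B i \<inter> box a b \<in> sets M" for i using meas[OF b] .
        show "(B i \<inter> box a b) \<inter> (B j \<inter> box a b) = {}" if "i \<noteq> j" for i j
          using B(1) that by (auto simp: disjoint_family_on_def)
        show "set_integrable M (\<Union>i. B i \<inter> box a b) g"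
          unfolding U[symmetric] using b by (intro set_int) auto
      qed
      then show "I (\<Union>i. B i) = 0" using B(3) by (simp add: I_def)
    qed auto
  qed
  have "AE z in M. g z = (\<lambda>_. 0) z"
  proof (rule density_unique_real)
    fix A assume "A \<in> sets M"
    then have A: "A \<in> sets lebesgue" "A \<subseteq> box a b"
      by (auto simp: M_def sets_restrict_space)
    obtain S N N' where A': "A = S \<union> N" "N \<subseteq> N'" "N' \<in> null_sets lborel" "S \<in> sets lborel"
      using sets_completionE[OF A(1)] by metis
    have null: "N \<in> null_sets lebesgue" using A' by (meson null_sets_completion_subset null_sets_completionI)
    have "(LINT z:A|M. g z) = I S"
      unfolding I_def set_lebesgue_integral_def
    proof (rule integral_cong_AE)
      have "AE z in lebesgue. z \<notin> N" using null by (rule AE_not_in)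
      then have "AE z in M. z \<notin> N" unfolding M_def by (subst AE_restrict_space_iff) auto
      then show "AE z in M. indicat_real A z *\<^sub>R g z = indicat_real (S \<inter> box a b) z *\<^sub>R g z"
      proof eventually_elim
        case (elim z)
        then show ?case using A A' by (auto simp: indicator_def)
      qed
    qed (use \<open>A \<in> sets M\<close> gM A' meas in \<open>auto intro!: borel_measurable_times borel_measurable_indicator\<close>)
    then show "(LINT z:A|M. g z) = (LINT z:A|M. 0)" using I_borel A' by simp
  qed (use gM in auto)
  then show ?thesis unfolding M_def .
qed

lemma rectangle_eq_box: "rectangle a b c d = box (a, c) (b, d)"
  by (auto simp: rectangle_def box_def Basis_prod_def)

lemma tensor_bump_tendsto_indicator:
  "(\<lambda>n. tensor (bump a b n) (bump c d n) z) \<longlonglongrightarrow> complex_of_real (indicator (rectangle a b c d) z)"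
proof -
  have "(\<lambda>n. complex_of_real (bump a b n (fst z) * bump c d n (snd z)))
     \<longlonglongrightarrow> complex_of_real (indicator {a<..<b} (fst z) * indicator {c<..<d} (snd z))"
    by (intro tendsto_intros bump_tendsto_indicator)
  moreover have "indicator {a<..<b} (fst z) * indicator {c<..<d} (snd z) = (indicator (rectangle a b c d) z :: real)"
    by (auto simp: indicator_def rectangle_def mem_Times_iff)
  ultimately show ?thesis by (simp add: tensor_def)
qed

lemma norm_tensor_bump_le: "cmod (tensor (bump a b n) (bump c d n') z) \<le> 1"
  using bump_bounds by (auto simp: tensor_def norm_mult abs_mult intro!: mult_le_one)

lemma tensor_bump_test_function:
  assumes "{a..b} \<times> {c..d} \<subseteq> \<Omega>"
  shows "tensor (bump a b n) (bump c d n') \<in> test_functions \<Omega>"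
  by (rule tensor_test_function[OF smooth_bump smooth_bump _ _ assms])
     (auto simp: bump_pos_iff)

lemma L1_loc_diff:
  assumes "v \<in> L1_loc \<Omega>" "w \<in> L1_loc \<Omega>"
  shows "(\<lambda>z. v z - w z) \<in> L1_loc \<Omega>"
  using assms unfolding L1_loc_def by (auto intro: set_integral_diff)

lemma L1_loc_test_integrable:
  assumes w: "w \<in> L1_loc \<Omega>" and \<phi>: "continuous_on UNIV \<phi>" "\<And>z. \<phi> z \<noteq> 0 \<Longrightarrow> z \<in> K" and K: "compact K" "K \<subseteq> \<Omega>"
    and \<Omega>: "\<Omega> \<in> sets lebesgue"
  shows "integrable (lebesgue_on \<Omega>) (\<lambda>z. w z * \<phi> z)"
proof -
  have "w absolutely_integrable_on K" using w K by (simp add: L1_loc_def)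
  then have wK: "integrable (lebesgue_on K) w"
    using K by (simp add: absolutely_integrable_measurable borel_measurable_if_D lmeasurable_compact set_integrable_def integrable_restrict_space fmeasurableD)
  obtain B where B: "\<And>z. z \<in> K \<Longrightarrow> cmod (\<phi> z) \<le> B"
    using compact_imp_bounded[OF compact_continuous_image[OF continuous_on_subset[OF \<phi>(1)] K(1)]]
    by (auto simp: bounded_iff)
  have "integrable (lebesgue_on K) (\<lambda>z. w z * \<phi> z)"
  proof (rule Bochner_Integration.integrable_bound[of _ "\<lambda>z. B * norm (w z)"])
    show "integrable (lebesgue_on K) (\<lambda>z. B * norm (w z))" using wK by auto
    show "(\<lambda>z. w z * \<phi> z) \<in> borel_measurable (lebesgue_on K)"
      using wK continuous_on_subset[OF \<phi>(1)] K
      by (intro borel_measurable_times) (auto intro!: continuous_imp_measurable_on_sets_lebesgue lmeasurable_compact fmeasurableD)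
    show "AE z in lebesgue_on K. norm (w z * \<phi> z) \<le> norm (B * norm (w z))"
    proof (rule AE_I2)
      fix z assume "z \<in> space (lebesgue_on K)"
      then have "cmod (\<phi> z) \<le> B" using B by simp
      then have "cmod (w z) * cmod (\<phi> z) \<le> cmod (w z) * B" by (intro mult_left_mono) auto
      also have "\<dots> \<le> \<bar>B\<bar> * cmod (w z)" by (metis abs_ge_self mult.commute mult_right_mono norm_ge_zero)
      finally show "norm (w z * \<phi> z) \<le> norm (B * norm (w z))" by (simp add: norm_mult abs_mult)
    qed
  qed
  then have "integrable lebesgue (\<lambda>z. indicator K z *\<^sub>R (w z * \<phi> z))"
    using K by (subst (asm) integrable_restrict_space) (auto simp: lmeasurable_compact fmeasurableD)
  then have "integrable lebesgue (\<lambda>z. indicator \<Omega> z *\<^sub>R (w z * \<phi> z))"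
    by (rule Bochner_Integration.integrable_cong[THEN iffD1, rotated 2])
       (use \<phi>(2) K in \<open>auto simp: indicator_def\<close>)
  then show ?thesis using \<Omega> by (subst integrable_restrict_space) auto
qed

text \<open>The fundamental lemma of the calculus of variations: bumps approximate the indicators of boxes,
  and a locally integrable function is determined by its integrals over boxes.\<close>

lemma L1_loc_zero_if_tests_zero:
  assumes \<Omega>: "\<Omega> = rectangle a b c d" and w: "w \<in> L1_loc \<Omega>"
    and zero: "\<And>\<phi>. \<phi> \<in> test_functions \<Omega> \<Longrightarrow> (LINT z|lebesgue_on \<Omega>. w z * \<phi> z) = 0"
  shows "AE z in lebesgue_on \<Omega>. w z = 0"
proof -
  have \<Omega>_meas: "\<Omega> \<in> sets lebesgue" by (simp add: \<Omega> rectangle_eq_box)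
  have local: "AE z in lebesgue. z \<in> rectangle p q r s \<longrightarrow> w z = 0" if K: "{p..q} \<times> {r..s} \<subseteq> \<Omega>" for p q r s
  proof -
    define Q where "Q = rectangle p q r s"
    have Q: "Q = box (p, r) (q, s)" by (simp add: Q_def rectangle_eq_box)
    have Qs: "Q \<subseteq> \<Omega>" using K by (auto simp: Q_def rectangle_def)
    have Qm: "Q \<in> sets lebesgue" by (simp add: Q)
    have "w absolutely_integrable_on ({p..q} \<times> {r..s})"
      using w K by (auto simp: L1_loc_def intro!: compact_Times)
    then have "w absolutely_integrable_on Q"
      by (rule set_integrable_subset) (auto simp: Q_def rectangle_def Qm[unfolded Q_def rectangle_def])
    then have wQ: "integrable (lebesgue_on Q) w"
      using Qm by (simp add: set_integrable_def integrable_restrict_space)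
    have box0: "(LINT z|lebesgue_on Q. indicator (box x y) z *\<^sub>R w z) = 0" if "box x y \<subseteq> Q" for x y
    proof (cases "box x y = {}")
      case False
      obtain x1 x2 y1 y2 where xy: "x = (x1, x2)" "y = (y1, y2)" by (cases x, cases y)
      have R: "box x y = rectangle x1 y1 x2 y2" by (simp add: xy rectangle_eq_box)
      have "closure (box x y) \<subseteq> closure Q" using that by (rule closure_mono)
      moreover have "Q \<noteq> {}" using that False by auto
      ultimately have "cbox x y \<subseteq> cbox (p, r) (q, s)" using False by (simp add: Q closure_box)
      then have sub: "{x1..y1} \<times> {x2..y2} \<subseteq> \<Omega>"
        using K by (auto simp: xy cbox_Pair_eq)
      have R_meas: "rectangle x1 y1 x2 y2 \<in> sets lebesgue" by (simp add: rectangle_eq_box)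
      have wi: "integrable (lebesgue_on \<Omega>) (\<lambda>z. indicator (rectangle x1 y1 x2 y2) z *\<^sub>R w z)"
      proof -
        have "integrable (lebesgue_on Q) (\<lambda>z. indicator (rectangle x1 y1 x2 y2) z *\<^sub>R w z)"
          using wQ that R_meas Qm
          by (intro integrable_mult_indicator) (auto simp: R sets_restrict_space)
        then have "integrable lebesgue (\<lambda>z. indicator Q z *\<^sub>R (indicator (rectangle x1 y1 x2 y2) z *\<^sub>R w z))"
          using Qm by (subst (asm) integrable_restrict_space) auto
        then have "integrable lebesgue (\<lambda>z. indicator \<Omega> z *\<^sub>R (indicator (rectangle x1 y1 x2 y2) z *\<^sub>R w z))"
          by (rule Bochner_Integration.integrable_cong[THEN iffD1, rotated 2])
             (use that Qs in \<open>auto simp: indicator_def R\<close>)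
        then show ?thesis using \<Omega>_meas by (subst integrable_restrict_space) auto
      qed
      define \<phi> where "\<phi> n = tensor (bump x1 y1 n) (bump x2 y2 n)" for n
      have \<phi>: "\<phi> n \<in> test_functions \<Omega>" for n
        unfolding \<phi>_def using sub by (rule tensor_bump_test_function)
      have supp: "\<phi> n z \<noteq> 0 \<Longrightarrow> z \<in> rectangle x1 y1 x2 y2" for n z
        by (auto simp: \<phi>_def tensor_def bump_pos_iff rectangle_def mem_Times_iff)
      have "(\<lambda>n. LINT z|lebesgue_on \<Omega>. w z * \<phi> n z) \<longlonglongrightarrow> (LINT z|lebesgue_on \<Omega>. indicator (rectangle x1 y1 x2 y2) z *\<^sub>R w z)"
      proof (rule integral_dominated_convergence)
        show "integrable (lebesgue_on \<Omega>) (\<lambda>z. norm (indicator (rectangle x1 y1 x2 y2) z *\<^sub>R w z))"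
          using wi by (rule integrable_norm)
        show "AE z in lebesgue_on \<Omega>. (\<lambda>n. w z * \<phi> n z) \<longlonglongrightarrow> indicator (rectangle x1 y1 x2 y2) z *\<^sub>R w z"
        proof (rule AE_I2)
          fix z
          have "(\<lambda>n. w z * \<phi> n z) \<longlonglongrightarrow> w z * complex_of_real (indicator (rectangle x1 y1 x2 y2) z)"
            unfolding \<phi>_def by (intro tendsto_intros tensor_bump_tendsto_indicator)
          then show "(\<lambda>n. w z * \<phi> n z) \<longlonglongrightarrow> indicator (rectangle x1 y1 x2 y2) z *\<^sub>R w z"
            by (simp add: scaleR_conv_of_real mult.commute)
        qed
        show "AE z in lebesgue_on \<Omega>. norm (w z * \<phi> n z) \<le> norm (indicator (rectangle x1 y1 x2 y2) z *\<^sub>R w z)" for n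
        proof (rule AE_I2)
          fix z
          show "norm (w z * \<phi> n z) \<le> norm (indicator (rectangle x1 y1 x2 y2) z *\<^sub>R w z)"
            using supp[of n z] norm_tensor_bump_le[of x1 y1 n x2 y2 n z] mult_left_mono[of "cmod (\<phi> n z)" 1 "cmod (w z)"]
            by (cases "\<phi> n z = 0") (auto simp: norm_mult \<phi>_def)
        qed
        have "integrable (lebesgue_on \<Omega>) (\<lambda>z. w z * \<phi> n z)" for n
          using w \<Omega>_meas sub supp
          by (intro L1_loc_test_integrable[of w \<Omega> _ "{x1..y1} \<times> {x2..y2}"])
             (fastforce simp: \<phi>_def rectangle_def mem_Times_iff intro!: tensor_continuous smooth_bump compact_Times)+
        then show "(\<lambda>z. w z * \<phi> n z) \<in> borel_measurable (lebesgue_on \<Omega>)" for n by auto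
        show "(\<lambda>z. indicator (rectangle x1 y1 x2 y2) z *\<^sub>R w z) \<in> borel_measurable (lebesgue_on \<Omega>)" using wi by auto
      qed
      then have "(LINT z|lebesgue_on \<Omega>. indicator (rectangle x1 y1 x2 y2) z *\<^sub>R w z) = 0"
        using zero[OF \<phi>] LIMSEQ_unique[OF _ tendsto_const] by simp
      also have "(LINT z|lebesgue_on \<Omega>. indicator (rectangle x1 y1 x2 y2) z *\<^sub>R w z)
          = (LINT z|lebesgue. indicator \<Omega> z *\<^sub>R (indicator (rectangle x1 y1 x2 y2) z *\<^sub>R w z))"
        using \<Omega>_meas by (subst integral_restrict_space) auto
      also have "\<dots> = (LINT z|lebesgue. indicator Q z *\<^sub>R (indicator (rectangle x1 y1 x2 y2) z *\<^sub>R w z))"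
        by (rule Bochner_Integration.integral_cong) (use that Qs in \<open>auto simp: indicator_def R\<close>)
      also have "\<dots> = (LINT z|lebesgue_on Q. indicator (rectangle x1 y1 x2 y2) z *\<^sub>R w z)"
        using Qm by (subst integral_restrict_space) auto
      finally show ?thesis by (simp add: R)
    qed simp
    have part: "AE z in lebesgue_on Q. L (w z) = 0" if L: "L = Re \<or> L = Im" for L
      unfolding Q
    proof (rule integral_zero_on_boxes_imp_AE_zero)
      have bl: "bounded_linear L" using L bounded_linear_Re bounded_linear_Im by auto
      show "integrable (lebesgue_on (box (p, r) (q, s))) (\<lambda>z. L (w z))"
        using wQ integrable_bounded_linear[OF bl] by (simp add: Q)
      fix x y assume sub: "box x y \<subseteq> box (p, r) (q, s)"
      have i: "integrable (lebesgue_on Q) (\<lambda>z. indicator (box x y) z *\<^sub>R w z)"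
        using wQ sub Qm by (intro integrable_mult_indicator) (auto simp: Q sets_restrict_space)
      have "L (indicator (box x y) z *\<^sub>R w z) = indicator (box x y) z * L (w z)" for z
        using L by auto
      then show "(LINT z|lebesgue_on (box (p, r) (q, s)). indicator (box x y) z * L (w z)) = 0"
        using integral_bounded_linear[OF bl i] box0[of x y] sub linear_0[OF bounded_linear.linear[OF bl]] by (simp add: Q)
    qed
    have "AE z in lebesgue_on Q. w z = 0"
      using part[OF disjI1[OF refl]] part[OF disjI2[OF refl]] by eventually_elim (auto simp: complex_eq_iff)
    then show ?thesis using Qm by (subst (asm) AE_restrict_space_iff) (auto simp: Q_def)
  qed
  have "AE z in lebesgue. \<forall>m::nat. z \<in> rectangle (a + 1 / real (Suc m)) (b - 1 / real (Suc m)) (c + 1 / real (Suc m)) (d - 1 / real (Suc m)) \<longrightarrow> w z = 0"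
    unfolding AE_all_countable
  proof
    fix m :: nat
    have p: "0 < 1 / real (Suc m)" by simp
    have "{a + 1 / real (Suc m)..b - 1 / real (Suc m)} \<times> {c + 1 / real (Suc m)..d - 1 / real (Suc m)} \<subseteq> \<Omega>"
    proof
      fix z assume "z \<in> {a + 1 / real (Suc m)..b - 1 / real (Suc m)} \<times> {c + 1 / real (Suc m)..d - 1 / real (Suc m)}"
      then show "z \<in> \<Omega>" using p unfolding \<Omega> rectangle_def mem_Times_iff greaterThanLessThan_iff atLeastAtMost_iff by linarith
    qed
    then show "AE z in lebesgue. z \<in> rectangle (a + 1 / real (Suc m)) (b - 1 / real (Suc m)) (c + 1 / real (Suc m)) (d - 1 / real (Suc m)) \<longrightarrow> w z = 0"
      by (rule local)
  qed
  then have "AE z in lebesgue. z \<in> \<Omega> \<longrightarrow> w z = 0"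
  proof eventually_elim
    case (elim z)
    show ?case
    proof
      assume "z \<in> \<Omega>"
      then have "0 < Min {fst z - a, b - fst z, snd z - c, d - snd z}"
        by (auto simp: \<Omega> rectangle_def)
      then obtain m where m: "inverse (real (Suc m)) < Min {fst z - a, b - fst z, snd z - c, d - snd z}"
        using reals_Archimedean by blast
      then have "z \<in> rectangle (a + 1 / real (Suc m)) (b - 1 / real (Suc m)) (c + 1 / real (Suc m)) (d - 1 / real (Suc m))"
        unfolding rectangle_def mem_Times_iff greaterThanLessThan_iff inverse_eq_divide by simp
      then show "w z = 0" using elim by blast
    qed
  qed
  then show ?thesis using \<Omega>_meas by (subst AE_restrict_space_iff) auto
qed

lemma rectangle_lmeasurable: "rectangle a b c d \<in> lmeasurable"
  by (simp add: rectangle_eq_box)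

lemma partial_x_support: "partial_x g z \<noteq> 0 \<Longrightarrow> z \<in> closure {z. g z \<noteq> 0}"
proof (rule ccontr)
  assume nz: "partial_x g z \<noteq> 0" and z: "z \<notin> closure {z. g z \<noteq> 0}"
  define S where "S = (\<lambda>s. (s, snd z)) -` (- closure {z. g z \<noteq> 0})"
  have o: "open S" unfolding S_def by (intro open_vimage continuous_intros) auto
  have i: "fst z \<in> S" using z by (simp add: S_def)
  have e: "0 = g (s, snd z)" if "s \<in> S" for s
    using that closure_subset[of "{z. g z \<noteq> 0}"] by (auto simp: S_def)
  have "((\<lambda>s. g (s, snd z)) has_vector_derivative 0) (at (fst z))"
    by (rule has_vector_derivative_transform_within_open[OF has_vector_derivative_const o i e])
  then show False using nz by (simp add: partial_x_def vector_derivative_at)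
qed

lemma partial_y_support: "partial_y g z \<noteq> 0 \<Longrightarrow> z \<in> closure {z. g z \<noteq> 0}"
proof (rule ccontr)
  assume nz: "partial_y g z \<noteq> 0" and z: "z \<notin> closure {z. g z \<noteq> 0}"
  define S where "S = (\<lambda>s. (fst z, s)) -` (- closure {z. g z \<noteq> 0})"
  have o: "open S" unfolding S_def by (intro open_vimage continuous_intros) auto
  have i: "snd z \<in> S" using z by (simp add: S_def)
  have e: "0 = g (fst z, s)" if "s \<in> S" for s
    using that closure_subset[of "{z. g z \<noteq> 0}"] by (auto simp: S_def)
  have "((\<lambda>s. g (fst z, s)) has_vector_derivative 0) (at (snd z))"
    by (rule has_vector_derivative_transform_within_open[OF has_vector_derivative_const o i e])
  then show False using nz by (simp add: partial_y_def vector_derivative_at)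
qed

text \<open>A function that vanishes on an open set has vanishing partial derivatives there. This makes
  \<open>v * partials i j \<phi>\<close> integrable for locally integrable \<open>v\<close>.\<close>

lemma partials_support: "partials i j g z \<noteq> 0 \<Longrightarrow> z \<in> closure {z. g z \<noteq> 0}"
proof -
  have cl: "{z. h z \<noteq> 0} \<subseteq> closure {z. g z \<noteq> 0} \<Longrightarrow> closure {z. h z \<noteq> 0} \<subseteq> closure {z. g z \<noteq> 0}" for h :: field2
    by (rule closure_minimal) auto
  have y: "{z. (partial_y ^^ j) g z \<noteq> 0} \<subseteq> closure {z. g z \<noteq> 0}" for j
  proof (induction j)
    case (Suc j)
    then show ?case using cl[OF Suc] partial_y_support[of "(partial_y ^^ j) g"] by auto
  qed (use closure_subset[of "{z. g z \<noteq> 0}"] in auto)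
  have "{z. partials i j g z \<noteq> 0} \<subseteq> closure {z. g z \<noteq> 0}" for i
    unfolding partials_def
  proof (induction i)
    case (Suc i)
    then show ?case using cl[OF Suc] partial_x_support[of "(partial_x ^^ i) ((partial_y ^^ j) g)"] by auto
  qed (use y[of j] in auto)
  then show "partials i j g z \<noteq> 0 \<Longrightarrow> z \<in> closure {z. g z \<noteq> 0}" by auto
qed

lemma L1_loc_partials_integrable:
  assumes w: "w \<in> L1_loc \<Omega>" and \<phi>: "\<phi> \<in> test_functions \<Omega>" and \<Omega>: "\<Omega> \<in> sets lebesgue"
  shows "integrable (lebesgue_on \<Omega>) (\<lambda>z. w z * partials i j \<phi> z)"
  using \<phi> unfolding test_functions_def
  by (intro L1_loc_test_integrable[OF w _ _ _ _ \<Omega>, of _ "closure {z. \<phi> z \<noteq> 0}"])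
     (auto intro: differentiable_imp_continuous_on partials_support)

lemma partials_0: "partials 0 0 \<phi> = \<phi>" by (simp add: partials_def)

lemma has_weak_deriv_unique:
  assumes \<Omega>: "\<Omega> = rectangle a b c d"
    and w: "has_weak_deriv \<Omega> i j v w1" "has_weak_deriv \<Omega> i j v w2"
  shows "AE z in lebesgue_on \<Omega>. w1 z = w2 z"
proof -
  have \<Omega>m: "\<Omega> \<in> sets lebesgue" using \<Omega> rectangle_lmeasurable fmeasurableD by blast
  have L: "w1 \<in> L1_loc \<Omega>" "w2 \<in> L1_loc \<Omega>" using w by (auto simp: has_weak_deriv_def)
  have "AE z in lebesgue_on \<Omega>. w1 z - w2 z = 0"
  proof (rule L1_loc_zero_if_tests_zero[OF \<Omega> L1_loc_diff[OF L]])
    fix \<phi> assume \<phi>: "\<phi> \<in> test_functions \<Omega>"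
    have i: "integrable (lebesgue_on \<Omega>) (\<lambda>z. w1 z * \<phi> z)" "integrable (lebesgue_on \<Omega>) (\<lambda>z. w2 z * \<phi> z)"
      using L1_loc_partials_integrable[OF L(1) \<phi> \<Omega>m, of 0 0] L1_loc_partials_integrable[OF L(2) \<phi> \<Omega>m, of 0 0]
      by (simp_all add: partials_0)
    have "(LINT z|lebesgue_on \<Omega>. v z * partials i j \<phi> z) = (-1) ^ (i + j) * (LINT z|lebesgue_on \<Omega>. w1 z * \<phi> z)"
      using w(1) \<phi> unfolding has_weak_deriv_def by blast
    moreover have "(LINT z|lebesgue_on \<Omega>. v z * partials i j \<phi> z) = (-1) ^ (i + j) * (LINT z|lebesgue_on \<Omega>. w2 z * \<phi> z)"
      using w(2) \<phi> unfolding has_weak_deriv_def by blast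
    ultimately have "(LINT z|lebesgue_on \<Omega>. w1 z * \<phi> z) = (LINT z|lebesgue_on \<Omega>. w2 z * \<phi> z)" by simp
    then show "(LINT z|lebesgue_on \<Omega>. (w1 z - w2 z) * \<phi> z) = 0"
      using i by (simp add: left_diff_distrib)
  qed
  then show ?thesis by eventually_elim simp
qed

lemma has_weak_deriv_diff:
  assumes \<Omega>: "\<Omega> = rectangle a b c d"
    and w: "has_weak_deriv \<Omega> i j v1 w1" "has_weak_deriv \<Omega> i j v2 w2"
  shows "has_weak_deriv \<Omega> i j (\<lambda>z. v1 z - v2 z) (\<lambda>z. w1 z - w2 z)"
proof -
  have \<Omega>m: "\<Omega> \<in> sets lebesgue" using \<Omega> rectangle_lmeasurable fmeasurableD by blast
  have L: "w1 \<in> L1_loc \<Omega>" "w2 \<in> L1_loc \<Omega>" "v1 \<in> L1_loc \<Omega>" "v2 \<in> L1_loc \<Omega>"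
    using w by (auto simp: has_weak_deriv_def)
  show ?thesis unfolding has_weak_deriv_def
  proof (intro conjI ballI L1_loc_diff L)
    fix \<phi> assume \<phi>: "\<phi> \<in> test_functions \<Omega>"
    note i = L1_loc_partials_integrable[OF L(1) \<phi> \<Omega>m, of 0 0] L1_loc_partials_integrable[OF L(2) \<phi> \<Omega>m, of 0 0]
      L1_loc_partials_integrable[OF L(3) \<phi> \<Omega>m, of i j] L1_loc_partials_integrable[OF L(4) \<phi> \<Omega>m, of i j]
    have e: "(LINT z|lebesgue_on \<Omega>. v1 z * partials i j \<phi> z) = (-1) ^ (i + j) * (LINT z|lebesgue_on \<Omega>. w1 z * \<phi> z)"
      "(LINT z|lebesgue_on \<Omega>. v2 z * partials i j \<phi> z) = (-1) ^ (i + j) * (LINT z|lebesgue_on \<Omega>. w2 z * \<phi> z)"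
      using w \<phi> unfolding has_weak_deriv_def by blast+
    show "(LINT z|lebesgue_on \<Omega>. (v1 z - v2 z) * partials i j \<phi> z)
        = (-1) ^ (i + j) * (LINT z|lebesgue_on \<Omega>. (w1 z - w2 z) * \<phi> z)"
      using i e by (simp add: left_diff_distrib right_diff_distrib partials_0)
  qed
qed

lemma has_weak_deriv_weak_deriv:
  "has_weak_deriv \<Omega> i j v w \<Longrightarrow> has_weak_deriv \<Omega> i j v (weak_deriv \<Omega> i j v)"
  unfolding weak_deriv_def by (rule someI[where P = "has_weak_deriv \<Omega> i j v"])

lemma weak_deriv_diff_AE:
  assumes \<Omega>: "\<Omega> = rectangle a b c d"
    and w: "has_weak_deriv \<Omega> i j v1 w1" "has_weak_deriv \<Omega> i j v2 w2"
  shows "AE z in lebesgue_on \<Omega>. weak_deriv \<Omega> i j (\<lambda>z. v1 z - v2 z) z = weak_deriv \<Omega> i j v1 z - weak_deriv \<Omega> i j v2 z"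
  using has_weak_deriv_diff[OF \<Omega> w[THEN has_weak_deriv_weak_deriv]]
  by (intro has_weak_deriv_unique[OF \<Omega>]) (auto intro: has_weak_deriv_weak_deriv)

section \<open>Norms and their suprema over time\<close>

text \<open>The value of \<open>Cm_time_norm\<close> is a real supremum, which carries information only if the set is bounded. That it
  is bounded follows from continuity in time and a triangle inequality of the norm. For the Sobolev norms, which
  are formed with chosen weak derivatives, the triangle inequality rests on their uniqueness.\<close>

lemma measurable_lebesgue_on_AE:
  fixes f g :: field2
  assumes "\<Omega> \<in> sets lebesgue" "f \<in> borel_measurable (lebesgue_on \<Omega>)" "AE z in lebesgue_on \<Omega>. f z = g z"
  shows "g \<in> borel_measurable (lebesgue_on \<Omega>)"
proof -
  have "(\<lambda>z. if z \<in> \<Omega> then f z else 0) \<in> borel_measurable lebesgue"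
    using assms by (simp add: borel_measurable_if)
  moreover have "AE z in lebesgue. (if z \<in> \<Omega> then f z else 0) = (if z \<in> \<Omega> then g z else 0)"
    using assms by (subst (asm) AE_restrict_space_iff) (auto elim: eventually_mono)
  ultimately have "(\<lambda>z. if z \<in> \<Omega> then g z else 0) \<in> borel_measurable lebesgue"
    by (rule borel_measurable_AE)
  then show ?thesis using assms by (simp add: borel_measurable_if)
qed

locale plane_rectangle =
  fixes a b c d :: real and \<Omega> :: "(real \<times> real) set"
  assumes ab: "a < b" and cd: "c < d" and \<Omega>: "\<Omega> = rectangle a b c d"
begin

lemma lmeas: "\<Omega> \<in> lmeasurable" and meas: "\<Omega> \<in> sets lebesgue"
  using \<Omega> rectangle_lmeasurable fmeasurableD by auto

lemma emeasure_pos: "emeasure (lebesgue_on \<Omega>) (space (lebesgue_on \<Omega>)) \<noteq> 0"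
proof -
  have "emeasure lborel (box (a, c) (b, d)) = ennreal ((b - a) * (d - c))"
    using ab cd by (simp add: emeasure_lborel_box_eq Basis_prod_def prod.reindex mult.commute)
  then show ?thesis using meas ab cd
    by (subst emeasure_restrict_space) (auto simp: \<Omega> rectangle_eq_box)
qed

lemma esssup_nonneg: "0 \<le> esssup (lebesgue_on \<Omega>) (\<lambda>z. ereal (cmod (v z)))"
proof -
  have "(0::ereal) = esssup (lebesgue_on \<Omega>) (\<lambda>z. 0)" using emeasure_pos by (simp add: esssup_const)
  also have "\<dots> \<le> esssup (lebesgue_on \<Omega>) (\<lambda>z. ereal (cmod (v z)))"
    by (rule esssup_mono) auto
  finally show ?thesis .
qed

lemma Linf_norm_nonneg: "0 \<le> Linf_norm \<Omega> v"
  unfolding Linf_norm_def using esssup_nonneg by (rule real_of_ereal_pos)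

lemma Linf_AE: "v \<in> Linf \<Omega> \<Longrightarrow> AE z in lebesgue_on \<Omega>. cmod (v z) \<le> Linf_norm \<Omega> v"
proof -
  assume v: "v \<in> Linf \<Omega>"
  define E where "E = esssup (lebesgue_on \<Omega>) (\<lambda>z. ereal (cmod (v z)))"
  have "E < \<infinity>" "0 \<le> E" using v esssup_nonneg by (auto simp: Linf_def E_def)
  then have E: "ereal (Linf_norm \<Omega> v) = E" unfolding Linf_norm_def E_def[symmetric] by (intro ereal_real') auto
  have "AE z in lebesgue_on \<Omega>. ereal (cmod (v z)) \<le> ereal (Linf_norm \<Omega> v)"
    unfolding E E_def by (rule esssup_AE)
  then show ?thesis by simp
qed

lemma LinfI:
  assumes v: "v \<in> borel_measurable (lebesgue_on \<Omega>)" and ae: "AE z in lebesgue_on \<Omega>. cmod (v z) \<le> B"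
  shows "v \<in> Linf \<Omega>" "Linf_norm \<Omega> v \<le> B"
proof -
  define E where "E = esssup (lebesgue_on \<Omega>) (\<lambda>z. ereal (cmod (v z)))"
  have m: "(\<lambda>z. ereal (cmod (v z))) \<in> borel_measurable (lebesgue_on \<Omega>)" using v by measurable
  have E: "E \<le> ereal B" unfolding E_def using ae by (intro esssup_I m) auto
  then show "v \<in> Linf \<Omega>" using v by (auto simp: Linf_def E_def[symmetric])
  show "Linf_norm \<Omega> v \<le> B" unfolding Linf_norm_def E_def[symmetric]
    using E esssup_nonneg[of v, folded E_def] by (cases E) auto
qed

lemma Linf_measurable: "v \<in> Linf \<Omega> \<Longrightarrow> v \<in> borel_measurable (lebesgue_on \<Omega>)"
  by (simp add: Linf_def)

lemma Linf_AE_cong: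
  assumes "v \<in> Linf \<Omega>" "AE z in lebesgue_on \<Omega>. v z = w z"
  shows "w \<in> Linf \<Omega>"
proof (rule LinfI(1))
  show "w \<in> borel_measurable (lebesgue_on \<Omega>)"
    by (rule measurable_lebesgue_on_AE[OF meas Linf_measurable[OF assms(1)] assms(2)])
  show "AE z in lebesgue_on \<Omega>. cmod (w z) \<le> Linf_norm \<Omega> v"
    using assms(2) Linf_AE[OF assms(1)] by eventually_elim simp
qed

lemma Linf_diff:
  assumes "v \<in> Linf \<Omega>" "w \<in> Linf \<Omega>"
  shows "(\<lambda>z. v z - w z) \<in> Linf \<Omega>"
proof (rule LinfI(1))
  show "(\<lambda>z. v z - w z) \<in> borel_measurable (lebesgue_on \<Omega>)"
    using assms[THEN Linf_measurable] by measurable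
  show "AE z in lebesgue_on \<Omega>. cmod (v z - w z) \<le> Linf_norm \<Omega> v + Linf_norm \<Omega> w"
    using Linf_AE[OF assms(1)] Linf_AE[OF assms(2)]
  proof eventually_elim
    case (elim z)
    then show ?case using norm_triangle_ineq4[of "v z" "w z"] by linarith
  qed
qed

lemma Linf_cmult:
  assumes "v \<in> Linf \<Omega>"
  shows "(\<lambda>z. k * v z) \<in> Linf \<Omega>"
proof (rule LinfI(1))
  show "(\<lambda>z. k * v z) \<in> borel_measurable (lebesgue_on \<Omega>)"
    using Linf_measurable[OF assms] by measurable
  show "AE z in lebesgue_on \<Omega>. cmod (k * v z) \<le> cmod k * Linf_norm \<Omega> v"
    using Linf_AE[OF assms] by eventually_elim (auto simp: norm_mult intro: mult_left_mono)
qed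

text \<open>The triangle inequality, with the difference replaced by a function \<open>x\<close> that equals it almost everywhere,
  such as the chosen weak derivative of a difference.\<close>

lemma Linf_norm_le_AE:
  assumes v: "v \<in> borel_measurable (lebesgue_on \<Omega>)" and "w \<in> Linf \<Omega>" "x \<in> Linf \<Omega>"
    and ae: "AE z in lebesgue_on \<Omega>. x z = v z - w z"
  shows "Linf_norm \<Omega> v \<le> Linf_norm \<Omega> w + Linf_norm \<Omega> x"
proof (rule LinfI(2)[OF v])
  show "AE z in lebesgue_on \<Omega>. cmod (v z) \<le> Linf_norm \<Omega> w + Linf_norm \<Omega> x"
    using Linf_AE[OF assms(2)] Linf_AE[OF assms(3)] ae
  proof eventually_elim
    case (elim z)
    then show ?case using norm_triangle_sub[of "v z" "w z"] by simp
  qed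
qed

lemma finite_index: "finite {(i, j). i + j \<le> (k::nat)}"
  by (rule finite_subset[of _ "{..k} \<times> {..k}"]) auto

lemma Wk_inf_weak_deriv:
  assumes v: "v \<in> Wk_inf \<Omega> k" and ij: "i + j \<le> k"
  shows "has_weak_deriv \<Omega> i j v (weak_deriv \<Omega> i j v)" "weak_deriv \<Omega> i j v \<in> Linf \<Omega>"
    "Linf_norm \<Omega> (weak_deriv \<Omega> i j v) \<le> Wk_inf_norm \<Omega> k v"
proof -
  obtain w where w: "w \<in> Linf \<Omega>" "has_weak_deriv \<Omega> i j v w" using v ij by (auto simp: Wk_inf_def)
  show d: "has_weak_deriv \<Omega> i j v (weak_deriv \<Omega> i j v)" using w(2) by (rule has_weak_deriv_weak_deriv)
  show "weak_deriv \<Omega> i j v \<in> Linf \<Omega>"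
    by (rule Linf_AE_cong[OF w(1) has_weak_deriv_unique[OF \<Omega> w(2) d]])
  show "Linf_norm \<Omega> (weak_deriv \<Omega> i j v) \<le> Wk_inf_norm \<Omega> k v"
    unfolding Wk_inf_norm_def using ij finite_index[of k] by (intro Max_ge) (auto simp: image_iff)
qed

lemma Wk_inf_norm_triangle:
  assumes "v \<in> Wk_inf \<Omega> k" "w \<in> Wk_inf \<Omega> k"
  shows "Wk_inf_norm \<Omega> k v \<le> Wk_inf_norm \<Omega> k w + Wk_inf_norm \<Omega> k (\<lambda>z. v z - w z)"
proof -
  have *: "Linf_norm \<Omega> (weak_deriv \<Omega> i j v) \<le> Wk_inf_norm \<Omega> k w + Wk_inf_norm \<Omega> k (\<lambda>z. v z - w z)"
    if ij: "i + j \<le> k" for i j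
  proof -
    note V = Wk_inf_weak_deriv[OF assms(1) ij] and W = Wk_inf_weak_deriv[OF assms(2) ij]
    have ae: "AE z in lebesgue_on \<Omega>. weak_deriv \<Omega> i j (\<lambda>z. v z - w z) z = weak_deriv \<Omega> i j v z - weak_deriv \<Omega> i j w z"
      by (rule weak_deriv_diff_AE[OF \<Omega> V(1) W(1)])
    have x: "weak_deriv \<Omega> i j (\<lambda>z. v z - w z) \<in> Linf \<Omega>"
      by (rule Linf_AE_cong[OF Linf_diff[OF V(2) W(2)]]) (use ae in eventually_elim, simp)
    have "Linf_norm \<Omega> (weak_deriv \<Omega> i j (\<lambda>z. v z - w z)) \<le> Wk_inf_norm \<Omega> k (\<lambda>z. v z - w z)"
      unfolding Wk_inf_norm_def using ij finite_index[of k] by (intro Max_ge) (auto simp: image_iff)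
    then show ?thesis using Linf_norm_le_AE[OF Linf_measurable[OF V(2)] W(2) x ae] W(3) by linarith
  qed
  show ?thesis unfolding Wk_inf_norm_def[of _ _ v]
    using * finite_index[of k] by (subst Max_le_iff) (auto intro!: exI[of _ 0])
qed

lemma Wk_inf_norm_nonneg: "0 \<le> Wk_inf_norm \<Omega> k v"
proof -
  have "Linf_norm \<Omega> (weak_deriv \<Omega> 0 0 v) \<le> Wk_inf_norm \<Omega> k v"
    unfolding Wk_inf_norm_def using finite_index[of k]
    by (intro Max_ge) (auto simp: image_iff intro!: exI[of _ 0])
  then show ?thesis using Linf_norm_nonneg[of "weak_deriv \<Omega> 0 0 v"] by linarith
qed

lemma L2_AE_cong:
  assumes "v \<in> L2 \<Omega>" "AE z in lebesgue_on \<Omega>. v z = w z"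
  shows "w \<in> L2 \<Omega>"
proof -
  have v: "v \<in> borel_measurable (lebesgue_on \<Omega>)" "integrable (lebesgue_on \<Omega>) (\<lambda>z. (cmod (v z))\<^sup>2)"
    using assms by (auto simp: L2_def)
  have w: "w \<in> borel_measurable (lebesgue_on \<Omega>)"
    by (rule measurable_lebesgue_on_AE[OF meas v(1) assms(2)])
  have "integrable (lebesgue_on \<Omega>) (\<lambda>z. (cmod (w z))\<^sup>2)"
    by (rule integrable_cong_AE_imp[OF v(2)]) (use w assms(2) in \<open>auto elim: eventually_mono\<close>)
  then show ?thesis using w by (simp add: L2_def)
qed

lemma norm_diff_square_le: "(cmod (x - y))\<^sup>2 \<le> 2 * (cmod x)\<^sup>2 + 2 * (cmod y)\<^sup>2"
proof -
  have "(cmod (x - y))\<^sup>2 \<le> (cmod x + cmod y)\<^sup>2" by (intro power_mono norm_triangle_ineq4) auto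
  also have "\<dots> \<le> 2 * (cmod x)\<^sup>2 + 2 * (cmod y)\<^sup>2"
    using sum_squares_bound[of "cmod x" "cmod y"] by (simp add: power2_sum)
  finally show ?thesis .
qed

lemma L2_diff:
  assumes "v \<in> L2 \<Omega>" "w \<in> L2 \<Omega>"
  shows "(\<lambda>z. v z - w z) \<in> L2 \<Omega>"
proof -
  have v: "v \<in> borel_measurable (lebesgue_on \<Omega>)" "integrable (lebesgue_on \<Omega>) (\<lambda>z. (cmod (v z))\<^sup>2)"
    and w: "w \<in> borel_measurable (lebesgue_on \<Omega>)" "integrable (lebesgue_on \<Omega>) (\<lambda>z. (cmod (w z))\<^sup>2)"
    using assms by (auto simp: L2_def)
  have "integrable (lebesgue_on \<Omega>) (\<lambda>z. (cmod (v z - w z))\<^sup>2)"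
  proof (rule Bochner_Integration.integrable_bound)
    show "integrable (lebesgue_on \<Omega>) (\<lambda>z. 2 * (cmod (v z))\<^sup>2 + 2 * (cmod (w z))\<^sup>2)" using v w by auto
    show "AE z in lebesgue_on \<Omega>. norm ((cmod (v z - w z))\<^sup>2) \<le> norm (2 * (cmod (v z))\<^sup>2 + 2 * (cmod (w z))\<^sup>2)"
      using norm_diff_square_le by (intro AE_I2) auto
  qed (use v w in measurable)
  then show ?thesis using v w by (auto simp: L2_def)
qed

lemma L2_norm_power2: "(L2_norm \<Omega> v)\<^sup>2 = (LINT z|lebesgue_on \<Omega>. (cmod (v z))\<^sup>2)"
  unfolding L2_norm_def by (intro real_sqrt_pow2 integral_nonneg_AE) auto

text \<open>The factor \<open>2\<close> comes from estimating squares crudely instead of proving Minkowski's inequality.\<close>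

lemma Hk_norm_quasi_triangle:
  assumes "v \<in> Hk \<Omega> k" "w \<in> Hk \<Omega> k"
  shows "Hk_norm \<Omega> k v \<le> 2 * (Hk_norm \<Omega> k w + Hk_norm \<Omega> k (\<lambda>z. v z - w z))"
proof -
  define S where "S v = (\<Sum>(i, j)\<in>{(i, j). i + j \<le> k}. (L2_norm \<Omega> (weak_deriv \<Omega> i j v))\<^sup>2)" for v
  have S: "0 \<le> S v" for v unfolding S_def by (intro sum_nonneg) auto
  have *: "(L2_norm \<Omega> (weak_deriv \<Omega> i j v))\<^sup>2
      \<le> 2 * (L2_norm \<Omega> (weak_deriv \<Omega> i j w))\<^sup>2 + 2 * (L2_norm \<Omega> (weak_deriv \<Omega> i j (\<lambda>z. v z - w z)))\<^sup>2"
    if ij: "i + j \<le> k" for i j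
  proof -
    have ex: "has_weak_deriv \<Omega> i j f (weak_deriv \<Omega> i j f) \<and> weak_deriv \<Omega> i j f \<in> L2 \<Omega>" if f: "f \<in> Hk \<Omega> k" for f
    proof -
      obtain g where g: "g \<in> L2 \<Omega>" "has_weak_deriv \<Omega> i j f g" using f ij by (auto simp: Hk_def)
      have d: "has_weak_deriv \<Omega> i j f (weak_deriv \<Omega> i j f)" using g(2) by (rule has_weak_deriv_weak_deriv)
      show ?thesis using d L2_AE_cong[OF g(1) has_weak_deriv_unique[OF \<Omega> g(2) d]] by simp
    qed
    note V = ex[OF assms(1)] and W = ex[OF assms(2)]
    have ae: "AE z in lebesgue_on \<Omega>. weak_deriv \<Omega> i j (\<lambda>z. v z - w z) z = weak_deriv \<Omega> i j v z - weak_deriv \<Omega> i j w z"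
      using V W by (intro weak_deriv_diff_AE[OF \<Omega>]) auto
    have ae': "AE z in lebesgue_on \<Omega>. weak_deriv \<Omega> i j v z - weak_deriv \<Omega> i j w z = weak_deriv \<Omega> i j (\<lambda>z. v z - w z) z"
      using ae by eventually_elim simp
    have x: "weak_deriv \<Omega> i j (\<lambda>z. v z - w z) \<in> L2 \<Omega>"
      using V W by (intro L2_AE_cong[OF L2_diff ae']) auto
    have "(LINT z|lebesgue_on \<Omega>. (cmod (weak_deriv \<Omega> i j v z))\<^sup>2)
       \<le> (LINT z|lebesgue_on \<Omega>. 2 * (cmod (weak_deriv \<Omega> i j w z))\<^sup>2 + 2 * (cmod (weak_deriv \<Omega> i j (\<lambda>z. v z - w z) z))\<^sup>2)"
    proof (rule integral_mono_AE)
      show "AE z in lebesgue_on \<Omega>. (cmod (weak_deriv \<Omega> i j v z))\<^sup>2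
         \<le> 2 * (cmod (weak_deriv \<Omega> i j w z))\<^sup>2 + 2 * (cmod (weak_deriv \<Omega> i j (\<lambda>z. v z - w z) z))\<^sup>2"
        using ae
      proof eventually_elim
        case (elim z)
        then show ?case
          using norm_diff_square_le[of "weak_deriv \<Omega> i j w z" "weak_deriv \<Omega> i j w z - weak_deriv \<Omega> i j v z"]
          by (simp add: norm_minus_commute)
      qed
    qed (use V W x in \<open>auto simp: L2_def\<close>)
    also have "\<dots> = 2 * (LINT z|lebesgue_on \<Omega>. (cmod (weak_deriv \<Omega> i j w z))\<^sup>2)
        + 2 * (LINT z|lebesgue_on \<Omega>. (cmod (weak_deriv \<Omega> i j (\<lambda>z. v z - w z) z))\<^sup>2)"
      using W x by (subst Bochner_Integration.integral_add) (auto simp: L2_def)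
    finally show ?thesis by (simp add: L2_norm_power2)
  qed
  have "S v \<le> (\<Sum>(i, j)\<in>{(i, j). i + j \<le> k}. 2 * (L2_norm \<Omega> (weak_deriv \<Omega> i j w))\<^sup>2
     + 2 * (L2_norm \<Omega> (weak_deriv \<Omega> i j (\<lambda>z. v z - w z)))\<^sup>2)"
    unfolding S_def using * by (intro sum_mono) auto
  also have "\<dots> = 2 * S w + 2 * S (\<lambda>z. v z - w z)"
    by (simp add: S_def case_prod_unfold sum.distrib sum_distrib_left)
  finally have "S v \<le> 2 * S w + 2 * S (\<lambda>z. v z - w z)" .
  also have "\<dots> \<le> (2 * (sqrt (S w) + sqrt (S (\<lambda>z. v z - w z))))\<^sup>2"
    using S[of w] S[of "\<lambda>z. v z - w z"] by (simp add: power_mult_distrib power2_sum)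
  finally have "sqrt (S v) \<le> 2 * (sqrt (S w) + sqrt (S (\<lambda>z. v z - w z)))"
    using S by (intro real_le_lsqrt) auto
  then show ?thesis by (simp add: Hk_norm_def S_def)
qed

lemma Hk_norm_nonneg: "0 \<le> Hk_norm \<Omega> k v"
  unfolding Hk_norm_def by (intro real_sqrt_ge_zero sum_nonneg) auto

lemma W4_H10_norm_quasi_triangle:
  assumes "v \<in> W4_H10 \<Omega>" "w \<in> W4_H10 \<Omega>"
  shows "W4_H10_norm \<Omega> v \<le> 2 * (W4_H10_norm \<Omega> w + W4_H10_norm \<Omega> (\<lambda>z. v z - w z))"
  using Wk_inf_norm_triangle[of v 4 w] Hk_norm_quasi_triangle[of v 1 w] assms
    Wk_inf_norm_nonneg[of 4 w] Wk_inf_norm_nonneg[of 4 "\<lambda>z. v z - w z"]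
  by (auto simp: W4_H10_def H1_0_def W4_H10_norm_def)

end

text \<open>Near each time the norm is bounded by continuity, and \<open>[0,T]\<close> is compact.\<close>

lemma Cm_time_bdd_above:
  assumes u: "u \<in> Cm_time m T V N" and l: "l \<le> m"
    and tri: "\<And>v w. v \<in> V \<Longrightarrow> w \<in> V \<Longrightarrow> N v \<le> 2 * (N w + N (\<lambda>z. v z - w z))"
  shows "bdd_above ((\<lambda>t. N ((time_deriv T V N ^^ l) u t)) ` {0..T})"
proof -
  define v where "v = (time_deriv T V N ^^ l) u"
  have V: "v t \<in> V" and lim: "((\<lambda>s. N (\<lambda>z. v s z - v t z)) \<longlongrightarrow> 0) (at t within {0..T})" if "t \<in> {0..T}" for t
    using u l that by (auto simp: Cm_time_def v_def)
  define B where "B t = max (2 * (N (v t) + 1)) (N (v t))" for t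
  have "\<exists>S. open S \<and> t \<in> S \<and> (\<forall>s\<in>S \<inter> {0..T}. N (v s) \<le> B t)" if t: "t \<in> {0..T}" for t
  proof -
    have "\<forall>\<^sub>F s in at t within {0..T}. N (\<lambda>z. v s z - v t z) < 1"
      using order_tendstoD(2)[OF lim[OF t], of 1] by simp
    then obtain S where S: "open S" "t \<in> S" "\<And>s. s \<in> S \<Longrightarrow> s \<noteq> t \<Longrightarrow> s \<in> {0..T} \<Longrightarrow> N (\<lambda>z. v s z - v t z) < 1"
      unfolding eventually_at_topological by blast
    have "N (v s) \<le> B t" if s: "s \<in> S \<inter> {0..T}" for s
    proof (cases "s = t")
      case False
      then have "N (\<lambda>z. v s z - v t z) < 1" using S(3) s by auto
      moreover have "N (v s) \<le> 2 * (N (v t) + N (\<lambda>z. v s z - v t z))"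
        using s t by (intro tri V) auto
      ultimately show ?thesis by (simp add: B_def)
    qed (simp add: B_def)
    then show ?thesis using S by blast
  qed
  then obtain S where S: "\<And>t. t \<in> {0..T} \<Longrightarrow> open (S t) \<and> t \<in> S t \<and> (\<forall>s\<in>S t \<inter> {0..T}. N (v s) \<le> B t)"
    by metis
  obtain C where C: "C \<subseteq> {0..T}" "finite C" "{0..T} \<subseteq> (\<Union>t\<in>C. S t)"
    using compactE_image[of "{0..T}" "{0..T}" S] S by (metis UN_I compact_Icc subsetI)
  show ?thesis
    unfolding v_def[symmetric]
  proof (rule bdd_aboveI2)
    fix s assume s: "s \<in> {0..T}"
    then obtain t where t: "t \<in> C" "s \<in> S t" using C by auto
    then have "N (v s) \<le> B t" using S[of t] C s by auto
    also have "\<dots> \<le> Max (B ` C)" using t C by (intro Max_ge) auto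
    finally show "N (v s) \<le> Max (B ` C)" .
  qed
qed

section \<open>Mollifiers\<close>

lemma eventually_inverse_Suc_less: "0 < (e::real) \<Longrightarrow> \<forall>\<^sub>F m in sequentially. 1 / real (Suc m) < e"
  using order_tendstoD(2)[OF LIMSEQ_inverse_real_of_nat, of e] unfolding inverse_eq_divide .

definition bump_mass :: "real \<Rightarrow> real" where
  "bump_mass r = integral (cbox (- r, - r) (r, r)) (\<lambda>z. bump (- r) r 0 (fst z) * bump (- r) r 0 (snd z))"

text \<open>The normalised kernel centred at \<open>z0\<close>, with both variables supported in an interval of half length \<open>r\<close>.\<close>

definition mollifier :: "real \<Rightarrow> real \<times> real \<Rightarrow> field2" where
  "mollifier r z0 = tensor (\<lambda>x. bump (- r) r 0 (x - fst z0) / bump_mass r) (\<lambda>y. bump (- r) r 0 (y - snd z0))"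

lemma smooth_translate: "smooth f \<Longrightarrow> smooth (\<lambda>x. f (x - s))"
  using smooth_affine[of f 1 "- s"] by simp

lemma smooth_divide: "smooth f \<Longrightarrow> smooth (\<lambda>x. f x / k)"
  using smooth_mult[OF _ smooth_const[of "1 / k"]] by simp

lemma bump_mass_pos:
  assumes r: "0 < r"
  shows "0 < bump_mass r"
proof -
  let ?f = "\<lambda>z::real \<times> real. bump (- r) r 0 (fst z) * bump (- r) r 0 (snd z)"
  have cont: "continuous_on S ?f" for S
    by (intro continuous_intros continuous_on_compose2[OF smooth_continuous[OF smooth_bump, of UNIV]]) auto
  have int: "?f integrable_on cbox (- r, - r) (r, r)" by (rule integrable_continuous[OF cont])
  have nn: "0 \<le> bump_mass r" unfolding bump_mass_def
    by (rule integral_nonneg[OF int]) (auto intro: mult_nonneg_nonneg bump_bounds)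
  moreover have "bump_mass r \<noteq> 0"
  proof
    assume "bump_mass r = 0"
    then have "(?f has_integral 0) (cbox (- r, - r) (r, r))"
      using int unfolding bump_mass_def by (metis integrable_integral)
    then have "?f (0, 0) = 0"
    proof (rule has_integral_0_cbox_imp_0[OF cont, rotated 1])
      show "0 \<le> ?f z" for z by (intro mult_nonneg_nonneg bump_bounds)
      show "box (- r, - r) (r, r) \<noteq> {}" using r by (auto simp: box_ne_empty Basis_prod_def)
      show "(0, 0) \<in> cbox (- r, - r) (r, r)" using r by (auto simp: cbox_Pair_eq)
    qed
    then show False using bump_pos_iff[of "- r" r 0 0] r by auto
  qed
  ultimately show ?thesis by simp
qed

lemma smooth_mollifier_factors:
  "smooth (\<lambda>x. bump (- r) r 0 (x - s) / k)" "smooth (\<lambda>x. bump (- r) r 0 (x - s))"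
  by (rule smooth_divide[OF smooth_translate[OF smooth_bump]], rule smooth_translate[OF smooth_bump])

lemma mollifier_continuous: "continuous_on S (mollifier r z0)"
  unfolding mollifier_def by (intro tensor_continuous smooth_mollifier_factors)

lemma mollifier_support:
  "mollifier r z0 z \<noteq> 0 \<Longrightarrow> \<bar>fst z - fst z0\<bar> < r \<and> \<bar>snd z - snd z0\<bar> < r"
  by (auto simp: mollifier_def tensor_def bump_pos_iff)

lemma mollifier_real_nonneg:
  assumes "0 < r"
  shows "mollifier r z0 z = complex_of_real (cmod (mollifier r z0 z))"
proof -
  have "0 \<le> bump (- r) r 0 (fst z - fst z0) / bump_mass r * bump (- r) r 0 (snd z - snd z0)"
    using bump_mass_pos[OF assms] by (intro mult_nonneg_nonneg divide_nonneg_pos bump_bounds)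
  then show ?thesis unfolding mollifier_def tensor_def norm_of_real by (simp only: abs_of_nonneg)
qed

context plane_rectangle
begin

lemma closure_\<Omega>: "closure \<Omega> = cbox (a, c) (b, d)"
proof -
  have "box (a, c) (b, d) \<noteq> {}" using ab cd by (auto simp: box_ne_empty Basis_prod_def)
  then show ?thesis by (simp add: \<Omega> rectangle_eq_box closure_box)
qed

lemma mem_\<Omega>: "z \<in> \<Omega> \<longleftrightarrow> a < fst z \<and> fst z < b \<and> c < snd z \<and> snd z < d"
  by (auto simp: \<Omega> rectangle_def mem_Times_iff)

lemma mem_closure_\<Omega>: "z \<in> closure \<Omega> \<longleftrightarrow> a \<le> fst z \<and> fst z \<le> b \<and> c \<le> snd z \<and> snd z \<le> d"
  by (cases z) (auto simp: closure_\<Omega> cbox_Pair_eq)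

lemma continuous_integrable:
  fixes F :: "real \<times> real \<Rightarrow> 'a::euclidean_space"
  assumes F: "continuous_on (closure \<Omega>) F"
  shows "integrable (lebesgue_on \<Omega>) F" "(LINT z|lebesgue_on \<Omega>. F z) = integral (cbox (a, c) (b, d)) F"
proof -
  have "F absolutely_integrable_on cbox (a, c) (b, d)"
    using F unfolding closure_\<Omega> by (rule absolutely_integrable_continuous)
  then have "F absolutely_integrable_on \<Omega>"
    by (rule set_integrable_subset) (use meas box_subset_cbox in \<open>auto simp: \<Omega> rectangle_eq_box\<close>)
  then show i: "integrable (lebesgue_on \<Omega>) F"
    using meas by (simp add: set_integrable_def integrable_restrict_space)
  have "(LINT z|lebesgue_on \<Omega>. F z) = integral \<Omega> F" by (rule lebesgue_integral_eq_integral[OF i meas])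
  also have "\<dots> = integral (cbox (a, c) (b, d)) F"
    by (simp add: \<Omega> rectangle_eq_box integral_open_interval)
  finally show "(LINT z|lebesgue_on \<Omega>. F z) = integral (cbox (a, c) (b, d)) F" .
qed

text \<open>The radii for which the mollifier centred at \<open>z\<close> is a test function.\<close>

definition fits :: "real \<Rightarrow> real \<times> real \<Rightarrow> bool" where
  "fits r z \<longleftrightarrow> 0 < r \<and> a < fst z - r \<and> fst z + r < b \<and> c < snd z - r \<and> snd z + r < d"

lemma fits_eventually:
  assumes "z \<in> \<Omega>"
  shows "\<forall>\<^sub>F m in sequentially. fits (1 / real (Suc m)) z"
proof -
  have "0 < Min {fst z - a, b - fst z, snd z - c, d - snd z}"
    using assms by (auto simp: mem_\<Omega>)
  then have "\<forall>\<^sub>F m in sequentially. 1 / real (Suc m) < Min {fst z - a, b - fst z, snd z - c, d - snd z}"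
    by (rule eventually_inverse_Suc_less)
  then show ?thesis by eventually_elim (auto simp: fits_def)
qed

lemma mollifier_test_function: "fits r z \<Longrightarrow> mollifier r z \<in> test_functions \<Omega>"
  unfolding mollifier_def
  by (rule tensor_test_function[where p = "fst z - r" and q = "fst z + r" and r = "snd z - r" and s = "snd z + r"])
     (auto simp: smooth_mollifier_factors bump_pos_iff fits_def mem_\<Omega>)

lemma mollifier_integral:
  assumes z: "fits r z"
  shows "integrable (lebesgue_on \<Omega>) (mollifier r z)" "(LINT x|lebesgue_on \<Omega>. cmod (mollifier r z x)) = 1"
    "(LINT x|lebesgue_on \<Omega>. mollifier r z x) = 1"
proof -
  have r: "0 < r" using z by (simp add: fits_def)
  define \<kappa> where "\<kappa> x = bump (- r) r 0 (fst x) * bump (- r) r 0 (snd x) / bump_mass r" for x :: "real \<times> real"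
  have norm: "cmod (mollifier r z x) = \<kappa> (x - z)" for x
  proof -
    have "mollifier r z x = complex_of_real (\<kappa> (x - z))" by (simp add: mollifier_def tensor_def \<kappa>_def)
    moreover have "0 \<le> \<kappa> (x - z)"
      unfolding \<kappa>_def using bump_mass_pos[OF r] by (intro divide_nonneg_pos mult_nonneg_nonneg bump_bounds)
    ultimately show ?thesis by simp
  qed
  show "integrable (lebesgue_on \<Omega>) (mollifier r z)"
    by (rule continuous_integrable(1)[OF mollifier_continuous])
  have cont: "continuous_on S \<kappa>" for S
    unfolding \<kappa>_def using bump_mass_pos[OF r]
    by (intro continuous_intros continuous_on_compose2[OF smooth_continuous[OF smooth_bump, of UNIV]]) auto
  have "integral (cbox (- r, - r) (r, r)) \<kappa> = 1"
    using bump_mass_pos[OF r] by (simp add: \<kappa>_def[abs_def] bump_mass_def)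
  then have "(\<kappa> has_integral 1) (cbox (- r, - r) (r, r))"
    using integrable_integral[OF integrable_continuous[OF cont]] by metis
  then have "((\<lambda>x. \<kappa> (x - z)) has_integral 1) (cbox ((- r, - r) + z) ((r, r) + z))"
    using has_integral_shift_cbox[of \<kappa> 1 "(- r, - r)" "(r, r)" "- z"] by simp
  then have "((\<lambda>x. \<kappa> (x - z)) has_integral 1) (cbox (a, c) (b, d))"
  proof (rule has_integral_on_superset)
    obtain x0 y0 where z0: "z = (x0, y0)" by (cases z)
    show "\<kappa> (x - z) = 0" if "x \<notin> cbox ((- r, - r) + z) ((r, r) + z)" for x
    proof (rule ccontr)
      assume "\<kappa> (x - z) \<noteq> 0"
      then have "bump (- r) r 0 (fst (x - z)) \<noteq> 0" "bump (- r) r 0 (snd (x - z)) \<noteq> 0"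
        by (auto simp: \<kappa>_def)
      then show False using that unfolding bump_pos_iff by (cases x) (auto simp: z0 cbox_Pair_eq)
    qed
    show "cbox ((- r, - r) + z) ((r, r) + z) \<subseteq> cbox (a, c) (b, d)"
      using z by (auto simp: z0 cbox_Pair_eq fits_def)
  qed
  then have "integral (cbox (a, c) (b, d)) (\<lambda>x. cmod (mollifier r z x)) = 1"
    unfolding norm by (rule integral_unique)
  then show n: "(LINT x|lebesgue_on \<Omega>. cmod (mollifier r z x)) = 1"
    by (subst continuous_integrable(2)) (auto intro: continuous_on_norm mollifier_continuous)
  have "(LINT x|lebesgue_on \<Omega>. mollifier r z x) = (LINT x|lebesgue_on \<Omega>. complex_of_real (cmod (mollifier r z x)))"
    using mollifier_real_nonneg[OF r] by (intro Bochner_Integration.integral_cong) auto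
  also have "\<dots> = complex_of_real (LINT x|lebesgue_on \<Omega>. cmod (mollifier r z x))"
    by (rule integral_complex_of_real)
  finally show "(LINT x|lebesgue_on \<Omega>. mollifier r z x) = 1" using n by simp
qed

text \<open>The equation holds, and the derivatives of \<open>u\<close> are known, only almost everywhere; averages are numbers to
  which pointwise calculus applies.\<close>

definition avg :: "real \<Rightarrow> real \<times> real \<Rightarrow> field2 \<Rightarrow> complex" where
  "avg r z v = (LINT x|lebesgue_on \<Omega>. v x * mollifier r z x)"

lemma mollifier_bounded: "\<exists>B. \<forall>x. cmod (mollifier r z x) \<le> B"
proof (intro exI allI)
  fix x
  have "cmod (mollifier r z x) = \<bar>bump (- r) r 0 (fst x - fst z)\<bar> * \<bar>bump (- r) r 0 (snd x - snd z)\<bar> / \<bar>bump_mass r\<bar>"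
    by (simp add: mollifier_def tensor_def norm_mult norm_divide)
  also have "\<dots> \<le> 1 / \<bar>bump_mass r\<bar>"
    using bump_bounds by (intro divide_right_mono mult_le_one) auto
  finally show "cmod (mollifier r z x) \<le> 1 / \<bar>bump_mass r\<bar>" .
qed

lemma integrable_times_mollifier:
  assumes "integrable (lebesgue_on \<Omega>) v"
  shows "integrable (lebesgue_on \<Omega>) (\<lambda>x. v x * mollifier r z x)"
proof -
  obtain B where B: "\<And>x. cmod (mollifier r z x) \<le> B" using mollifier_bounded by blast
  show ?thesis
  proof (rule Bochner_Integration.integrable_bound[where f = "\<lambda>x. B * norm (v x)"])
    show "integrable (lebesgue_on \<Omega>) (\<lambda>x. B * norm (v x))" using assms by auto
    have "mollifier r z \<in> borel_measurable (lebesgue_on \<Omega>)"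
      using continuous_integrable(1)[OF mollifier_continuous[of "closure \<Omega>" r z]] by auto
    then show "(\<lambda>x. v x * mollifier r z x) \<in> borel_measurable (lebesgue_on \<Omega>)"
      using assms by (intro borel_measurable_times) auto
    show "AE x in lebesgue_on \<Omega>. norm (v x * mollifier r z x) \<le> norm (B * norm (v x))"
    proof (rule AE_I2)
      fix x
      have "cmod (v x) * cmod (mollifier r z x) \<le> cmod (v x) * B" by (intro mult_left_mono B) auto
      moreover have "cmod (v x) * B \<le> \<bar>B * cmod (v x)\<bar>" by (simp add: mult.commute)
      ultimately show "norm (v x * mollifier r z x) \<le> norm (B * norm (v x))" by (simp add: norm_mult)
    qed
  qed
qed

lemma avg_diff:
  assumes "integrable (lebesgue_on \<Omega>) v" "integrable (lebesgue_on \<Omega>) w"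
  shows "avg r z (\<lambda>x. v x - w x) = avg r z v - avg r z w"
  unfolding avg_def using assms by (simp add: left_diff_distrib integrable_times_mollifier)

lemma avg_cmult: "avg r z (\<lambda>x. k * v x) = k * avg r z v"
  unfolding avg_def by (simp add: mult.assoc)

lemma avg_le:
  assumes v: "integrable (lebesgue_on \<Omega>) v" and z: "fits r z"
    and le: "AE x in lebesgue_on \<Omega>. mollifier r z x \<noteq> 0 \<longrightarrow> cmod (v x) \<le> B"
  shows "cmod (avg r z v) \<le> B"
proof -
  have "cmod (avg r z v) \<le> (LINT x|lebesgue_on \<Omega>. cmod (v x * mollifier r z x))"
    unfolding avg_def by (rule integral_norm_bound)
  also have "\<dots> \<le> (LINT x|lebesgue_on \<Omega>. B * cmod (mollifier r z x))"
  proof (rule integral_mono_AE)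
    show "integrable (lebesgue_on \<Omega>) (\<lambda>x. cmod (v x * mollifier r z x))"
      using integrable_times_mollifier[OF v] by (rule integrable_norm)
    show "integrable (lebesgue_on \<Omega>) (\<lambda>x. B * cmod (mollifier r z x))"
      using mollifier_integral(1)[OF z] by auto
    show "AE x in lebesgue_on \<Omega>. cmod (v x * mollifier r z x) \<le> B * cmod (mollifier r z x)"
      using le by eventually_elim (auto simp: norm_mult intro: mult_right_mono)
  qed
  also have "\<dots> = B" using mollifier_integral(2)[OF z] by simp
  finally show ?thesis .
qed

lemma finite_measure_\<Omega>: "finite_measure (lebesgue_on \<Omega>)"
  using lmeas by (rule finite_measure_lebesgue_on)

lemma Linf_integrable: "v \<in> Linf \<Omega> \<Longrightarrow> integrable (lebesgue_on \<Omega>) v"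
  using Linf_AE Linf_measurable
  by (intro finite_measure.integrable_const_bound[OF finite_measure_\<Omega>])

lemma avg_Linf_le: "v \<in> Linf \<Omega> \<Longrightarrow> fits r z \<Longrightarrow> cmod (avg r z v) \<le> Linf_norm \<Omega> v"
  using Linf_AE[of v] by (intro avg_le Linf_integrable) (auto elim: eventually_mono)

lemma avg_tendsto:
  assumes v: "continuous_on (closure \<Omega>) v" and z: "z \<in> \<Omega>"
  shows "(\<lambda>m. avg (1 / real (Suc m)) z v) \<longlonglongrightarrow> v z"
proof (rule tendstoI)
  fix \<epsilon> :: real assume \<epsilon>: "0 < \<epsilon>"
  have zc: "z \<in> closure \<Omega>" using z closure_subset by auto
  obtain \<delta> where \<delta>: "0 < \<delta>" "\<And>x. x \<in> closure \<Omega> \<Longrightarrow> dist x z < \<delta> \<Longrightarrow> dist (v x) (v z) < \<epsilon> / 2"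
    using v zc \<epsilon> unfolding continuous_on_iff by (meson half_gt_zero)
  have "\<forall>\<^sub>F m in sequentially. 1 / real (Suc m) < \<delta> / 2"
    using \<delta> by (intro eventually_inverse_Suc_less) auto
  then show "\<forall>\<^sub>F m in sequentially. dist (avg (1 / real (Suc m)) z v) (v z) < \<epsilon>"
    using fits_eventually[OF z]
  proof eventually_elim
    case (elim m)
    define r where "r = 1 / real (Suc m)"
    have f: "fits r z" and rd: "r < \<delta> / 2" using elim by (auto simp: r_def)
    have i: "integrable (lebesgue_on \<Omega>) v" "integrable (lebesgue_on \<Omega>) (\<lambda>_. v z)"
      by (auto intro: continuous_integrable v)
    have "avg r z (\<lambda>x. v x - v z) = avg r z v - v z * (LINT x|lebesgue_on \<Omega>. mollifier r z x)"
      using avg_diff[OF i] by (simp add: avg_def)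
    then have "avg r z v - v z = avg r z (\<lambda>x. v x - v z)" by (simp add: mollifier_integral(3)[OF f])
    moreover have "cmod (avg r z (\<lambda>x. v x - v z)) \<le> \<epsilon> / 2"
    proof (rule avg_le[OF _ f])
      show "integrable (lebesgue_on \<Omega>) (\<lambda>x. v x - v z)" using i by auto
      show "AE x in lebesgue_on \<Omega>. mollifier r z x \<noteq> 0 \<longrightarrow> cmod (v x - v z) \<le> \<epsilon> / 2"
      proof (rule AE_I2, rule impI)
        fix x assume x: "x \<in> space (lebesgue_on \<Omega>)" "mollifier r z x \<noteq> 0"
        have "dist x z \<le> dist (fst x) (fst z) + dist (snd x) (snd z)"
          unfolding dist_prod_def using sqrt_sum_squares_le_sum_abs[of "dist (fst x) (fst z)" "dist (snd x) (snd z)"] by simp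
        also have "\<dots> < \<delta>" using mollifier_support[OF x(2)] rd by (simp add: dist_real_def)
        finally have "dist (v x) (v z) < \<epsilon> / 2" using x closure_subset by (intro \<delta>(2)) auto
        then show "cmod (v x - v z) \<le> \<epsilon> / 2" by (simp add: dist_norm)
      qed
    qed
    ultimately show ?case using \<epsilon> by (simp add: dist_norm r_def)
  qed
qed

end

section \<open>Taylor estimates\<close>

lemma divide_diff_eq: "x / k - y = (x - k * y) / k" if "k \<noteq> 0" for x y k :: complex
  using that by (simp add: diff_divide_distrib)

text \<open>A Taylor bound without the optimal constant \<open>1 / n!\<close>. It needs one-sided derivatives at the end
  points only, and follows by repeated use of the mean value inequality.\<close>

lemma taylor_bound:
  fixes F :: "nat \<Rightarrow> real \<Rightarrow> complex"
  assumes S: "convex S"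
    and F: "\<And>i s. i < n \<Longrightarrow> s \<in> S \<Longrightarrow> (F i has_vector_derivative F (Suc i) s) (at s within S)"
    and M: "\<And>s. s \<in> S \<Longrightarrow> cmod (F n s) \<le> M"
    and t: "t \<in> S" "s \<in> S"
  shows "cmod (F 0 s - (\<Sum>i<n. ((s - t) ^ i / fact i) *\<^sub>R F i t)) \<le> M * \<bar>s - t\<bar> ^ n"
  using F M t
proof (induction n arbitrary: F s)
  case 0
  then show ?case by simp
next
  case (Suc n)
  define R where "R x = F 0 x - (\<Sum>i<Suc n. ((x - t) ^ i / fact i) *\<^sub>R F i t)" for x
  define R' where "R' x = F 1 x - (\<Sum>i<n. ((x - t) ^ i / fact i) *\<^sub>R F (Suc i) t)" for x
  have M0: "0 \<le> M" using Suc.prems(2)[OF t(1)] norm_ge_zero order_trans by blast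
  have R': "cmod (R' x) \<le> M * \<bar>x - t\<bar> ^ n" if "x \<in> S" for x
    using Suc.IH[of "\<lambda>i. F (Suc i)" x] Suc.prems that t(1) by (simp add: R'_def)
  have dR: "(R has_vector_derivative R' x) (at x within S)" if x: "x \<in> S" for x
  proof -
    have p: "((\<lambda>x. ((x - t) ^ Suc i / fact (Suc i)) *\<^sub>R F (Suc i) t) has_vector_derivative
        ((x - t) ^ i / fact i) *\<^sub>R F (Suc i) t) (at x within S)" for i
    proof -
      have "((\<lambda>x. (x - t) ^ Suc i / fact (Suc i)) has_real_derivative (x - t) ^ i / fact i) (at x within S)"
        by (auto intro!: derivative_eq_intros simp: field_simps simp del: power_Suc fact_Suc)
           (simp add: field_simps)
      then show ?thesis by (intro has_vector_derivative_scaleR[THEN has_vector_derivative_eq_rhs]) (auto intro!: derivative_eq_intros)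
    qed
    have "((\<lambda>x. F 0 x - (F 0 t + (\<Sum>i<n. ((x - t) ^ Suc i / fact (Suc i)) *\<^sub>R F (Suc i) t))) has_vector_derivative
        F 1 x - (0 + (\<Sum>i<n. ((x - t) ^ i / fact i) *\<^sub>R F (Suc i) t))) (at x within S)"
      using Suc.prems(1)[of 0 x] x p
      by (intro has_vector_derivative_diff has_vector_derivative_add has_vector_derivative_sum has_vector_derivative_const) auto
    moreover have "R = (\<lambda>x. F 0 x - (F 0 t + (\<Sum>i<n. ((x - t) ^ Suc i / fact (Suc i)) *\<^sub>R F (Suc i) t)))"
      unfolding R_def sum.lessThan_Suc_shift by simp
    ultimately show ?thesis by (simp add: R'_def)
  qed
  have R_t: "R t = 0" unfolding R_def sum.lessThan_Suc_shift by simp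
  have seg: "closed_segment t s \<subseteq> S" using Suc.prems S by (intro closed_segment_subset) auto
  have "norm (R s - R t) \<le> (M * \<bar>s - t\<bar> ^ n) * norm (s - t)"
  proof (rule differentiable_bound[OF convex_closed_segment])
    show "(R has_derivative (\<lambda>h. h *\<^sub>R R' x)) (at x within closed_segment t s)" if "x \<in> closed_segment t s" for x
      using has_vector_derivative_within_subset[OF dR seg] that seg by (auto simp: has_vector_derivative_def)
    show "onorm (\<lambda>h. h *\<^sub>R R' x) \<le> M * \<bar>s - t\<bar> ^ n" if x: "x \<in> closed_segment t s" for x
    proof (rule onorm_le)
      fix h :: real
      have "\<bar>x - t\<bar> \<le> \<bar>s - t\<bar>" using x by (auto simp: closed_segment_eq_real_ivl split: if_splits)
      then have "M * \<bar>x - t\<bar> ^ n \<le> M * \<bar>s - t\<bar> ^ n" using M0 by (intro mult_left_mono power_mono) auto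
      then have "cmod (R' x) \<le> M * \<bar>s - t\<bar> ^ n" using R'[of x] x seg by auto
      then have "\<bar>h\<bar> * cmod (R' x) \<le> \<bar>h\<bar> * (M * \<bar>s - t\<bar> ^ n)" by (intro mult_left_mono) auto
      then show "norm (h *\<^sub>R R' x) \<le> M * \<bar>s - t\<bar> ^ n * norm h" by (simp add: mult.commute)
    qed
  qed auto
  then show ?case using R_t by (simp add: R_def mult_ac)
qed

lemma BDF2_quotient_error:
  fixes F :: "nat \<Rightarrow> real \<Rightarrow> complex"
  assumes F: "\<And>i s. i < 3 \<Longrightarrow> s \<in> {0..T} \<Longrightarrow> (F i has_vector_derivative F (Suc i) s) (at s within {0..T})"
    and M: "\<And>s. s \<in> {0..T} \<Longrightarrow> cmod (F 3 s) \<le> M"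
    and t: "0 \<le> t - 2 * \<tau>" "t \<le> T" "0 < \<tau>"
  shows "cmod ((3 * F 0 t - 4 * F 0 (t - \<tau>) + F 0 (t - 2 * \<tau>)) / complex_of_real (2 * \<tau>) - F 1 t) \<le> 6 * M * \<tau>\<^sup>2"
proof -
  define R where "R s = F 0 s - (\<Sum>i<3. ((s - t) ^ i / fact i) *\<^sub>R F i t)" for s
  have R: "cmod (R s) \<le> M * \<bar>s - t\<bar> ^ 3" if "s \<in> {0..T}" for s
    unfolding R_def using t that by (intro taylor_bound[where S = "{0..T}"] F M) auto
  have sum3: "(\<Sum>i<3. f i) = f 0 + f 1 + f 2" for f :: "nat \<Rightarrow> complex"
    by (simp add: numeral_eq_Suc)
  have "(3 * F 0 t - 4 * F 0 (t - \<tau>) + F 0 (t - 2 * \<tau>)) - complex_of_real (2 * \<tau>) * F 1 t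
     = R (t - 2 * \<tau>) - 4 * R (t - \<tau>)"
    unfolding R_def sum3 by (simp add: scaleR_conv_of_real power2_eq_square algebra_simps)
  then have e: "(3 * F 0 t - 4 * F 0 (t - \<tau>) + F 0 (t - 2 * \<tau>)) / complex_of_real (2 * \<tau>) - F 1 t
     = (R (t - 2 * \<tau>) - 4 * R (t - \<tau>)) / complex_of_real (2 * \<tau>)"
    using t by (subst divide_diff_eq) auto
  have "cmod (R (t - 2 * \<tau>) - 4 * R (t - \<tau>)) \<le> cmod (R (t - 2 * \<tau>)) + 4 * cmod (R (t - \<tau>))"
    using norm_triangle_ineq4[of "R (t - 2 * \<tau>)" "4 * R (t - \<tau>)"] by (simp only: norm_mult norm_numeral)
  also have "\<dots> \<le> M * (2 * \<tau>) ^ 3 + 4 * (M * \<tau> ^ 3)"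
    using R[of "t - 2 * \<tau>"] R[of "t - \<tau>"] t by (intro add_mono mult_left_mono) auto
  also have "\<dots> = 6 * M * \<tau>\<^sup>2 * (2 * \<tau>)" by (simp add: power3_eq_cube power2_eq_square algebra_simps)
  finally have "cmod (R (t - 2 * \<tau>) - 4 * R (t - \<tau>)) / (2 * \<tau>) \<le> 6 * M * \<tau>\<^sup>2"
    using t by (simp add: pos_divide_le_eq)
  then show ?thesis unfolding e using t by (simp add: norm_divide)
qed

lemma second_difference_small:
  fixes F :: "nat \<Rightarrow> real \<Rightarrow> complex"
  assumes F: "\<And>i s. i < 2 \<Longrightarrow> s \<in> {0..T} \<Longrightarrow> (F i has_vector_derivative F (Suc i) s) (at s within {0..T})"
    and M: "\<And>s. s \<in> {0..T} \<Longrightarrow> cmod (F 2 s) \<le> M"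
    and t: "0 \<le> t - 2 * \<tau>" "t \<le> T" "0 < \<tau>"
  shows "cmod (F 0 t - (2 * F 0 (t - \<tau>) - F 0 (t - 2 * \<tau>))) \<le> 6 * M * \<tau>\<^sup>2"
proof -
  define R where "R s = F 0 s - (\<Sum>i<2. ((s - t) ^ i / fact i) *\<^sub>R F i t)" for s
  have R: "cmod (R s) \<le> M * \<bar>s - t\<bar> ^ 2" if "s \<in> {0..T}" for s
    unfolding R_def using t that by (intro taylor_bound[where S = "{0..T}"] F M) auto
  have sum2: "(\<Sum>i<2. f i) = f 0 + f 1" for f :: "nat \<Rightarrow> complex"
    by (simp add: numeral_eq_Suc)
  have e: "F 0 t - (2 * F 0 (t - \<tau>) - F 0 (t - 2 * \<tau>)) = R (t - 2 * \<tau>) - 2 * R (t - \<tau>)"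
    unfolding R_def sum2 by (simp add: scaleR_conv_of_real algebra_simps)
  have "cmod (R (t - 2 * \<tau>) - 2 * R (t - \<tau>)) \<le> cmod (R (t - 2 * \<tau>)) + 2 * cmod (R (t - \<tau>))"
    using norm_triangle_ineq4[of "R (t - 2 * \<tau>)" "2 * R (t - \<tau>)"] by (simp only: norm_mult norm_numeral)
  also have "\<dots> \<le> M * (2 * \<tau>) ^ 2 + 2 * (M * \<tau> ^ 2)"
    using R[of "t - 2 * \<tau>"] R[of "t - \<tau>"] t by (intro add_mono mult_left_mono) auto
  also have "\<dots> = 6 * M * \<tau>\<^sup>2" by (simp add: power2_eq_square algebra_simps)
  finally show ?thesis unfolding e .
qed

lemma backward_quotient_error:
  fixes F :: "nat \<Rightarrow> real \<Rightarrow> complex"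
  assumes F: "\<And>i s. i < 2 \<Longrightarrow> s \<in> {0..T} \<Longrightarrow> (F i has_vector_derivative F (Suc i) s) (at s within {0..T})"
    and M: "\<And>s. s \<in> {0..T} \<Longrightarrow> cmod (F 2 s) \<le> M"
    and t: "0 \<le> t - \<tau>" "t \<le> T" "0 < \<tau>"
  shows "cmod ((F 0 t - F 0 (t - \<tau>)) / complex_of_real \<tau> - F 1 t) \<le> M * \<tau>"
proof -
  define R where "R s = F 0 s - (\<Sum>i<2. ((s - t) ^ i / fact i) *\<^sub>R F i t)" for s
  have R: "cmod (R s) \<le> M * \<bar>s - t\<bar> ^ 2" if "s \<in> {0..T}" for s
    unfolding R_def using t that by (intro taylor_bound[where S = "{0..T}"] F M) auto
  have sum2: "(\<Sum>i<2. f i) = f 0 + f 1" for f :: "nat \<Rightarrow> complex"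
    by (simp add: numeral_eq_Suc)
  have "(F 0 t - F 0 (t - \<tau>)) - complex_of_real \<tau> * F 1 t = - R (t - \<tau>)"
    unfolding R_def sum2 by (simp add: scaleR_conv_of_real algebra_simps)
  then have "(F 0 t - F 0 (t - \<tau>)) / complex_of_real \<tau> - F 1 t = - R (t - \<tau>) / complex_of_real \<tau>"
    using t by (subst divide_diff_eq) auto
  moreover have "cmod (R (t - \<tau>)) / \<tau> \<le> M * \<tau>"
    using R[of "t - \<tau>"] t by (simp add: pos_divide_le_eq power2_eq_square mult.assoc)
  ultimately show ?thesis using t by (simp add: norm_divide)
qed

lemma increment_small:
  fixes F :: "nat \<Rightarrow> real \<Rightarrow> complex"
  assumes F: "\<And>i s. i < 1 \<Longrightarrow> s \<in> {0..T} \<Longrightarrow> (F i has_vector_derivative F (Suc i) s) (at s within {0..T})"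
    and M: "\<And>s. s \<in> {0..T} \<Longrightarrow> cmod (F 1 s) \<le> M"
    and t: "0 \<le> t - \<tau>" "t \<le> T" "0 < \<tau>"
  shows "cmod (F 0 t - F 0 (t - \<tau>)) \<le> M * \<tau>"
proof -
  have "cmod (F 0 t - (\<Sum>i<1. ((t - (t - \<tau>)) ^ i / fact i) *\<^sub>R F i (t - \<tau>))) \<le> M * \<bar>t - (t - \<tau>)\<bar> ^ 1"
    using t by (intro taylor_bound[where S = "{0..T}"] F M) auto
  then show ?thesis using t by simp
qed

lemma central_second_difference_error:
  fixes F :: "nat \<Rightarrow> real \<Rightarrow> complex"
  assumes F: "\<And>i s. i < 4 \<Longrightarrow> s \<in> {-h..h} \<Longrightarrow> (F i has_vector_derivative F (Suc i) s) (at s within {-h..h})"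
    and M: "\<And>s. s \<in> {-h..h} \<Longrightarrow> cmod (F 4 s) \<le> M"
    and h: "0 < h"
  shows "cmod ((F 0 h - 2 * F 0 0 + F 0 (- h)) / complex_of_real (h\<^sup>2) - F 2 0) \<le> 2 * M * h\<^sup>2"
proof -
  define R where "R s = F 0 s - (\<Sum>i<4. ((s - 0) ^ i / fact i) *\<^sub>R F i 0)" for s
  have R: "cmod (R s) \<le> M * \<bar>s - 0\<bar> ^ 4" if "s \<in> {-h..h}" for s
    unfolding R_def using h that by (intro taylor_bound[where S = "{-h..h}"] F M) auto
  have sum4: "(\<Sum>i<4. f i) = f 0 + f 1 + f 2 + f 3" for f :: "nat \<Rightarrow> complex"
    by (simp add: numeral_eq_Suc)
  have "(F 0 h - 2 * F 0 0 + F 0 (- h)) - complex_of_real (h\<^sup>2) * F 2 0 = R h + R (- h)"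
    unfolding R_def sum4 by (simp add: scaleR_conv_of_real power2_eq_square power3_eq_cube fact_numeral algebra_simps)
  then have e: "(F 0 h - 2 * F 0 0 + F 0 (- h)) / complex_of_real (h\<^sup>2) - F 2 0 = (R h + R (- h)) / complex_of_real (h\<^sup>2)"
    using h by (subst divide_diff_eq) auto
  have "cmod (R h + R (- h)) \<le> M * h ^ 4 + M * h ^ 4"
    using norm_triangle_ineq[of "R h" "R (- h)"] R[of h] R[of "- h"] h by simp
  also have "\<dots> = 2 * M * h\<^sup>2 * h\<^sup>2" by (simp add: power2_eq_square power4_eq_xxxx algebra_simps)
  finally have "cmod (R h + R (- h)) / h\<^sup>2 \<le> 2 * M * h\<^sup>2" using h by (simp add: pos_divide_le_eq)
  then show ?thesis unfolding e by (simp add: norm_divide norm_power)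
qed

text \<open>A bounded linear functional turns a time derivative in the norm \<open>N\<close> into an ordinary
  derivative. This is how Taylor expansions in function spaces are reduced to scalar ones.\<close>

lemma functional_time_deriv:
  fixes L :: "field2 \<Rightarrow> complex"
  assumes w: "has_time_deriv T V N u t w" and u: "\<And>s. s \<in> {0..T} \<Longrightarrow> u s \<in> V" and t: "t \<in> {0..T}"
    and V: "\<And>v w. v \<in> V \<Longrightarrow> w \<in> V \<Longrightarrow> (\<lambda>z. v z - w z) \<in> V" "\<And>v k. v \<in> V \<Longrightarrow> (\<lambda>z. k * v z) \<in> V"
    and L: "\<And>v w. v \<in> V \<Longrightarrow> w \<in> V \<Longrightarrow> L (\<lambda>z. v z - w z) = L v - L w" "\<And>v k. v \<in> V \<Longrightarrow> L (\<lambda>z. k * v z) = k * L v"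
    and bd: "\<And>v. v \<in> V \<Longrightarrow> cmod (L v) \<le> B * N v"
  shows "((\<lambda>s. L (u s)) has_vector_derivative L w) (at t within {0..T})"
proof -
  have wV: "w \<in> V" and lim: "((\<lambda>s. N (\<lambda>z. (u s z - u t z) / complex_of_real (s - t) - w z)) \<longlongrightarrow> 0) (at t within {0..T})"
    using w by (auto simp: has_time_deriv_def)
  have q: "(\<lambda>z. (u s z - u t z) / complex_of_real (s - t) - w z) \<in> V"
    "L (\<lambda>z. (u s z - u t z) / complex_of_real (s - t) - w z) = (L (u s) - L (u t)) / complex_of_real (s - t) - L w"
    if s: "s \<in> {0..T}" for s
  proof -
    define k where "k = 1 / complex_of_real (s - t)"
    have e: "(\<lambda>z. (u s z - u t z) / complex_of_real (s - t) - w z) = (\<lambda>z. (k * (u s z - u t z)) - w z)"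
      by (simp add: k_def)
    have 1: "(\<lambda>z. u s z - u t z) \<in> V" by (intro V u s t)
    have 2: "(\<lambda>z. k * (u s z - u t z)) \<in> V" by (rule V(2)[OF 1])
    show "(\<lambda>z. (u s z - u t z) / complex_of_real (s - t) - w z) \<in> V" unfolding e by (rule V(1)[OF 2 wV])
    show "L (\<lambda>z. (u s z - u t z) / complex_of_real (s - t) - w z) = (L (u s) - L (u t)) / complex_of_real (s - t) - L w"
      unfolding e L(1)[OF 2 wV] L(2)[OF 1] L(1)[OF u[OF s] u[OF t]] by (simp add: k_def)
  qed
  have "((\<lambda>s. (1 / norm (s - t)) *\<^sub>R (L (u s) - (L (u t) + (s - t) *\<^sub>R L w))) \<longlongrightarrow> 0) (at t within {0..T})"
  proof (rule Lim_null_comparison)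
    show "((\<lambda>s. B * N (\<lambda>z. (u s z - u t z) / complex_of_real (s - t) - w z)) \<longlongrightarrow> 0) (at t within {0..T})"
      using tendsto_mult[OF tendsto_const lim, of B] by simp
    have "norm ((1 / norm (s - t)) *\<^sub>R (L (u s) - (L (u t) + (s - t) *\<^sub>R L w)))
        \<le> B * N (\<lambda>z. (u s z - u t z) / complex_of_real (s - t) - w z)" if s: "s \<in> {0..T}" "s \<noteq> t" for s
    proof -
      have st: "complex_of_real (s - t) \<noteq> 0" using s by simp
      have "L (u s) - (L (u t) + (s - t) *\<^sub>R L w)
          = complex_of_real (s - t) * ((L (u s) - L (u t)) / complex_of_real (s - t) - L w)"
        using st by (simp only: divide_diff_eq[OF st] scaleR_conv_of_real) simp
      then have "norm ((1 / norm (s - t)) *\<^sub>R (L (u s) - (L (u t) + (s - t) *\<^sub>R L w)))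
          = cmod ((L (u s) - L (u t)) / complex_of_real (s - t) - L w)"
        using s by (simp only: norm_scaleR norm_mult norm_of_real) simp
      then show ?thesis using bd[OF q(1)[OF s(1)]] q(2)[OF s(1)] by simp
    qed
    then show "\<forall>\<^sub>F s in at t within {0..T}. norm ((1 / norm (s - t)) *\<^sub>R (L (u s) - (L (u t) + (s - t) *\<^sub>R L w)))
        \<le> B * N (\<lambda>z. (u s z - u t z) / complex_of_real (s - t) - w z)"
      by (auto simp: eventually_at_filter)
  qed
  then show ?thesis
    unfolding has_vector_derivative_def has_derivative_within by (simp add: bounded_linear_scaleR_left)
qed

section \<open>Spatial second differences of averages\<close>

lemma continuous_on_proj: "continuous_on S fst" "continuous_on S snd"
  using continuous_on_fst[OF continuous_on_id] continuous_on_snd[OF continuous_on_id] by auto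

lemma higher_deriv_translate:
  assumes f: "smooth f"
  shows "(deriv ^^ i) (\<lambda>x. f (x - s)) = (\<lambda>x. (deriv ^^ i) f (x - s))"
proof (induction i)
  case (Suc i)
  have "((\<lambda>x. (deriv ^^ i) f (x - s)) has_real_derivative (deriv ^^ Suc i) f (x - s) * 1) (at x)" for x
    by (rule DERIV_chain2[OF smooth_has_higher_deriv[OF f]]) (auto intro!: derivative_eq_intros)
  then have "deriv (\<lambda>x. (deriv ^^ i) f (x - s)) = (\<lambda>x. (deriv ^^ Suc i) f (x - s))"
    by (intro ext DERIV_imp_deriv) auto
  then show ?case using Suc by simp
qed simp

lemma translate_vector_derivative:
  assumes f: "smooth f"
  shows "((\<lambda>s. complex_of_real ((- 1) ^ i * ((deriv ^^ i) f (x - s) * k))) has_vector_derivative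
     complex_of_real ((- 1) ^ Suc i * ((deriv ^^ Suc i) f (x - s) * k))) (at s)"
proof (rule has_vector_derivative_of_real)
  have "((\<lambda>s. (deriv ^^ i) f (x - s)) has_real_derivative (deriv ^^ Suc i) f (x - s) * (- 1)) (at s)"
    by (rule DERIV_chain2[OF smooth_has_higher_deriv[OF f]]) (auto intro!: derivative_eq_intros)
  then have "((\<lambda>s. (- 1) ^ i * ((deriv ^^ i) f (x - s) * k)) has_real_derivative
     (- 1) ^ i * ((deriv ^^ Suc i) f (x - s) * (- 1) * k)) (at s)"
    by (intro DERIV_cmult DERIV_cmult_right)
  then show "((\<lambda>s. (- 1) ^ i * ((deriv ^^ i) f (x - s) * k)) has_real_derivative
     (- 1) ^ Suc i * ((deriv ^^ Suc i) f (x - s) * k)) (at s)"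
    by (simp add: mult.assoc)
qed

context plane_rectangle
begin

text \<open>Differentiation under the integral sign: \<open>K i s\<close> is the \<open>i\<close>-th derivative in \<open>s\<close> of the kernel \<open>K 0 s\<close>.\<close>

lemma second_difference_of_integrals:
  fixes K :: "nat \<Rightarrow> real \<Rightarrow> field2"
  assumes v: "continuous_on (closure \<Omega>) v" and h: "0 < h"
    and dK: "\<And>i s z. i < 4 \<Longrightarrow> ((\<lambda>s. K i s z) has_vector_derivative K (Suc i) s z) (at s)"
    and cK: "\<And>i. i \<le> 4 \<Longrightarrow> continuous_on UNIV (\<lambda>p. K i (fst p) (snd p))"
    and B: "\<And>s. s \<in> {-h..h} \<Longrightarrow> cmod (LINT z|lebesgue_on \<Omega>. v z * K 4 s z) \<le> B"
  shows "cmod (((LINT z|lebesgue_on \<Omega>. v z * K 0 h z) - 2 * (LINT z|lebesgue_on \<Omega>. v z * K 0 0 z)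
       + (LINT z|lebesgue_on \<Omega>. v z * K 0 (- h) z)) / complex_of_real (h\<^sup>2)
     - (LINT z|lebesgue_on \<Omega>. v z * K 2 0 z)) \<le> 2 * B * h\<^sup>2"
proof -
  define F where "F i s = (LINT z|lebesgue_on \<Omega>. v z * K i s z)" for i s
  have cKs: "continuous_on S (K i s)" if "i \<le> 4" for i s S
    by (rule continuous_on_compose2[OF cK[OF that], of S "\<lambda>z. (s, z)", simplified]) (auto intro!: continuous_intros)
  have F: "F i s = integral (cbox (a, c) (b, d)) (\<lambda>z. v z * K i s z)" if "i \<le> 4" for i s
    unfolding F_def by (rule continuous_integrable(2)) (intro continuous_on_mult v cKs that)
  have "(F i has_vector_derivative F (Suc i) s) (at s within {-h..h})" if i: "i < 4" and s: "s \<in> {-h..h}" for i s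
  proof -
    have "((\<lambda>s. integral (cbox (a, c) (b, d)) (\<lambda>z. v z * K i s z)) has_vector_derivative
        integral (cbox (a, c) (b, d)) (\<lambda>z. v z * K (Suc i) s z)) (at s within {-h..h})"
    proof (rule leibniz_rule_vector_derivative)
      show "((\<lambda>s. v z * K i s z) has_vector_derivative v z * K (Suc i) s z) (at s within {-h..h})" for s z
        by (intro has_vector_derivative_mult_right has_vector_derivative_at_within[OF dK] i)
      show "(\<lambda>z. v z * K i s z) integrable_on cbox (a, c) (b, d)" for s
        using v i unfolding closure_\<Omega> by (intro integrable_continuous continuous_on_mult cKs) auto
      have "continuous_on ({-h..h} \<times> cbox (a, c) (b, d)) (\<lambda>p. v (snd p) * K (Suc i) (fst p) (snd p))"
        using i v unfolding closure_\<Omega>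
        by (intro continuous_on_mult continuous_on_subset[OF cK] continuous_on_compose2[OF _ continuous_on_snd[OF continuous_on_id]]) auto
      then show "continuous_on ({-h..h} \<times> cbox (a, c) (b, d)) (\<lambda>(s, z). v z * K (Suc i) s z)"
        by (simp add: case_prod_unfold)
    qed (use s in auto)
    moreover have "F i = (\<lambda>s. integral (cbox (a, c) (b, d)) (\<lambda>z. v z * K i s z))" using F[of i] i by auto
    ultimately show ?thesis using F[of "Suc i" s] i by simp
  qed
  then have "cmod ((F 0 h - 2 * F 0 0 + F 0 (- h)) / complex_of_real (h\<^sup>2) - F 2 0) \<le> 2 * B * h\<^sup>2"
    using B[folded F_def] h by (intro central_second_difference_error) auto
  then show ?thesis by (simp add: F_def)
qed

lemma avg_weak_deriv:
  assumes "has_weak_deriv \<Omega> i j v w" "fits r z"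
  shows "(LINT x|lebesgue_on \<Omega>. v x * partials i j (mollifier r z) x) = (-1) ^ (i + j) * avg r z w"
  using assms mollifier_test_function[of r z] by (auto simp: has_weak_deriv_def avg_def)

text \<open>Translating the kernel in one coordinate differentiates it, and the weak derivative moves the derivatives over
  to \<open>v\<close>. So the average has fourth derivative bounded by the norm of \<open>w4\<close>, uniformly in \<open>r\<close>. The coordinate
  direction is encoded by \<open>p\<close>, \<open>q\<close> (the moving and the fixed coordinate) and by the orders \<open>k i\<close>, \<open>l i\<close>, one of
  which is \<open>0\<close> and the other \<open>i\<close>.\<close>

lemma avg_second_difference:
  fixes \<zeta> :: "real \<Rightarrow> real \<times> real" and p q :: "real \<times> real \<Rightarrow> real" and k l :: "nat \<Rightarrow> nat"
  assumes v: "continuous_on (closure \<Omega>) v" and h: "0 < h"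
    and fg: "smooth f" "smooth g" and pq: "continuous_on UNIV p" "continuous_on UNIV q"
    and kl: "\<And>i. k i + l i = i"
    and part: "\<And>i s. partials (k i) (l i) (mollifier r (\<zeta> s)) = (\<lambda>z. complex_of_real ((deriv ^^ i) f (p z - s) * g (q z)))"
    and w2: "has_weak_deriv \<Omega> (k 2) (l 2) v w2" and w4: "has_weak_deriv \<Omega> (k 4) (l 4) v w4" "w4 \<in> Linf \<Omega>"
    and fit: "\<And>s. s \<in> {-h..h} \<Longrightarrow> fits r (\<zeta> s)"
  shows "cmod ((avg r (\<zeta> h) v - 2 * avg r (\<zeta> 0) v + avg r (\<zeta> (- h)) v) / complex_of_real (h\<^sup>2)
     - avg r (\<zeta> 0) w2) \<le> 2 * Linf_norm \<Omega> w4 * h\<^sup>2"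
proof -
  define K where "K i s z = complex_of_real ((- 1) ^ i * ((deriv ^^ i) f (p z - s) * g (q z)))" for i s z
  have Keq: "K i s = (\<lambda>z. (- 1) ^ i * partials (k i) (l i) (mollifier r (\<zeta> s)) z)" for i s
    unfolding part by (intro ext) (simp add: K_def)
  have K0: "K 0 s = mollifier r (\<zeta> s)" for s
    using kl[of 0] unfolding Keq by (simp add: partials_0)
  have K4: "(LINT z|lebesgue_on \<Omega>. v z * K 4 s z) = avg r (\<zeta> s) w4" if "s \<in> {-h..h}" for s
    using avg_weak_deriv[OF w4(1) fit[OF that]] unfolding kl Keq by simp
  have K2: "(LINT z|lebesgue_on \<Omega>. v z * K 2 0 z) = avg r (\<zeta> 0) w2"
    using avg_weak_deriv[OF w2 fit[of 0]] h unfolding kl Keq by simp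
  have main: "cmod (((LINT z|lebesgue_on \<Omega>. v z * K 0 h z) - 2 * (LINT z|lebesgue_on \<Omega>. v z * K 0 0 z)
       + (LINT z|lebesgue_on \<Omega>. v z * K 0 (- h) z)) / complex_of_real (h\<^sup>2)
     - (LINT z|lebesgue_on \<Omega>. v z * K 2 0 z)) \<le> 2 * Linf_norm \<Omega> w4 * h\<^sup>2"
  proof (rule second_difference_of_integrals[OF v h])
    show "((\<lambda>s. K i s z) has_vector_derivative K (Suc i) s z) (at s)" for i s z
      unfolding K_def by (rule translate_vector_derivative[OF fg(1)])
    show "continuous_on UNIV (\<lambda>x. K i (fst x) (snd x))" for i
      unfolding K_def
      by (intro continuous_intros continuous_on_compose2[OF smooth_continuous[OF smooth_higher_deriv[OF fg(1)]], of UNIV]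
          continuous_on_compose2[OF smooth_continuous[OF fg(2)], of UNIV]
          continuous_on_compose2[OF pq(1)] continuous_on_compose2[OF pq(2)]) auto
    show "cmod (LINT z|lebesgue_on \<Omega>. v z * K 4 s z) \<le> Linf_norm \<Omega> w4" if "s \<in> {-h..h}" for s
      unfolding K4[OF that] by (rule avg_Linf_le[OF w4(2) fit[OF that]])
  qed
  then show ?thesis unfolding K2 K0 by (simp add: avg_def)
qed

lemma avg_second_difference_x:
  assumes v: "continuous_on (closure \<Omega>) v" and h: "0 < h"
    and w2: "has_weak_deriv \<Omega> 2 0 v w2" and w4: "has_weak_deriv \<Omega> 4 0 v w4" "w4 \<in> Linf \<Omega>"
    and z: "fits r (x + h, y)" "fits r (x - h, y)"
  shows "cmod ((avg r (x + h, y) v - 2 * avg r (x, y) v + avg r (x - h, y) v) / complex_of_real (h\<^sup>2)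
     - avg r (x, y) w2) \<le> 2 * Linf_norm \<Omega> w4 * h\<^sup>2"
proof -
  define f where "f x' = bump (- r) r 0 (x' - x) / bump_mass r" for x'
  define g where "g y' = bump (- r) r 0 (y' - y)" for y'
  have fg: "smooth f" "smooth g" unfolding f_def[abs_def] g_def[abs_def] by (rule smooth_mollifier_factors)+
  have mol: "mollifier r (x + s, y) = tensor (\<lambda>x. f (x - s)) g" for s
    unfolding mollifier_def f_def g_def by (simp add: diff_diff_eq add.commute)
  have part: "partials i 0 (mollifier r (x + s, y)) = (\<lambda>z. complex_of_real ((deriv ^^ i) f (fst z - s) * g (snd z)))" for i s
    unfolding mol partials_tensor[OF smooth_translate[OF fg(1)] fg(2)] higher_deriv_translate[OF fg(1)]
    by (auto simp: tensor_def)
  show ?thesis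
    using avg_second_difference[OF v h fg continuous_on_proj _ part w2 w4] z
    by (auto simp: fits_def)
qed

lemma avg_second_difference_y:
  assumes v: "continuous_on (closure \<Omega>) v" and h: "0 < h"
    and w2: "has_weak_deriv \<Omega> 0 2 v w2" and w4: "has_weak_deriv \<Omega> 0 4 v w4" "w4 \<in> Linf \<Omega>"
    and z: "fits r (x, y + h)" "fits r (x, y - h)"
  shows "cmod ((avg r (x, y + h) v - 2 * avg r (x, y) v + avg r (x, y - h) v) / complex_of_real (h\<^sup>2)
     - avg r (x, y) w2) \<le> 2 * Linf_norm \<Omega> w4 * h\<^sup>2"
proof -
  define f where "f x' = bump (- r) r 0 (x' - x) / bump_mass r" for x'
  define g where "g y' = bump (- r) r 0 (y' - y)" for y'
  have fg: "smooth f" "smooth g" unfolding f_def[abs_def] g_def[abs_def] by (rule smooth_mollifier_factors)+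
  have mol: "mollifier r (x, y + s) = tensor f (\<lambda>y. g (y - s))" for s
    unfolding mollifier_def f_def g_def by (simp add: diff_diff_eq add.commute)
  have part: "partials 0 i (mollifier r (x, y + s)) = (\<lambda>z. complex_of_real ((deriv ^^ i) g (snd z - s) * f (fst z)))" for i s
    unfolding mol partials_tensor[OF fg(1) smooth_translate[OF fg(2)]] higher_deriv_translate[OF fg(2)]
    by (auto simp: tensor_def)
  show ?thesis
    using avg_second_difference[OF v h fg(2,1) continuous_on_proj(2,1) _ part w2 w4] z
    by (auto simp: fits_def)
qed

end

section \<open>Consistency of the scheme\<close>

definition neighbours :: "real \<Rightarrow> real \<Rightarrow> real \<times> real \<Rightarrow> (real \<times> real) set" where
  "neighbours h1 h2 z = {(fst z + h1, snd z), (fst z - h1, snd z), (fst z, snd z + h2), (fst z, snd z - h2)}"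

definition stencil_laplacian :: "real \<Rightarrow> real \<Rightarrow> field2 \<Rightarrow> field2" where
  "stencil_laplacian h1 h2 w z =
     (w (fst z + h1, snd z) - 2 * w z + w (fst z - h1, snd z)) / complex_of_real (h1\<^sup>2)
     + (w (fst z, snd z + h2) - 2 * w z + w (fst z, snd z - h2)) / complex_of_real (h2\<^sup>2)"

context plane_rectangle
begin

lemma L2_integrable: "v \<in> L2 \<Omega> \<Longrightarrow> integrable (lebesgue_on \<Omega>) v"
proof -
  assume v: "v \<in> L2 \<Omega>"
  interpret finite_measure "lebesgue_on \<Omega>" by (rule finite_measure_\<Omega>)
  have i: "integrable (lebesgue_on \<Omega>) (\<lambda>z. 1 + (cmod (v z))\<^sup>2)" using v by (auto simp: L2_def)
  show ?thesis
  proof (rule Bochner_Integration.integrable_bound[OF i])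
    show "v \<in> borel_measurable (lebesgue_on \<Omega>)" using v by (simp add: L2_def)
    show "AE z in lebesgue_on \<Omega>. norm (v z) \<le> norm (1 + (cmod (v z))\<^sup>2)"
    proof (rule AE_I2)
      fix z
      have "2 * cmod (v z) * 1 \<le> (cmod (v z))\<^sup>2 + 1\<^sup>2" by (rule sum_squares_bound)
      then have "2 * cmod (v z) \<le> (cmod (v z))\<^sup>2 + 1" by simp
      then have "cmod (v z) \<le> 1 + (cmod (v z))\<^sup>2" using norm_ge_zero[of "v z"] by linarith
      then show "norm (v z) \<le> norm (1 + (cmod (v z))\<^sup>2)" by simp
    qed
  qed
qed

lemma L2_cmult: "v \<in> L2 \<Omega> \<Longrightarrow> (\<lambda>z. k * v z) \<in> L2 \<Omega>"
  by (auto simp: L2_def norm_mult power_mult_distrib)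

text \<open>Averages are continuous in \<open>L\<^sup>2\<close>. Any constant will do, so Young's inequality with a suitable weight replaces
  the Cauchy-Schwarz inequality.\<close>

lemma avg_L2_le:
  assumes v: "v \<in> L2 \<Omega>"
  shows "cmod (avg r z v) \<le> ((LINT x|lebesgue_on \<Omega>. (cmod (mollifier r z x))\<^sup>2) + 1) / 2 * L2_norm \<Omega> v"
proof -
  define P where "P = (LINT x|lebesgue_on \<Omega>. (cmod (mollifier r z x))\<^sup>2)"
  have P: "0 \<le> P" unfolding P_def by (intro integral_nonneg_AE) auto
  have iP: "integrable (lebesgue_on \<Omega>) (\<lambda>x. (cmod (mollifier r z x))\<^sup>2)"
    by (intro continuous_integrable continuous_intros continuous_on_norm mollifier_continuous)
  have iv: "integrable (lebesgue_on \<Omega>) (\<lambda>x. (cmod (v x))\<^sup>2)" using v by (simp add: L2_def)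
  have young: "cmod (avg r z v) \<le> \<epsilon> * P / 2 + (L2_norm \<Omega> v)\<^sup>2 / (2 * \<epsilon>)" if \<epsilon>: "0 < \<epsilon>" for \<epsilon>
  proof -
    have "cmod (avg r z v) \<le> (LINT x|lebesgue_on \<Omega>. cmod (v x * mollifier r z x))"
      unfolding avg_def by (rule integral_norm_bound)
    also have "\<dots> \<le> (LINT x|lebesgue_on \<Omega>. \<epsilon> / 2 * (cmod (mollifier r z x))\<^sup>2 + 1 / (2 * \<epsilon>) * (cmod (v x))\<^sup>2)"
    proof (rule integral_mono)
      show "integrable (lebesgue_on \<Omega>) (\<lambda>x. cmod (v x * mollifier r z x))"
        using integrable_times_mollifier[OF L2_integrable[OF v]] by (rule integrable_norm)
      show "integrable (lebesgue_on \<Omega>) (\<lambda>x. \<epsilon> / 2 * (cmod (mollifier r z x))\<^sup>2 + 1 / (2 * \<epsilon>) * (cmod (v x))\<^sup>2)"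
        using iP iv by auto
      fix x
      have "2 * (sqrt \<epsilon> * cmod (mollifier r z x)) * (cmod (v x) / sqrt \<epsilon>)
          \<le> (sqrt \<epsilon> * cmod (mollifier r z x))\<^sup>2 + (cmod (v x) / sqrt \<epsilon>)\<^sup>2" by (rule sum_squares_bound)
      then show "cmod (v x * mollifier r z x) \<le> \<epsilon> / 2 * (cmod (mollifier r z x))\<^sup>2 + 1 / (2 * \<epsilon>) * (cmod (v x))\<^sup>2"
        using \<epsilon> by (simp add: norm_mult power_mult_distrib power_divide mult.commute field_simps)
    qed
    also have "\<dots> = \<epsilon> * P / 2 + (L2_norm \<Omega> v)\<^sup>2 / (2 * \<epsilon>)"
      using iP iv by (simp add: P_def L2_norm_power2)
    finally show ?thesis .
  qed
  have N: "0 \<le> L2_norm \<Omega> v" unfolding L2_norm_def by (intro real_sqrt_ge_zero integral_nonneg_AE) auto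
  show ?thesis unfolding P_def[symmetric]
  proof (cases "L2_norm \<Omega> v = 0")
    case False
    then have "0 < L2_norm \<Omega> v" using N by simp
    then show "cmod (avg r z v) \<le> (P + 1) / 2 * L2_norm \<Omega> v"
      using young[of "L2_norm \<Omega> v"] by (simp add: power2_eq_square field_simps)
  next
    case True
    have "cmod (avg r z v) \<le> 0 + e" if e: "0 < e" for e :: real
    proof -
      have "cmod (avg r z v) \<le> (e / (P + 1)) * P / 2" using young[of "e / (P + 1)"] True e P by simp
      also have "\<dots> \<le> e" using e P by (simp add: field_simps) 
      finally show ?thesis by simp
    qed
    then show "cmod (avg r z v) \<le> (P + 1) / 2 * L2_norm \<Omega> v" using field_le_epsilon[of "cmod (avg r z v)" 0] True by simp
  qed
qed

end

definition residual_const :: "real \<Rightarrow> real \<Rightarrow> real \<Rightarrow> real" where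
  "residual_const M3 M0 L = 1 + 6 * M3 + 48 * L * M3 + 4 * L + 4 * M0"

lemma zlog_residual_transfer:
  assumes "cmod (A - 2 * complex_of_real lam * zlog p) \<le> \<delta>" "cmod (zlog p - zlog q) \<le> \<eta>"
  shows "cmod (A - 2 * complex_of_real lam * zlog q) \<le> \<delta> + 2 * \<bar>lam\<bar> * \<eta>"
proof -
  have "A - 2 * complex_of_real lam * zlog q = (A - 2 * complex_of_real lam * zlog p) + 2 * complex_of_real lam * (zlog p - zlog q)"
    by (simp add: algebra_simps)
  then have "cmod (A - 2 * complex_of_real lam * zlog q)
      \<le> cmod (A - 2 * complex_of_real lam * zlog p) + cmod (2 * complex_of_real lam * (zlog p - zlog q))"
    by (simp only: norm_triangle_ineq)
  also have "cmod (2 * complex_of_real lam * (zlog p - zlog q)) = 2 * \<bar>lam\<bar> * cmod (zlog p - zlog q)"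
    by (simp add: norm_mult)
  also have "cmod (A - 2 * complex_of_real lam * zlog p) + 2 * \<bar>lam\<bar> * cmod (zlog p - zlog q) \<le> \<delta> + 2 * \<bar>lam\<bar> * \<eta>"
    using assms by (intro add_mono mult_left_mono) auto
  finally show ?thesis .
qed

locale smooth_logSE_solution = plane_rectangle +
  fixes lam T :: real and u0 :: field2 and u :: "real \<Rightarrow> field2"
  assumes T: "0 < T"
    and sol: "logSE_solution \<Omega> lam u0 T u"
    and C3: "u \<in> Cm_time 3 T (Linf \<Omega>) (Linf_norm \<Omega>)"
    and C0: "u \<in> Cm_time 0 T (W4_H10 \<Omega>) (W4_H10_norm \<Omega>)"
begin

definition M3 :: real where "M3 = Cm_time_norm 3 T (Linf \<Omega>) (Linf_norm \<Omega>) u"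
definition M0 :: real where "M0 = Cm_time_norm 0 T (W4_H10 \<Omega>) (W4_H10_norm \<Omega>) u"

definition dt :: "nat \<Rightarrow> real \<Rightarrow> field2" where
  "dt l = (time_deriv T (Linf \<Omega>) (Linf_norm \<Omega>) ^^ l) u"

lemma dt_0: "dt 0 = u" by (simp add: dt_def)

lemma dt_Linf: "l \<le> 3 \<Longrightarrow> t \<in> {0..T} \<Longrightarrow> dt l t \<in> Linf \<Omega>"
  using C3 by (auto simp: Cm_time_def dt_def)

lemma dt_bound:
  assumes "l \<le> 3" "t \<in> {0..T}"
  shows "Linf_norm \<Omega> (dt l t) \<le> M3"
proof -
  have bdd: "bdd_above ((\<lambda>t. Linf_norm \<Omega> (dt l t)) ` {0..T})"
    unfolding dt_def
  proof (rule Cm_time_bdd_above[OF C3 assms(1)])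
    fix v w assume vw: "v \<in> Linf \<Omega>" "w \<in> Linf \<Omega>"
    have "Linf_norm \<Omega> v \<le> Linf_norm \<Omega> w + Linf_norm \<Omega> (\<lambda>z. v z - w z)"
      by (rule Linf_norm_le_AE[OF Linf_measurable[OF vw(1)] vw(2) Linf_diff[OF vw]]) auto
    then show "Linf_norm \<Omega> v \<le> 2 * (Linf_norm \<Omega> w + Linf_norm \<Omega> (\<lambda>z. v z - w z))"
      using add_mono[OF Linf_norm_nonneg[of w] Linf_norm_nonneg[of "\<lambda>z. v z - w z"]] by simp
  qed
  have "Linf_norm \<Omega> (dt l t) \<le> (SUP t\<in>{0..T}. Linf_norm \<Omega> (dt l t))"
    by (rule cSUP_upper[OF assms(2) bdd])
  also have "\<dots> \<le> M3"
    unfolding M3_def Cm_time_norm_def dt_def using assms(1) by (intro Max_ge) auto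
  finally show ?thesis .
qed

lemma M3_nonneg: "0 \<le> M3"
  using dt_bound[of 0 0] Linf_norm_nonneg[of "dt 0 0"] T by auto

lemma u_W4: "t \<in> {0..T} \<Longrightarrow> u t \<in> Wk_inf \<Omega> 4"
  using C0 by (auto simp: Cm_time_def W4_H10_def)

lemma space_deriv:
  assumes "i + j \<le> 4" "t \<in> {0..T}"
  shows "has_weak_deriv \<Omega> i j (u t) (weak_deriv \<Omega> i j (u t))" "weak_deriv \<Omega> i j (u t) \<in> Linf \<Omega>"
    "Linf_norm \<Omega> (weak_deriv \<Omega> i j (u t)) \<le> M0"
proof -
  show "has_weak_deriv \<Omega> i j (u t) (weak_deriv \<Omega> i j (u t))" "weak_deriv \<Omega> i j (u t) \<in> Linf \<Omega>"
    by (rule Wk_inf_weak_deriv[OF u_W4[OF assms(2)] assms(1)])+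
  have bdd: "bdd_above ((\<lambda>t. W4_H10_norm \<Omega> (u t)) ` {0..T})"
    using Cm_time_bdd_above[OF C0, of 0] W4_H10_norm_quasi_triangle by auto
  have "Linf_norm \<Omega> (weak_deriv \<Omega> i j (u t)) \<le> W4_H10_norm \<Omega> (u t)"
    using Wk_inf_weak_deriv(3)[OF u_W4[OF assms(2)] assms(1)] Hk_norm_nonneg[of 1 "u t"] by (simp add: W4_H10_norm_def)
  also have "\<dots> \<le> (SUP t\<in>{0..T}. W4_H10_norm \<Omega> (u t))" by (rule cSUP_upper[OF assms(2) bdd])
  also have "\<dots> = M0" by (simp add: M0_def Cm_time_norm_def)
  finally show "Linf_norm \<Omega> (weak_deriv \<Omega> i j (u t)) \<le> M0" .
qed

lemma M0_nonneg: "0 \<le> M0"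
  using space_deriv(3)[of 0 0 0] Linf_norm_nonneg[of "weak_deriv \<Omega> 0 0 (u 0)"] T by auto

lemma u_cont: "t \<in> {0..T} \<Longrightarrow> continuous_on (closure \<Omega>) (u t)"
  using sol by (simp add: logSE_solution_def)

lemma avg_dt_deriv:
  assumes z: "fits r z" and "l < 3" "t \<in> {0..T}"
  shows "((\<lambda>s. avg r z (dt l s)) has_vector_derivative avg r z (dt (Suc l) t)) (at t within {0..T})"
proof (rule functional_time_deriv[where V = "Linf \<Omega>" and N = "Linf_norm \<Omega>" and B = 1
      and u = "dt l" and w = "dt (Suc l) t" and L = "avg r z"])
  have "\<exists>w. has_time_deriv T (Linf \<Omega>) (Linf_norm \<Omega>) (dt l) t w"
    using C3 assms by (auto simp: Cm_time_def dt_def)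
  then show "has_time_deriv T (Linf \<Omega>) (Linf_norm \<Omega>) (dt l) t (dt (Suc l) t)"
    using someI_ex[of "has_time_deriv T (Linf \<Omega>) (Linf_norm \<Omega>) (dt l) t"] by (simp add: dt_def time_deriv_def)
qed (use assms dt_Linf avg_Linf_le in \<open>auto intro: Linf_diff Linf_cmult avg_diff avg_cmult Linf_integrable\<close>)

lemma avg_dt_bound: "fits r z \<Longrightarrow> l \<le> 3 \<Longrightarrow> t \<in> {0..T} \<Longrightarrow> cmod (avg r z (dt l t)) \<le> M3"
  using avg_Linf_le[OF dt_Linf] dt_bound order_trans by blast

text \<open>The time derivatives with respect to \<open>L\<^sup>2\<close> and to \<open>L\<^sup>\<infinity>\<close> have the same averages, since both are
  the derivative of the average of \<open>u\<close>.\<close>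

lemma avg_L2_time_deriv:
  assumes z: "fits r z" and t: "t \<in> {0..T}"
  shows "avg r z (time_deriv T (L2 \<Omega>) (L2_norm \<Omega>) u t) = avg r z (dt 1 t)"
    "time_deriv T (L2 \<Omega>) (L2_norm \<Omega>) u t \<in> L2 \<Omega>"
proof -
  have C1: "u \<in> Cm_time 1 T (L2 \<Omega>) (L2_norm \<Omega>)" using sol by (simp add: logSE_solution_def)
  have "\<exists>w. has_time_deriv T (L2 \<Omega>) (L2_norm \<Omega>) u t w"
    using C1 t by (auto simp: Cm_time_def)
  then have d: "has_time_deriv T (L2 \<Omega>) (L2_norm \<Omega>) u t (time_deriv T (L2 \<Omega>) (L2_norm \<Omega>) u t)"
    unfolding time_deriv_def by (rule someI_ex)
  then show "time_deriv T (L2 \<Omega>) (L2_norm \<Omega>) u t \<in> L2 \<Omega>" by (simp add: has_time_deriv_def)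
  have uL2: "u s \<in> L2 \<Omega>" if "s \<in> {0..T}" for s
    using C1 that by (auto simp: Cm_time_def dest: spec[of _ 0])
  have "((\<lambda>s. avg r z (u s)) has_vector_derivative avg r z (time_deriv T (L2 \<Omega>) (L2_norm \<Omega>) u t)) (at t within {0..T})"
    by (rule functional_time_deriv[OF d uL2 t, where B = "((LINT x|lebesgue_on \<Omega>. (cmod (mollifier r z x))\<^sup>2) + 1) / 2"])
       (use avg_L2_le in \<open>auto intro: L2_diff L2_cmult avg_diff avg_cmult L2_integrable\<close>)
  moreover have "((\<lambda>s. avg r z (u s)) has_vector_derivative avg r z (dt 1 t)) (at t within {0..T})"
    using avg_dt_deriv[OF z _ t, of 0] by (simp add: dt_0)
  ultimately show "avg r z (time_deriv T (L2 \<Omega>) (L2_norm \<Omega>) u t) = avg r z (dt 1 t)"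
    using vector_derivative_unique_within_closed_interval[of 0 T t] T t by auto
qed

lemma zlog_continuous: "continuous_on S zlog"
  by (intro continuous_at_imp_continuous_on ballI isCont_zlog)

lemma zlog_u_cont: "t \<in> {0..T} \<Longrightarrow> continuous_on (closure \<Omega>) (\<lambda>x. zlog (u t x))"
  by (rule continuous_on_compose2[OF zlog_continuous[of UNIV] u_cont]) auto

lemma avg_equation:
  assumes z: "fits r z" and t: "t \<in> {0..T}"
  shows "\<i> * avg r z (dt 1 t) + (avg r z (weak_deriv \<Omega> 2 0 (u t)) + avg r z (weak_deriv \<Omega> 0 2 (u t)))
     = 2 * complex_of_real lam * avg r z (\<lambda>x. zlog (u t x))"
proof -
  define ut where "ut = time_deriv T (L2 \<Omega>) (L2_norm \<Omega>) u t"
  note ut = avg_L2_time_deriv[OF z t, folded ut_def]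
  have i: "integrable (lebesgue_on \<Omega>) (\<lambda>x. ut x * mollifier r z x)"
    "integrable (lebesgue_on \<Omega>) (\<lambda>x. weak_deriv \<Omega> 2 0 (u t) x * mollifier r z x)"
    "integrable (lebesgue_on \<Omega>) (\<lambda>x. weak_deriv \<Omega> 0 2 (u t) x * mollifier r z x)"
    "integrable (lebesgue_on \<Omega>) (\<lambda>x. zlog (u t x) * mollifier r z x)"
    using L2_integrable[OF ut(2)] Linf_integrable[OF space_deriv(2)[of 2 0 t]]
      Linf_integrable[OF space_deriv(2)[of 0 2 t]] continuous_integrable(1)[OF zlog_u_cont[OF t]] t
    by (simp_all add: integrable_times_mollifier)
  have zl: "x * complex_of_real (ln ((cmod x)\<^sup>2)) = 2 * zlog x" for x
    by (cases "x = 0") (auto simp: zlog_def ln_realpow)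
  have eq: "AE x in lebesgue_on \<Omega>. \<i> * ut x + (weak_deriv \<Omega> 2 0 (u t) x + weak_deriv \<Omega> 0 2 (u t) x)
     = complex_of_real lam * u t x * complex_of_real (ln ((cmod (u t x))\<^sup>2))"
    using sol t unfolding logSE_solution_def ut_def by blast
  have "(LINT x|lebesgue_on \<Omega>. \<i> * (ut x * mollifier r z x) + (weak_deriv \<Omega> 2 0 (u t) x * mollifier r z x
       + weak_deriv \<Omega> 0 2 (u t) x * mollifier r z x))
     = (LINT x|lebesgue_on \<Omega>. 2 * complex_of_real lam * (zlog (u t x) * mollifier r z x))"
  proof (rule integral_cong_AE)
    show "AE x in lebesgue_on \<Omega>. \<i> * (ut x * mollifier r z x) + (weak_deriv \<Omega> 2 0 (u t) x * mollifier r z x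
       + weak_deriv \<Omega> 0 2 (u t) x * mollifier r z x) = 2 * complex_of_real lam * (zlog (u t x) * mollifier r z x)"
      using eq
    proof eventually_elim
      case (elim x)
      have "\<i> * (ut x * mollifier r z x) + (weak_deriv \<Omega> 2 0 (u t) x * mollifier r z x
          + weak_deriv \<Omega> 0 2 (u t) x * mollifier r z x)
        = (\<i> * ut x + (weak_deriv \<Omega> 2 0 (u t) x + weak_deriv \<Omega> 0 2 (u t) x)) * mollifier r z x"
        by (simp add: distrib_right mult.assoc)
      also have "\<dots> = complex_of_real lam * (u t x * complex_of_real (ln ((cmod (u t x))\<^sup>2))) * mollifier r z x"
        by (simp only: elim mult.assoc)
      finally show ?case by (simp add: zl mult_ac)
    qed
  qed (use i in auto)
  moreover have "(LINT x|lebesgue_on \<Omega>. \<i> * (ut x * mollifier r z x) + (weak_deriv \<Omega> 2 0 (u t) x * mollifier r z x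
       + weak_deriv \<Omega> 0 2 (u t) x * mollifier r z x)) = \<i> * avg r z ut + (avg r z (weak_deriv \<Omega> 2 0 (u t)) + avg r z (weak_deriv \<Omega> 0 2 (u t)))"
    unfolding avg_def using i by simp
  moreover have "(LINT x|lebesgue_on \<Omega>. 2 * complex_of_real lam * (zlog (u t x) * mollifier r z x))
     = 2 * complex_of_real lam * avg r z (\<lambda>x. zlog (u t x))"
    unfolding avg_def by simp
  ultimately show ?thesis using ut(1) by simp
qed

text \<open>\<open>D\<close> stands for a difference quotient in time of averages. The averaged equation holds exactly, so only the
  errors of the difference quotients in time and in space remain.\<close>

lemma avg_consistency:
  assumes t: "t \<in> {0..T}" and h: "0 < h1" "0 < h2"
    and fit: "\<And>p. p \<in> neighbours h1 h2 z \<Longrightarrow> fits r p"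
    and D: "cmod (D - avg r z (dt 1 t)) \<le> \<delta>"
  shows "cmod (\<i> * D + stencil_laplacian h1 h2 (\<lambda>p. avg r p (u t)) z
      - 2 * complex_of_real lam * avg r z (\<lambda>x. zlog (u t x))) \<le> \<delta> + 2 * M0 * (h1\<^sup>2 + h2\<^sup>2)"
proof -
  obtain x y where xy: "z = (x, y)" by (cases z)
  define X where "X = (avg r (x + h1, y) (u t) - 2 * avg r (x, y) (u t) + avg r (x - h1, y) (u t)) / complex_of_real (h1\<^sup>2)"
  define Y where "Y = (avg r (x, y + h2) (u t) - 2 * avg r (x, y) (u t) + avg r (x, y - h2) (u t)) / complex_of_real (h2\<^sup>2)"
  define wx where "wx = avg r z (weak_deriv \<Omega> 2 0 (u t))"
  define wy where "wy = avg r z (weak_deriv \<Omega> 0 2 (u t))"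
  have fit': "fits r (x + h1, y)" "fits r (x - h1, y)" "fits r (x, y + h2)" "fits r (x, y - h2)"
    using fit by (auto simp: neighbours_def xy)
  then have z: "fits r z" by (auto simp: fits_def xy)
  have X: "cmod (X - wx) \<le> 2 * M0 * h1\<^sup>2"
  proof -
    have "cmod (X - wx) \<le> 2 * Linf_norm \<Omega> (weak_deriv \<Omega> 4 0 (u t)) * h1\<^sup>2"
      unfolding X_def wx_def xy using t h fit'
      by (intro avg_second_difference_x u_cont space_deriv) auto
    also have "\<dots> \<le> 2 * M0 * h1\<^sup>2" using space_deriv(3)[of 4 0 t] t by (intro mult_right_mono) auto
    finally show ?thesis .
  qed
  have Y: "cmod (Y - wy) \<le> 2 * M0 * h2\<^sup>2"
  proof -
    have "cmod (Y - wy) \<le> 2 * Linf_norm \<Omega> (weak_deriv \<Omega> 0 4 (u t)) * h2\<^sup>2"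
      unfolding Y_def wy_def xy using t h fit'
      by (intro avg_second_difference_y u_cont space_deriv) auto
    also have "\<dots> \<le> 2 * M0 * h2\<^sup>2" using space_deriv(3)[of 0 4 t] t by (intro mult_right_mono) auto
    finally show ?thesis .
  qed
  have "\<i> * D + (X + Y) - 2 * complex_of_real lam * avg r z (\<lambda>x. zlog (u t x))
      = \<i> * (D - avg r z (dt 1 t)) + ((X - wx) + (Y - wy))"
    unfolding avg_equation[OF z t, symmetric] wx_def wy_def by (simp add: algebra_simps)
  also have "cmod \<dots> \<le> cmod (D - avg r z (dt 1 t)) + (cmod (X - wx) + cmod (Y - wy))"
    by (intro order_trans[OF norm_triangle_ineq] add_mono norm_triangle_ineq) (simp add: norm_mult)
  also have "\<dots> \<le> \<delta> + 2 * M0 * (h1\<^sup>2 + h2\<^sup>2)" using D X Y by (simp add: distrib_left)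
  finally show ?thesis by (simp add: stencil_laplacian_def X_def Y_def xy)
qed

text \<open>As the radius tends to \<open>0\<close> the averages become point values; here all points of the stencil lie in \<open>\<Omega>\<close>.\<close>

lemma interior_consistency:
  assumes t: "t \<in> {0..T}" and h: "0 < h1" "0 < h2" and z: "z \<in> \<Omega>" and mem: "neighbours h1 h2 z \<subseteq> \<Omega>"
    and Dm: "Dm \<longlonglongrightarrow> D" "\<And>m. fits (1 / real (Suc m)) z \<Longrightarrow> cmod (Dm m - avg (1 / real (Suc m)) z (dt 1 t)) \<le> \<delta>"
  shows "cmod (\<i> * D + stencil_laplacian h1 h2 (u t) z - 2 * complex_of_real lam * zlog (u t z))
     \<le> \<delta> + 2 * M0 * (h1\<^sup>2 + h2\<^sup>2)"
proof (rule LIMSEQ_le_const2)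
  let ?A = "\<lambda>m p v. avg (1 / real (Suc m)) p v"
  let ?R = "\<lambda>m. cmod (\<i> * Dm m + stencil_laplacian h1 h2 (\<lambda>p. ?A m p (u t)) z
      - 2 * complex_of_real lam * ?A m z (\<lambda>x. zlog (u t x)))"
  show "?R \<longlonglongrightarrow> cmod (\<i> * D + stencil_laplacian h1 h2 (u t) z - 2 * complex_of_real lam * zlog (u t z))"
    unfolding stencil_laplacian_def using h mem
    by (intro tendsto_intros Dm(1) avg_tendsto u_cont zlog_u_cont t z) (auto simp: neighbours_def)
  have "\<forall>\<^sub>F m in sequentially. \<forall>p\<in>neighbours h1 h2 z. fits (1 / real (Suc m)) p"
    using mem by (intro eventually_ball_finite ballI fits_eventually) (auto simp: neighbours_def)
  then have "\<forall>\<^sub>F m in sequentially. ?R m \<le> \<delta> + 2 * M0 * (h1\<^sup>2 + h2\<^sup>2)"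
    using fits_eventually[OF z]
  proof eventually_elim
    case (elim m)
    then show ?case by (intro avg_consistency t h Dm(2)) auto
  qed
  then show "\<exists>N. \<forall>m\<ge>N. ?R m \<le> \<delta> + 2 * M0 * (h1\<^sup>2 + h2\<^sup>2)"
    by (simp add: eventually_sequentially)
qed

text \<open>Next to the boundary of the grid the stencil has points on the boundary of \<open>\<Omega>\<close>, about which no average can be
  formed. They are reached by shrinking the stencil by a factor \<open>\<theta> < 1\<close> and letting \<open>\<theta> \<rightarrow> 1\<close>.\<close>

lemma stencil_consistency:
  assumes t: "t \<in> {0..T}" and h: "0 < h1" "0 < h2" and z: "z \<in> \<Omega>" and mem: "neighbours h1 h2 z \<subseteq> closure \<Omega>"
    and Dm: "Dm \<longlonglongrightarrow> D" "\<And>m. fits (1 / real (Suc m)) z \<Longrightarrow> cmod (Dm m - avg (1 / real (Suc m)) z (dt 1 t)) \<le> \<delta>"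
  shows "cmod (\<i> * D + stencil_laplacian h1 h2 (u t) z - 2 * complex_of_real lam * zlog (u t z))
     \<le> \<delta> + 2 * M0 * (h1\<^sup>2 + h2\<^sup>2)"
proof (rule LIMSEQ_le_const2)
  define \<theta> where "\<theta> n = 1 - 1 / real (Suc (Suc n))" for n
  have \<theta>: "0 < \<theta> n" "\<theta> n < 1" for n by (auto simp: \<theta>_def)
  have "(\<lambda>n. 1 / real (Suc (Suc n))) \<longlonglongrightarrow> 0"
    using LIMSEQ_Suc[OF LIMSEQ_inverse_real_of_nat] by (simp add: inverse_eq_divide)
  then have "(\<lambda>n. 1 - 1 / real (Suc (Suc n))) \<longlonglongrightarrow> 1 - 0" by (intro tendsto_intros)
  then have \<theta>_lim: "\<theta> \<longlonglongrightarrow> 1" by (simp add: \<theta>_def[abs_def])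
  have small: "0 < h1 * \<theta> n" "h1 * \<theta> n < h1" "0 < h2 * \<theta> n" "h2 * \<theta> n < h2" for n
    using h \<theta>[of n] by auto
  have inn: "neighbours (h1 * \<theta> n) (h2 * \<theta> n) z \<subseteq> \<Omega>" for n
    using z mem small[of n] unfolding neighbours_def by (auto simp: mem_\<Omega> mem_closure_\<Omega>)
  have L: "(\<lambda>n. h1 * \<theta> n) \<longlonglongrightarrow> h1" "(\<lambda>n. h2 * \<theta> n) \<longlonglongrightarrow> h2"
    using tendsto_mult[OF tendsto_const \<theta>_lim, of h1] tendsto_mult[OF tendsto_const \<theta>_lim, of h2] by auto
  have lim: "(\<lambda>n. u t (p n)) \<longlonglongrightarrow> u t q" if "p \<longlonglongrightarrow> q" "q \<in> closure \<Omega>" "\<And>n. p n \<in> \<Omega>" for p q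
    using that subsetD[OF closure_subset[of \<Omega>]]
    by (intro continuous_on_tendsto_compose[OF u_cont[OF t]] always_eventually) auto
  let ?R = "\<lambda>n. cmod (\<i> * D + stencil_laplacian (h1 * \<theta> n) (h2 * \<theta> n) (u t) z - 2 * complex_of_real lam * zlog (u t z))"
  show "?R \<longlonglongrightarrow> cmod (\<i> * D + stencil_laplacian h1 h2 (u t) z - 2 * complex_of_real lam * zlog (u t z))"
    unfolding stencil_laplacian_def using h mem inn unfolding neighbours_def
    by (intro tendsto_intros lim L) auto
  have "?R n \<le> \<delta> + 2 * M0 * (h1\<^sup>2 + h2\<^sup>2)" for n
  proof (rule order_trans[OF interior_consistency[OF t small(1,3) z inn Dm]])
    have "(h1 * \<theta> n)\<^sup>2 + (h2 * \<theta> n)\<^sup>2 \<le> h1\<^sup>2 + h2\<^sup>2"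
      using less_imp_le[OF small(1)] less_imp_le[OF small(2)] less_imp_le[OF small(3)] less_imp_le[OF small(4)]
      by (intro add_mono power_mono)
    then have "2 * M0 * ((h1 * \<theta> n)\<^sup>2 + (h2 * \<theta> n)\<^sup>2) \<le> 2 * M0 * (h1\<^sup>2 + h2\<^sup>2)"
      using M0_nonneg by (intro mult_left_mono) auto
    then show "\<delta> + 2 * M0 * ((h1 * \<theta> n)\<^sup>2 + (h2 * \<theta> n)\<^sup>2) \<le> \<delta> + 2 * M0 * (h1\<^sup>2 + h2\<^sup>2)" by simp
  qed
  then show "\<exists>N. \<forall>n\<ge>N. ?R n \<le> \<delta> + 2 * M0 * (h1\<^sup>2 + h2\<^sup>2)" by blast
qed

lemma pointwise_from_avg:
  assumes z: "z \<in> \<Omega>" and X: "X \<longlonglongrightarrow> L" and B: "\<And>m. fits (1 / real (Suc m)) z \<Longrightarrow> cmod (X m) \<le> B"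
  shows "cmod L \<le> B"
proof (rule LIMSEQ_le_const2[OF tendsto_norm[OF X]])
  show "\<exists>N. \<forall>n\<ge>N. cmod (X n) \<le> B"
    using fits_eventually[OF z] B unfolding eventually_sequentially by blast
qed

lemma u_bound:
  assumes z: "z \<in> \<Omega>" and t: "t \<in> {0..T}"
  shows "cmod (u t z) \<le> M3"
  using avg_dt_bound[OF _ _ t, of _ z 0] by (intro pointwise_from_avg[OF z avg_tendsto[OF u_cont[OF t] z]]) (simp add: dt_0)

lemma u_extrapolation:
  assumes z: "z \<in> \<Omega>" and t: "0 \<le> t - 2 * \<tau>" "t \<le> T" "0 < \<tau>"
  shows "cmod (u t z - (2 * u (t - \<tau>) z - u (t - 2 * \<tau>) z)) \<le> 6 * M3 * \<tau>\<^sup>2"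
proof (rule pointwise_from_avg[OF z])
  show "(\<lambda>m. avg (1 / real (Suc m)) z (dt 0 t) - (2 * avg (1 / real (Suc m)) z (dt 0 (t - \<tau>)) - avg (1 / real (Suc m)) z (dt 0 (t - 2 * \<tau>))))
     \<longlonglongrightarrow> u t z - (2 * u (t - \<tau>) z - u (t - 2 * \<tau>) z)"
    unfolding dt_0 using t by (intro tendsto_intros avg_tendsto u_cont z) auto
  show "cmod (avg (1 / real (Suc m)) z (dt 0 t) - (2 * avg (1 / real (Suc m)) z (dt 0 (t - \<tau>)) - avg (1 / real (Suc m)) z (dt 0 (t - 2 * \<tau>)))) \<le> 6 * M3 * \<tau>\<^sup>2"
    if "fits (1 / real (Suc m)) z" for m
    by (rule second_difference_small[where F = "\<lambda>l s. avg (1 / real (Suc m)) z (dt l s)" and T = T])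
       (use that t avg_dt_deriv avg_dt_bound in auto)
qed

lemma u_increment:
  assumes z: "z \<in> \<Omega>" and t: "0 \<le> t - \<tau>" "t \<le> T" "0 < \<tau>"
  shows "cmod (u t z - u (t - \<tau>) z) \<le> M3 * \<tau>"
proof (rule pointwise_from_avg[OF z])
  show "(\<lambda>m. avg (1 / real (Suc m)) z (dt 0 t) - avg (1 / real (Suc m)) z (dt 0 (t - \<tau>))) \<longlonglongrightarrow> u t z - u (t - \<tau>) z"
    unfolding dt_0 using t by (intro tendsto_intros avg_tendsto u_cont z) auto
  show "cmod (avg (1 / real (Suc m)) z (dt 0 t) - avg (1 / real (Suc m)) z (dt 0 (t - \<tau>))) \<le> M3 * \<tau>"
    if "fits (1 / real (Suc m)) z" for m
    by (rule increment_small[where F = "\<lambda>l s. avg (1 / real (Suc m)) z (dt l s)" and T = T])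
       (use that t avg_dt_deriv avg_dt_bound in auto)
qed

text \<open>The values \<open>f(u(t))\<close> and \<open>f\<close> at the extrapolated point differ by a multiple of \<open>\<tau>\<^sup>2 |ln \<tau>|\<close>, by log-Lipschitz
  continuity with threshold \<open>\<tau>\<^sup>2\<close>.\<close>

lemma BDF2_residual:
  assumes t: "0 \<le> t - 2 * \<tau>" "t \<le> T" "0 < \<tau>" and h: "0 < h1" "0 < h2" "h1 \<le> h" "h2 \<le> h" and z: "z \<in> \<Omega>" and mem: "neighbours h1 h2 z \<subseteq> closure \<Omega>"
    and small: "\<tau> \<le> exp (- 1)" "3 * M3 * \<tau> \<le> 1"
  shows "cmod (\<i> * ((3 * u t z - 4 * u (t - \<tau>) z + u (t - 2 * \<tau>) z) / complex_of_real (2 * \<tau>))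
      + stencil_laplacian h1 h2 (u t) z
      - 2 * complex_of_real lam * zlog (2 * u (t - \<tau>) z - u (t - 2 * \<tau>) z))
    \<le> residual_const M3 M0 \<bar>lam\<bar> * (\<tau>\<^sup>2 * \<bar>ln \<tau>\<bar> + h\<^sup>2)"
proof -
  define l where "l = \<bar>ln \<tau>\<bar>"
  have "exp (- 1) < (1::real)" by simp
  then have \<tau>1: "\<tau> \<le> 1" using small by linarith
  have l: "1 \<le> l" "l = - ln \<tau>" using ln_mono[OF small(1)] t(3) \<tau>1 by (auto simp: l_def)
  have tm: "t \<in> {0..T}" "t - \<tau> \<in> {0..T}" "t - 2 * \<tau> \<in> {0..T}" using t by auto
  define p where "p = u t z"
  define q where "q = 2 * u (t - \<tau>) z - u (t - 2 * \<tau>) z"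
  have pq: "cmod (p - q) \<le> 6 * M3 * \<tau>\<^sup>2" unfolding p_def q_def by (rule u_extrapolation[OF z t])
  have B: "1 \<le> 1 / \<tau>" "3 * M3 \<le> 1 / \<tau>" using \<tau>1 t small by (auto simp: field_simps)
  have p: "cmod p \<le> 1 / \<tau>" using u_bound[OF z tm(1)] B(2) M3_nonneg by (simp add: p_def)
  have "cmod q \<le> 2 * cmod (u (t - \<tau>) z) + cmod (u (t - 2 * \<tau>) z)"
    unfolding q_def using norm_triangle_ineq4[of "2 * u (t - \<tau>) z" "u (t - 2 * \<tau>) z"] by (simp add: norm_mult)
  then have q: "cmod q \<le> 1 / \<tau>" using u_bound[OF z tm(2)] u_bound[OF z tm(3)] B(2) by linarith
  have "cmod (zlog p - zlog q) \<le> (1 + ln (1 / \<tau>) + ln (1 / \<tau>\<^sup>2)) * cmod (p - q) + 2 * \<tau>\<^sup>2"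
    using t \<tau>1 B p q by (intro zlog_diff_le) (auto simp: power_le_one)
  also have "1 + ln (1 / \<tau>) + ln (1 / \<tau>\<^sup>2) = 1 + 3 * l"
    using t by (simp add: l ln_div ln_realpow)
  also have "(1 + 3 * l) * cmod (p - q) \<le> (4 * l) * (6 * M3 * \<tau>\<^sup>2)"
    using l pq by (intro mult_mono) auto
  finally have zl: "cmod (zlog p - zlog q) \<le> 24 * M3 * (\<tau>\<^sup>2 * l) + 2 * \<tau>\<^sup>2" by (simp add: mult_ac)
  define Dm where "Dm m = (3 * avg (1 / real (Suc m)) z (dt 0 t) - 4 * avg (1 / real (Suc m)) z (dt 0 (t - \<tau>))
      + avg (1 / real (Suc m)) z (dt 0 (t - 2 * \<tau>))) / complex_of_real (2 * \<tau>)" for m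
  have Dm: "Dm \<longlonglongrightarrow> (3 * u t z - 4 * u (t - \<tau>) z + u (t - 2 * \<tau>) z) / complex_of_real (2 * \<tau>)"
    unfolding Dm_def dt_0 using t by (intro tendsto_intros avg_tendsto u_cont z tm) auto
  have Dm': "cmod (Dm m - avg (1 / real (Suc m)) z (dt 1 t)) \<le> 6 * M3 * \<tau>\<^sup>2" if "fits (1 / real (Suc m)) z" for m
    unfolding Dm_def
    by (rule BDF2_quotient_error[where F = "\<lambda>l s. avg (1 / real (Suc m)) z (dt l s)" and T = T])
       (use that t avg_dt_deriv avg_dt_bound in auto)
  note main = zlog_residual_transfer[OF stencil_consistency[OF tm(1) h(1,2) z mem Dm Dm', folded p_def] zl, unfolded q_def p_def]
  have "6 * M3 * \<tau>\<^sup>2 + 2 * M0 * (h1\<^sup>2 + h2\<^sup>2) + 2 * \<bar>lam\<bar> * (24 * M3 * (\<tau>\<^sup>2 * l) + 2 * \<tau>\<^sup>2)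
     \<le> residual_const M3 M0 \<bar>lam\<bar> * (\<tau>\<^sup>2 * l + h\<^sup>2)"
  proof -
    define R where "R = \<tau>\<^sup>2 * l"
    have R: "\<tau>\<^sup>2 \<le> R" unfolding R_def using mult_left_mono[OF l(1), of "\<tau>\<^sup>2"] by simp
    then have R0: "0 \<le> R" using zero_le_power2[of \<tau>] by linarith
    have hh: "h1\<^sup>2 + h2\<^sup>2 \<le> 2 * h\<^sup>2" using power_mono[OF h(3), of 2] power_mono[OF h(4), of 2] h by linarith
    have "6 * M3 * \<tau>\<^sup>2 \<le> 6 * M3 * R" using R M3_nonneg by (intro mult_left_mono) auto
    moreover have "2 * M0 * (h1\<^sup>2 + h2\<^sup>2) \<le> 2 * M0 * (2 * h\<^sup>2)" using hh M0_nonneg by (intro mult_left_mono) auto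
    moreover have "2 * \<bar>lam\<bar> * (24 * M3 * R + 2 * \<tau>\<^sup>2) \<le> 2 * \<bar>lam\<bar> * (24 * M3 * R + 2 * R)"
      using R by (intro mult_left_mono) auto
    moreover have "0 \<le> (1 + 4 * M0) * R" "0 \<le> (1 + 6 * M3 + 48 * \<bar>lam\<bar> * M3 + 4 * \<bar>lam\<bar>) * h\<^sup>2"
      using R0 M0_nonneg M3_nonneg by auto
    moreover have "residual_const M3 M0 \<bar>lam\<bar> * (R + h\<^sup>2) = 6 * M3 * R + 2 * M0 * (2 * h\<^sup>2) + 2 * \<bar>lam\<bar> * (24 * M3 * R + 2 * R)
        + (1 + 4 * M0) * R + (1 + 6 * M3 + 48 * \<bar>lam\<bar> * M3 + 4 * \<bar>lam\<bar>) * h\<^sup>2"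
      by (simp add: residual_const_def algebra_simps)
    ultimately show ?thesis unfolding R_def[symmetric] by linarith
  qed
  with main show ?thesis unfolding l_def by (rule order_trans)
qed

text \<open>The residual of the first step is larger, because both the difference quotient and the argument of \<open>f\<close> are
  accurate to first order only.\<close>

lemma Euler_residual:
  assumes t: "0 \<le> t - \<tau>" "t \<le> T" "0 < \<tau>" and h: "0 < h1" "0 < h2" "h1 \<le> h" "h2 \<le> h" and z: "z \<in> \<Omega>" and mem: "neighbours h1 h2 z \<subseteq> closure \<Omega>"
    and small: "\<tau> \<le> exp (- 1)" "3 * M3 * \<tau> \<le> 1"
  shows "cmod (\<i> * ((u t z - u (t - \<tau>) z) / complex_of_real \<tau>)
      + stencil_laplacian h1 h2 (u t) z
      - 2 * complex_of_real lam * zlog (u (t - \<tau>) z))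
    \<le> residual_const M3 M0 \<bar>lam\<bar> * (\<tau>\<^sup>2 * \<bar>ln \<tau>\<bar> + h\<^sup>2) / \<tau>"
proof -
  define l where "l = \<bar>ln \<tau>\<bar>"
  have "exp (- 1) < (1::real)" by simp
  then have \<tau>1: "\<tau> \<le> 1" using small by linarith
  have l: "1 \<le> l" "l = - ln \<tau>" using ln_mono[OF small(1)] t(3) \<tau>1 by (auto simp: l_def)
  have tm: "t \<in> {0..T}" "t - \<tau> \<in> {0..T}" using t by auto
  define p where "p = u t z"
  define q where "q = u (t - \<tau>) z"
  have pq: "cmod (p - q) \<le> M3 * \<tau>" unfolding p_def q_def by (rule u_increment[OF z t])
  have B: "1 \<le> 1 / \<tau>" "3 * M3 \<le> 1 / \<tau>" using \<tau>1 t small by (auto simp: field_simps)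
  have p: "cmod p \<le> 1 / \<tau>" using u_bound[OF z tm(1)] B(2) M3_nonneg by (simp add: p_def)
  have q: "cmod q \<le> 1 / \<tau>" using u_bound[OF z tm(2)] B(2) M3_nonneg by (simp add: q_def)
  have "cmod (zlog p - zlog q) \<le> (1 + ln (1 / \<tau>) + ln (1 / \<tau>)) * cmod (p - q) + 2 * \<tau>"
    using t \<tau>1 B p q by (intro zlog_diff_le) auto
  also have "1 + ln (1 / \<tau>) + ln (1 / \<tau>) = 1 + 2 * l"
    using t by (simp add: l ln_div)
  also have "(1 + 2 * l) * cmod (p - q) \<le> (3 * l) * (M3 * \<tau>)"
    using l pq by (intro mult_mono) auto
  finally have zl: "cmod (zlog p - zlog q) \<le> 3 * M3 * (\<tau> * l) + 2 * \<tau>" by (simp add: mult_ac)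
  define Dm where "Dm m = (avg (1 / real (Suc m)) z (dt 0 t) - avg (1 / real (Suc m)) z (dt 0 (t - \<tau>)))
      / complex_of_real \<tau>" for m
  have Dm: "Dm \<longlonglongrightarrow> (u t z - u (t - \<tau>) z) / complex_of_real \<tau>"
    unfolding Dm_def dt_0 using t by (intro tendsto_intros avg_tendsto u_cont z tm) auto
  have Dm': "cmod (Dm m - avg (1 / real (Suc m)) z (dt 1 t)) \<le> M3 * \<tau>" if "fits (1 / real (Suc m)) z" for m
    unfolding Dm_def
    by (rule backward_quotient_error[where F = "\<lambda>l s. avg (1 / real (Suc m)) z (dt l s)" and T = T])
       (use that t avg_dt_deriv avg_dt_bound in auto)
  note main = zlog_residual_transfer[OF stencil_consistency[OF tm(1) h(1,2) z mem Dm Dm', folded p_def] zl, unfolded q_def p_def]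
  have "M3 * \<tau> + 2 * M0 * (h1\<^sup>2 + h2\<^sup>2) + 2 * \<bar>lam\<bar> * (3 * M3 * (\<tau> * l) + 2 * \<tau>)
     \<le> residual_const M3 M0 \<bar>lam\<bar> * (\<tau>\<^sup>2 * l + h\<^sup>2) / \<tau>"
  proof -
    define R where "R = \<tau> * l"
    define H where "H = h\<^sup>2 / \<tau>"
    have R: "\<tau> \<le> R" "0 \<le> R" unfolding R_def using mult_left_mono[OF l(1), of \<tau>] l t by auto
    have H: "h\<^sup>2 \<le> H" "0 \<le> H" unfolding H_def using t \<tau>1 mult_left_mono[of \<tau> 1 "h\<^sup>2"] by (auto simp: pos_le_divide_eq)
    have hh: "h1\<^sup>2 + h2\<^sup>2 \<le> 2 * H" using power_mono[OF h(3), of 2] power_mono[OF h(4), of 2] h H by linarith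
    have e: "(\<tau>\<^sup>2 * l + h\<^sup>2) / \<tau> = R + H" using t by (simp add: R_def H_def add_divide_distrib power2_eq_square)
    have "M3 * \<tau> \<le> M3 * R" using R M3_nonneg by (intro mult_left_mono) auto
    moreover have "2 * M0 * (h1\<^sup>2 + h2\<^sup>2) \<le> 2 * M0 * (2 * H)" using hh M0_nonneg by (intro mult_left_mono) auto
    moreover have "2 * \<bar>lam\<bar> * (3 * M3 * R + 2 * \<tau>) \<le> 2 * \<bar>lam\<bar> * (3 * M3 * R + 2 * R)"
      using R by (intro mult_left_mono) auto
    moreover have "0 \<le> (1 + 4 * M0 + 5 * M3 + 42 * \<bar>lam\<bar> * M3) * R" "0 \<le> (1 + 6 * M3 + 48 * \<bar>lam\<bar> * M3 + 4 * \<bar>lam\<bar>) * H"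
      using R H M0_nonneg M3_nonneg by auto
    moreover have "residual_const M3 M0 \<bar>lam\<bar> * (R + H) = M3 * R + 2 * M0 * (2 * H) + 2 * \<bar>lam\<bar> * (3 * M3 * R + 2 * R)
        + (1 + 4 * M0 + 5 * M3 + 42 * \<bar>lam\<bar> * M3) * R + (1 + 6 * M3 + 48 * \<bar>lam\<bar> * M3 + 4 * \<bar>lam\<bar>) * H"
      by (simp add: residual_const_def algebra_simps)
    ultimately show ?thesis unfolding R_def[symmetric] times_divide_eq_right[symmetric] e by linarith
  qed
  with main show ?thesis unfolding l_def by (rule order_trans)
qed

end

section \<open>The error estimate\<close>

definition error_const :: "real \<Rightarrow> real \<Rightarrow> real \<Rightarrow> real \<Rightarrow> real \<Rightarrow> real" where
  "error_const M3 M0 L A T =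
     residual_const \<bar>M3\<bar> \<bar>M0\<bar> \<bar>L\<bar> * (1 + sqrt (laplacian_const L \<bar>A\<bar> \<bar>T\<bar>))"

lemma residual_const_ge_1: "0 \<le> M3 \<Longrightarrow> 0 \<le> M0 \<Longrightarrow> 0 \<le> L \<Longrightarrow> 1 \<le> residual_const M3 M0 L"
  by (simp add: residual_const_def)

lemma energy_le_laplacian_const:
  assumes "0 \<le> A" "0 \<le> T"
  shows "0 \<le> energy_const lam A T" "energy_const lam A T \<le> laplacian_const lam A T" "0 \<le> laplacian_const lam A T"
proof -
  show e: "0 \<le> energy_const lam A T" using assms by (simp add: energy_const_def)
  have "0 \<le> 4 * A * (4 * \<bar>lam\<bar> + 1)\<^sup>2" using assms by simp
  then show "energy_const lam A T \<le> laplacian_const lam A T" using e by (simp add: laplacian_const_def)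
  then show "0 \<le> laplacian_const lam A T" using e by simp
qed

lemma error_const_pos: "0 < error_const M3 M0 L A T"
  unfolding error_const_def using residual_const_ge_1[of "\<bar>M3\<bar>" "\<bar>M0\<bar>" "\<bar>L\<bar>"] energy_le_laplacian_const(3)[of "\<bar>A\<bar>" "\<bar>T\<bar>" L]
  by (intro mult_pos_pos) (auto intro: add_pos_nonneg)

text \<open>The smallness conditions under which stability and consistency hold. Each left-hand side tends to \<open>0\<close> with \<open>\<tau>\<close>;
  \<open>\<tau>\<^sub>0\<close> may depend on everything, in contrast to \<open>error_const\<close>.\<close>

lemma small_time_step:
  fixes lam M c :: real
  shows "\<exists>\<tau>0>0. \<forall>\<tau>. 0 < \<tau> \<and> \<tau> \<le> \<tau>0 \<longrightarrow> \<tau> \<le> exp (- 1) \<and> 2304 * lam\<^sup>2 * \<tau> * (ln \<tau>)\<^sup>2 \<le> 1 \<and>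
     3 * M * \<tau> ^ 3 + 3 * \<tau> \<le> 1 \<and> 3 * M * \<tau> \<le> 1 \<and> c * \<tau>\<^sup>2 \<le> 1"
proof -
  have l0: "((\<lambda>\<tau>::real. \<tau> * (ln \<tau>)\<^sup>2) \<longlongrightarrow> 0) (at_right 0)" by real_asymp
  have l1: "((\<lambda>\<tau>::real. 2304 * lam\<^sup>2 * (\<tau> * (ln \<tau>)\<^sup>2)) \<longlongrightarrow> 2304 * lam\<^sup>2 * 0) (at_right 0)"
    by (intro tendsto_intros l0)
  have l2: "((\<lambda>\<tau>::real. 3 * M * \<tau> ^ 3 + 3 * \<tau>) \<longlongrightarrow> 3 * M * 0 ^ 3 + 3 * 0) (at_right 0)"
    by (intro tendsto_intros)
  have l3: "((\<lambda>\<tau>::real. 3 * M * \<tau>) \<longlongrightarrow> 3 * M * 0) (at_right 0)" by (intro tendsto_intros)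
  have l4: "((\<lambda>\<tau>::real. c * \<tau>\<^sup>2) \<longlongrightarrow> c * 0\<^sup>2) (at_right 0)" by (intro tendsto_intros)
  have l5: "((\<lambda>\<tau>::real. \<tau>) \<longlongrightarrow> 0) (at_right 0)" by (intro tendsto_intros)
  have "\<forall>\<^sub>F \<tau> in at_right (0::real). \<tau> < exp (- 1) \<and> 2304 * lam\<^sup>2 * (\<tau> * (ln \<tau>)\<^sup>2) < 1 \<and>
     3 * M * \<tau> ^ 3 + 3 * \<tau> < 1 \<and> 3 * M * \<tau> < 1 \<and> c * \<tau>\<^sup>2 < 1"
    using order_tendstoD(2)[OF l1, of 1] order_tendstoD(2)[OF l2, of 1] order_tendstoD(2)[OF l3, of 1]
      order_tendstoD(2)[OF l4, of 1] order_tendstoD(2)[OF l5, of "exp (- 1)"]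
    by (auto simp: eventually_conj_iff)
  then obtain b where b: "0 < b" "\<And>\<tau>. 0 < \<tau> \<Longrightarrow> \<tau> < b \<Longrightarrow> \<tau> < exp (- 1) \<and> 2304 * lam\<^sup>2 * (\<tau> * (ln \<tau>)\<^sup>2) < 1 \<and>
     3 * M * \<tau> ^ 3 + 3 * \<tau> < 1 \<and> 3 * M * \<tau> < 1 \<and> c * \<tau>\<^sup>2 < 1"
    unfolding eventually_at_right_field by blast
  show ?thesis
  proof (intro exI[of _ "b / 2"] conjI allI impI)
    show "0 < b / 2" using b by simp
    fix \<tau> assume "0 < \<tau> \<and> \<tau> \<le> b / 2"
    then have "0 < \<tau>" "\<tau> < b" using b by auto
    note s = b(2)[OF this]
    show "\<tau> \<le> exp (- 1)" "3 * M * \<tau> ^ 3 + 3 * \<tau> \<le> 1" "3 * M * \<tau> \<le> 1" "c * \<tau>\<^sup>2 \<le> 1" using s by auto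
    show "2304 * lam\<^sup>2 * \<tau> * (ln \<tau>)\<^sup>2 \<le> 1" using s by (simp add: mult.assoc)
  qed
qed

context smooth_logSE_solution
begin

lemma measure_\<Omega>: "measure lebesgue \<Omega> = (b - a) * (d - c)"
  using ab cd by (simp add: \<Omega> rectangle_eq_box measure_lborel_box_eq Basis_prod_def prod.reindex mult.commute)

lemma frontier_zero:
  assumes "t \<in> {0..T}" "z \<in> closure \<Omega>" "fst z = a \<or> fst z = b \<or> snd z = c \<or> snd z = d"
  shows "u t z = 0"
proof -
  have "open \<Omega>" by (simp add: \<Omega> rectangle_eq_box open_box)
  then have "z \<in> frontier \<Omega>" using assms by (auto simp: frontier_def interior_open mem_\<Omega>)
  then show ?thesis using sol assms by (simp add: logSE_solution_def)
qed

text \<open>The residuals are bounded by \<open>r = residual_const * (\<tau>\<^sup>2 |ln \<tau>| + h\<^sup>2)\<close>, and by \<open>r / \<tau>\<close> in the first step; stability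
  turns this into the estimates of the squared norms.\<close>

theorem error_estimate:
  fixes N J K :: nat and U :: "nat \<Rightarrow> grid_fun"
  assumes NJK: "0 < N" "0 < J" "0 < K"
  defines "\<tau> \<equiv> T / real N" and "hx \<equiv> (b - a) / real J" and "hy \<equiv> (d - c) / real K"
  defines "h \<equiv> max hx hy"
  assumes U: "BDF2_solution lam \<tau> hx hy N J K (\<lambda>j k. u0 (a + real j * hx, c + real k * hy)) U"
    and h1: "h \<le> 1"
    and small: "\<tau> \<le> exp (- 1)" "2304 * lam\<^sup>2 * \<tau> * (ln \<tau>)\<^sup>2 \<le> 1" "3 * M3 * \<tau> ^ 3 + 3 * \<tau> \<le> 1" "3 * M3 * \<tau> \<le> 1"
      "(measure lebesgue \<Omega> * laplacian_const lam (measure lebesgue \<Omega>) T * (2 * residual_const M3 M0 \<bar>lam\<bar>)\<^sup>2) * \<tau>\<^sup>2 \<le> 1"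
    and n: "n \<le> N"
  shows "grid_norm hx hy J K (\<lambda>j k. u (real n * \<tau>) (a + real j * hx, c + real k * hy) - U n j k)
       \<le> error_const M3 M0 \<bar>lam\<bar> (measure lebesgue \<Omega>) T * (\<tau>\<^sup>2 * \<bar>ln \<tau>\<bar> + h\<^sup>2)"
    and "grid_seminorm1 hx hy J K (\<lambda>j k. u (real n * \<tau>) (a + real j * hx, c + real k * hy) - U n j k)
       \<le> error_const M3 M0 \<bar>lam\<bar> (measure lebesgue \<Omega>) T * \<tau> powr (- 1 / 2) * (\<tau>\<^sup>2 * \<bar>ln \<tau>\<bar> + h\<^sup>2)"
proof -
  define A where "A = measure lebesgue \<Omega>"
  define v where "v n j k = u (real n * \<tau>) (a + real j * hx, c + real k * hy)" for n j k
  define K1 where "K1 = residual_const M3 M0 \<bar>lam\<bar>"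
  define \<rho> where "\<rho> = \<tau>\<^sup>2 * \<bar>ln \<tau>\<bar> + h\<^sup>2"
  define r where "r = K1 * \<rho>"
  have pos: "0 < \<tau>" "0 < hx" "0 < hy" using NJK T ab cd by (auto simp: \<tau>_def hx_def hy_def)
  have hb: "hx \<le> h" "hy \<le> h" by (auto simp: h_def)
  have Nt: "real N * \<tau> = T" "real J * hx = b - a" "real K * hy = d - c"
    using NJK by (auto simp: \<tau>_def hx_def hy_def)
  have A: "A = (hx * real J) * (hy * real K)" using Nt by (simp add: A_def measure_\<Omega> mult.commute)
  have A0: "0 \<le> A" by (simp add: A_def)
  have K1: "1 \<le> K1" unfolding K1_def by (intro residual_const_ge_1 M3_nonneg M0_nonneg) auto
  have "exp (- 1) < (1::real)" by simp
  then have \<tau>1: "\<tau> \<le> 1" using small by linarith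
  define l where "l = \<bar>ln \<tau>\<bar>"
  have l: "1 \<le> l" "l = - ln \<tau>" using ln_mono[OF small(1)] pos \<tau>1 by (auto simp: l_def)
  have \<tau>l: "\<tau> * l \<le> 1"
    using ln_le_minus_one[of "1 / \<tau>"] pos by (simp add: l ln_div field_simps)
  have \<rho>_ge: "\<tau>\<^sup>2 \<le> \<rho>"
    using mult_left_mono[OF l(1), of "\<tau>\<^sup>2"] unfolding \<rho>_def l_def[symmetric] by (simp add: add_increasing2)
  have \<rho>0: "0 \<le> \<rho>" by (simp add: \<rho>_def)
  have \<rho>2: "\<rho> \<le> 2"
  proof -
    have "\<tau>\<^sup>2 * l = \<tau> * (\<tau> * l)" by (simp add: power2_eq_square)
    also have "\<dots> \<le> 1 * 1"
    proof (intro mult_mono \<tau>l \<tau>1)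
      show "0 \<le> \<tau> * l" using pos(1) l(1) by (intro mult_nonneg_nonneg; linarith)
    qed simp
    finally have "\<tau>\<^sup>2 * l \<le> 1" by simp
    moreover have "h\<^sup>2 \<le> 1" using h1 pos hb by (intro power_le_one) auto
    ultimately show ?thesis by (simp add: \<rho>_def l_def)
  qed
  have time: "real m * \<tau> \<in> {0..T}" if "m \<le> N" for m
    using that pos Nt(1) mult_right_mono[of "real m" "real N" \<tau>] by auto
  have gx: "real j * hx \<le> b - a" if "j \<le> J" for j
    using that pos Nt(2) mult_right_mono[of "real j" "real J" hx] by auto
  have gy: "real k * hy \<le> d - c" if "k \<le> K" for k
    using that pos Nt(3) mult_right_mono[of "real k" "real K" hy] by auto
  have grid: "(a + real j * hx, c + real k * hy) \<in> closure \<Omega>" if "j \<le> J" "k \<le> K" for j k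
    using gx[OF that(1)] gy[OF that(2)] pos by (auto simp: mem_closure_\<Omega>)
  define node where "node j k = (a + real j * hx, c + real k * hy)" for j k
  have inner: "node j k \<in> \<Omega>" "neighbours hx hy (node j k) \<subseteq> closure \<Omega>"
    if jk: "j \<in> {1..<J}" "k \<in> {1..<K}" for j k
  proof -
    have "real (j + 1) * hx \<le> b - a" "real (k + 1) * hy \<le> d - c" using jk by (intro gx gy; simp)+
    moreover have "1 * hx \<le> real j * hx" "1 * hy \<le> real k * hy" using jk pos by (intro mult_right_mono; simp)+
    ultimately show "node j k \<in> \<Omega>" "neighbours hx hy (node j k) \<subseteq> closure \<Omega>"
      using pos by (auto simp: node_def neighbours_def mem_\<Omega> mem_closure_\<Omega> distrib_right)
  qed
  have v: "v m j k = u (real m * \<tau>) (node j k)" for m j k by (simp add: v_def node_def)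
  have lap: "grid_laplacian hx hy (v m) j k = stencil_laplacian hx hy (u (real m * \<tau>)) (node j k)"
    if jk: "j \<in> {1..<J}" "k \<in> {1..<K}" for m j k
  proof -
    have "a + real (j + 1) * hx = a + real j * hx + hx" "a + real (j - 1) * hx = a + real j * hx - hx"
      "c + real (k + 1) * hy = c + real k * hy + hy" "c + real (k - 1) * hy = c + real k * hy - hy"
      using jk by (simp_all add: of_nat_diff algebra_simps)
    then show ?thesis unfolding grid_laplacian_def stencil_laplacian_def v node_def by (simp only: fst_conv snd_conv)
  qed
  have space0: "v m \<in> grid_space0 J K" if m: "m \<le> N" for m
    unfolding grid_space0_def
  proof (intro CollectI allI impI)
    fix j k assume jk: "j \<le> J" "k \<le> K" "j = 0 \<or> j = J \<or> k = 0 \<or> k = K"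
    show "v m j k = 0"
      unfolding v_def using jk Nt by (intro frontier_zero time[OF m] grid) auto
  qed
  have v_le: "cmod (v m j k) \<le> M3" if "m \<le> N" "j \<in> {1..<J}" "k \<in> {1..<K}" for m j k
    unfolding v using that by (intro u_bound inner time) auto
  have res1: "cmod (\<i> * ((v 1 j k - v 0 j k) / complex_of_real \<tau>) + grid_laplacian hx hy (v 1) j k
        - 2 * complex_of_real lam * zlog (v 0 j k)) \<le> r / \<tau>"
    if "1 \<le> N" "j \<in> {1..<J}" "k \<in> {1..<K}" for j k
  proof -
    have e: "real 0 * \<tau> = real 1 * \<tau> - \<tau>" by simp
    show ?thesis unfolding lap[OF that(2,3)] v e r_def K1_def \<rho>_def
      using time[of 1] that pos hb small inner[OF that(2,3)] by (intro Euler_residual) auto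
  qed
  have res: "cmod (\<i> * ((3 * v (m + 1) j k - 4 * v m j k + v (m - 1) j k) / complex_of_real (2 * \<tau>))
          + grid_laplacian hx hy (v (m + 1)) j k
        - 2 * complex_of_real lam * zlog (2 * v m j k - v (m - 1) j k)) \<le> r"
    if m: "m \<in> {1..<N}" and jk: "j \<in> {1..<J}" "k \<in> {1..<K}" for m j k
  proof -
    have e: "real m * \<tau> = real (m + 1) * \<tau> - \<tau>" "real (m - 1) * \<tau> = real (m + 1) * \<tau> - 2 * \<tau>"
      using m by (simp_all add: of_nat_diff algebra_simps)
    have "0 \<le> real (m + 1) * \<tau> - 2 * \<tau>" unfolding e(2)[symmetric] using pos by simp
    then show ?thesis unfolding lap[OF jk] v e r_def K1_def \<rho>_def
      using time[of "m + 1"] m pos hb small inner[OF jk] by (intro BDF2_residual) auto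
  qed
  have u_init: "v 0 j k = u0 (a + real j * hx, c + real k * hy)" if "j \<le> J" "k \<le> K" for j k
    using sol grid[OF that] by (simp add: v_def logSE_solution_def)
  have U': "BDF2_solution lam \<tau> hx hy N J K (v 0) U"
  proof -
    have "U 0 j k = v 0 j k" if "j \<le> J" "k \<le> K" for j k
      using U that u_init[OF that] unfolding BDF2_solution_def by metis
    then show ?thesis using U unfolding BDF2_solution_def by blast
  qed
  have r: "\<tau>\<^sup>2 \<le> r" using mult_mono[OF K1 \<rho>_ge] K1 \<rho>0 by (simp add: r_def)
  have r0: "0 \<le> r" using K1 \<rho>0 by (simp add: r_def)
  have small4: "A * laplacian_const lam A T * r\<^sup>2 * \<tau>\<^sup>2 \<le> 1"
  proof -
    have "r \<le> 2 * K1" using mult_left_mono[OF \<rho>2, of K1] K1 by (simp add: r_def)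
    then have "r\<^sup>2 \<le> (2 * K1)\<^sup>2" using r0 by (intro power_mono) auto
    then have "A * laplacian_const lam A T * r\<^sup>2 * \<tau>\<^sup>2 \<le> A * laplacian_const lam A T * (2 * K1)\<^sup>2 * \<tau>\<^sup>2"
      using A0 energy_le_laplacian_const(3)[of A T lam] T by (intro mult_right_mono mult_left_mono) auto
    then show ?thesis using small(5) by (simp add: A_def K1_def)
  qed
  have stab: "(grid_norm hx hy J K (\<lambda>j k. v n j k - U n j k))\<^sup>2 \<le> energy_const lam A T * r\<^sup>2"
    "\<tau> * (grid_seminorm1 hx hy J K (\<lambda>j k. v n j k - U n j k))\<^sup>2 \<le> laplacian_const lam A T * r\<^sup>2"
    using BDF2_stability[where v = v and U = U and M = M3 and n = n and N = N and r = r,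
        OF NJK(2,3) pos(2,3,1) M3_nonneg space0 v_le res1 res U' r small(1,2,3)
          small4[unfolded A Nt(1)[symmetric]] n]
    unfolding A Nt(1)[symmetric] by blast+
  define s where "s = sqrt (laplacian_const lam A T)"
  have lc: "0 \<le> laplacian_const lam A T" "energy_const lam A T \<le> laplacian_const lam A T"
    using energy_le_laplacian_const[of A T lam] A0 T by auto
  have s: "0 \<le> s" "s\<^sup>2 = laplacian_const lam A T" using lc by (auto simp: s_def)
  have const: "error_const M3 M0 \<bar>lam\<bar> A T = K1 * (1 + s)"
    using M3_nonneg M0_nonneg A0 T
    by (simp add: error_const_def K1_def s_def laplacian_const_def energy_const_def)
  have sr: "s * r \<le> error_const M3 M0 \<bar>lam\<bar> A T * \<rho>"
  proof -
    have "s * r \<le> (1 + s) * r" using r0 by (intro mult_right_mono) auto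
    then show ?thesis by (simp add: const r_def mult_ac)
  qed
  have "grid_norm hx hy J K (\<lambda>j k. v n j k - U n j k) \<le> s * r"
  proof (rule power2_le_imp_le)
    have "energy_const lam A T * r\<^sup>2 \<le> laplacian_const lam A T * r\<^sup>2" using lc by (intro mult_right_mono) auto
    then show "(grid_norm hx hy J K (\<lambda>j k. v n j k - U n j k))\<^sup>2 \<le> (s * r)\<^sup>2"
      using stab(1) by (simp add: power_mult_distrib s)
  qed (use s r0 in auto)
  then show "grid_norm hx hy J K (\<lambda>j k. u (real n * \<tau>) (a + real j * hx, c + real k * hy) - U n j k)
       \<le> error_const M3 M0 \<bar>lam\<bar> (measure lebesgue \<Omega>) T * (\<tau>\<^sup>2 * \<bar>ln \<tau>\<bar> + h\<^sup>2)"
    using sr unfolding v_def A_def \<rho>_def by linarith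
  have "sqrt \<tau> * grid_seminorm1 hx hy J K (\<lambda>j k. v n j k - U n j k) \<le> s * r"
  proof (rule power2_le_imp_le)
    show "(sqrt \<tau> * grid_seminorm1 hx hy J K (\<lambda>j k. v n j k - U n j k))\<^sup>2 \<le> (s * r)\<^sup>2"
      using stab(2) pos by (simp add: power_mult_distrib s)
  qed (use s r0 in auto)
  then have "sqrt \<tau> * grid_seminorm1 hx hy J K (\<lambda>j k. v n j k - U n j k) \<le> error_const M3 M0 \<bar>lam\<bar> A T * \<rho>"
    using sr by linarith
  then have "grid_seminorm1 hx hy J K (\<lambda>j k. v n j k - U n j k) \<le> error_const M3 M0 \<bar>lam\<bar> A T * \<rho> / sqrt \<tau>"
    using pos by (simp add: pos_le_divide_eq mult.commute)
  also have "\<dots> = error_const M3 M0 \<bar>lam\<bar> A T * \<tau> powr (- 1 / 2) * \<rho>"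
    using pos by (simp add: powr_minus_divide powr_half_sqrt)
  finally show "grid_seminorm1 hx hy J K (\<lambda>j k. u (real n * \<tau>) (a + real j * hx, c + real k * hy) - U n j k)
       \<le> error_const M3 M0 \<bar>lam\<bar> (measure lebesgue \<Omega>) T * \<tau> powr (- 1 / 2) * (\<tau>\<^sup>2 * \<bar>ln \<tau>\<bar> + h\<^sup>2)"
    unfolding v_def A_def \<rho>_def .
qed

end

theorem theorem3p2:
  shows "\<exists>Cu :: real \<Rightarrow> real \<Rightarrow> real \<Rightarrow> real \<Rightarrow> real \<Rightarrow> real \<Rightarrow> real.
    (\<forall>M3 M2 M0 L A T. 0 < Cu M3 M2 M0 L A T) \<and>
    (\<forall>(a::real) (b::real) (c::real) (d::real) (\<Omega>::(real \<times> real) set) (lam::real) (T::real)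
       (u0::real \<times> real \<Rightarrow> complex) (u::real \<Rightarrow> real \<times> real \<Rightarrow> complex) (C::real).
      a < b \<and> c < d \<and> \<Omega> = rectangle a b c d \<and> lam \<noteq> 0 \<and>
      0 < T \<and> ereal T < max_existence_time \<Omega> lam u0 \<and> logSE_solution \<Omega> lam u0 T u \<and>
      u \<in> Cm_time 3 T (Linf \<Omega>) (Linf_norm \<Omega>) \<and>
      u \<in> Cm_time 2 T (Wk_inf \<Omega> 2) (Wk_inf_norm \<Omega> 2) \<and>
      u \<in> Cm_time 0 T (W4_H10 \<Omega>) (W4_H10_norm \<Omega>)
      \<longrightarrow>
      (\<exists>h0>0. \<exists>\<tau>0>0. \<forall>(N::nat) (J::nat) (K::nat) (\<tau>::real) (hx::real) (hy::real) (h::real)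
         (U::nat \<Rightarrow> nat \<Rightarrow> nat \<Rightarrow> complex) (e::nat \<Rightarrow> nat \<Rightarrow> nat \<Rightarrow> complex) (Cst::real).
        0 < N \<and> 0 < J \<and> 0 < K \<and>
        \<tau> = T / real N \<and> hx = (b - a) / real J \<and> hy = (d - c) / real K \<and> h = max hx hy \<and>
        h \<le> C * min hx hy \<and>
        0 < h \<and> h \<le> h0 \<and> 0 < \<tau> \<and> \<tau> \<le> \<tau>0 \<and>
        BDF2_solution lam \<tau> hx hy N J K (\<lambda>j k. u0 (a + real j * hx, c + real k * hy)) U \<and>
        e = (\<lambda>n j k. u (real n * \<tau>) (a + real j * hx, c + real k * hy) - U n j k) \<and>
        Cst = Cu (Cm_time_norm 3 T (Linf \<Omega>) (Linf_norm \<Omega>) u)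
                 (Cm_time_norm 2 T (Wk_inf \<Omega> 2) (Wk_inf_norm \<Omega> 2) u)
                 (Cm_time_norm 0 T (W4_H10 \<Omega>) (W4_H10_norm \<Omega>) u)
                 \<bar>lam\<bar> (measure lebesgue \<Omega>) T
        \<longrightarrow>
        (\<forall>n\<le>N.
           grid_norm hx hy J K (e n) \<le> Cst * (\<tau>\<^sup>2 * \<bar>ln \<tau>\<bar> + h\<^sup>2) \<and>
           grid_seminorm1 hx hy J K (e n) \<le> Cst * \<tau> powr (-1/2) * (\<tau>\<^sup>2 * \<bar>ln \<tau>\<bar> + h\<^sup>2))))"
proof (intro exI[of _ "\<lambda>M3 M2 M0 L A T. error_const M3 M0 L A T"] conjI allI impI error_const_pos)
  fix a b c d :: real and \<Omega> :: "(real \<times> real) set" and lam T :: real and u0 :: field2 and u :: "real \<Rightarrow> field2" and C :: real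
  assume asm: "a < b \<and> c < d \<and> \<Omega> = rectangle a b c d \<and> lam \<noteq> 0 \<and>
      0 < T \<and> ereal T < max_existence_time \<Omega> lam u0 \<and> logSE_solution \<Omega> lam u0 T u \<and>
      u \<in> Cm_time 3 T (Linf \<Omega>) (Linf_norm \<Omega>) \<and>
      u \<in> Cm_time 2 T (Wk_inf \<Omega> 2) (Wk_inf_norm \<Omega> 2) \<and>
      u \<in> Cm_time 0 T (W4_H10 \<Omega>) (W4_H10_norm \<Omega>)"
  interpret S: smooth_logSE_solution a b c d \<Omega> lam T u0 u
    using asm by unfold_locales auto
  obtain \<tau>0 where \<tau>0: "0 < \<tau>0" and small: "\<And>\<tau>. 0 < \<tau> \<Longrightarrow> \<tau> \<le> \<tau>0 \<Longrightarrow>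
     \<tau> \<le> exp (- 1) \<and> 2304 * lam\<^sup>2 * \<tau> * (ln \<tau>)\<^sup>2 \<le> 1 \<and> 3 * S.M3 * \<tau> ^ 3 + 3 * \<tau> \<le> 1 \<and> 3 * S.M3 * \<tau> \<le> 1 \<and>
     (measure lebesgue \<Omega> * laplacian_const lam (measure lebesgue \<Omega>) T * (2 * residual_const S.M3 S.M0 \<bar>lam\<bar>)\<^sup>2) * \<tau>\<^sup>2 \<le> 1"
    using small_time_step[of lam S.M3 "measure lebesgue \<Omega> * laplacian_const lam (measure lebesgue \<Omega>) T * (2 * residual_const S.M3 S.M0 \<bar>lam\<bar>)\<^sup>2"]
    by blast
  show "\<exists>h0>0. \<exists>\<tau>0>0. \<forall>(N::nat) (J::nat) (K::nat) (\<tau>::real) (hx::real) (hy::real) (h::real)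
         (U::nat \<Rightarrow> nat \<Rightarrow> nat \<Rightarrow> complex) (e::nat \<Rightarrow> nat \<Rightarrow> nat \<Rightarrow> complex) (Cst::real).
        0 < N \<and> 0 < J \<and> 0 < K \<and>
        \<tau> = T / real N \<and> hx = (b - a) / real J \<and> hy = (d - c) / real K \<and> h = max hx hy \<and>
        h \<le> C * min hx hy \<and>
        0 < h \<and> h \<le> h0 \<and> 0 < \<tau> \<and> \<tau> \<le> \<tau>0 \<and>
        BDF2_solution lam \<tau> hx hy N J K (\<lambda>j k. u0 (a + real j * hx, c + real k * hy)) U \<and>
        e = (\<lambda>n j k. u (real n * \<tau>) (a + real j * hx, c + real k * hy) - U n j k) \<and>
        Cst = error_const (Cm_time_norm 3 T (Linf \<Omega>) (Linf_norm \<Omega>) u)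
                 (Cm_time_norm 0 T (W4_H10 \<Omega>) (W4_H10_norm \<Omega>) u)
                 \<bar>lam\<bar> (measure lebesgue \<Omega>) T
        \<longrightarrow>
        (\<forall>n\<le>N.
           grid_norm hx hy J K (e n) \<le> Cst * (\<tau>\<^sup>2 * \<bar>ln \<tau>\<bar> + h\<^sup>2) \<and>
           grid_seminorm1 hx hy J K (e n) \<le> Cst * \<tau> powr (-1/2) * (\<tau>\<^sup>2 * \<bar>ln \<tau>\<bar> + h\<^sup>2))"
    \<comment> \<open>\<open>h\<^sub>0 = 1\<close> suffices: together with \<open>\<tau>\<^sup>2 |ln \<tau>| \<le> 1\<close> it bounds \<open>\<tau>\<^sup>2 |ln \<tau>| + h\<^sup>2\<close> by \<open>2\<close>.\<close>
  proof (rule exI[of _ 1], rule conjI, simp, rule exI[of _ \<tau>0], intro conjI allI impI \<tau>0)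
    fix N J K :: nat and \<tau> hx hy h Cst :: real and U e :: "nat \<Rightarrow> grid_fun" and n :: nat
    assume H: "0 < N \<and> 0 < J \<and> 0 < K \<and>
        \<tau> = T / real N \<and> hx = (b - a) / real J \<and> hy = (d - c) / real K \<and> h = max hx hy \<and>
        h \<le> C * min hx hy \<and>
        0 < h \<and> h \<le> 1 \<and> 0 < \<tau> \<and> \<tau> \<le> \<tau>0 \<and>
        BDF2_solution lam \<tau> hx hy N J K (\<lambda>j k. u0 (a + real j * hx, c + real k * hy)) U \<and>
        e = (\<lambda>n j k. u (real n * \<tau>) (a + real j * hx, c + real k * hy) - U n j k) \<and>
        Cst = error_const (Cm_time_norm 3 T (Linf \<Omega>) (Linf_norm \<Omega>) u)
                 (Cm_time_norm 0 T (W4_H10 \<Omega>) (W4_H10_norm \<Omega>) u)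
                 \<bar>lam\<bar> (measure lebesgue \<Omega>) T" and n: "n \<le> N"
    have e: "e n = (\<lambda>j k. u (real n * \<tau>) (a + real j * hx, c + real k * hy) - U n j k)" using H by auto
    have Cst: "Cst = error_const S.M3 S.M0 \<bar>lam\<bar> (measure lebesgue \<Omega>) T"
      using H by (simp add: S.M3_def S.M0_def)
    have NJK: "0 < N" "0 < J" "0 < K" and \<tau>: "\<tau> = T / real N" "0 < \<tau>" "\<tau> \<le> \<tau>0" and hx: "hx = (b - a) / real J"
      and hy: "hy = (d - c) / real K" and h: "h = max hx hy" "h \<le> 1"
      and U: "BDF2_solution lam \<tau> hx hy N J K (\<lambda>j k. u0 (a + real j * hx, c + real k * hy)) U"
      using H by auto
    note s = small[OF \<tau>(2,3)]
    note est = S.error_estimate[OF NJK, folded \<tau>(1) hx hy, folded h(1), OF U h(2)]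
    show "grid_norm hx hy J K (e n) \<le> Cst * (\<tau>\<^sup>2 * \<bar>ln \<tau>\<bar> + h\<^sup>2)"
      unfolding e Cst using s by (intro est(1) n) auto
    show "grid_seminorm1 hx hy J K (e n) \<le> Cst * \<tau> powr (-1/2) * (\<tau>\<^sup>2 * \<bar>ln \<tau>\<bar> + h\<^sup>2)"
      unfolding e Cst using s by (intro est(2) n) auto
  qed
qed

end
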